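(* Let $K:\mathcal X\to\mathcal Y$ be a compact operator with dense range between infinite-dimensional Hilbert spaces, $\|K\|\le 1$, and let $x^\dagger=K^+y^\dagger$ with $y^\dagger\in\mathcal R(K)$. Let $\tau>1$ and let $x^\delta_{k^\delta_{\mathrm{dp}},m^\delta_{\mathrm{dp}}}$ be the output of the modified discrepancy principle for Landweber iteration (described in the context), applied to $y^\delta=y^\dagger+\delta Z$ with $Z$ white noise. Then for any $\varepsilon>0$, $$\mathbb P\left(\|x^\delta_{k^\delta_{\mathrm{dp}},m^\delta_{\mathrm{dp}}}-x^\dagger\|\le\varepsilon\right)\to 1\qquad\text{as }\delta\to 0,$$ i.e. $x^\delta_{k^\delta_{\mathrm{dp}},m^\delta_{\mathrm{dp}}}$ converges to $x^\dagger$ in probability.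
   Context: $\mathbb N=\{1,2,\dots\}$. $K^+$ is the Moore–Penrose inverse of $K$ and $\mathcal R(K)$ its range. The singular value decomposition $(\sigma_j,v_j,u_j)_{j\in\mathbb N}$ of $K$ satisfies $\sigma_1\ge\sigma_2\ge\dots>0$, $(u_j)$ and $(v_j)$ are orthonormal bases of $\mathcal Y$ and $\mathcal N(K)^\perp$ (orthogonal complement of the null space), $Kv_j=\sigma_ju_j$, $K^*u_j=\sigma_jv_j$. Noise: $y^\delta=y^\dagger+\delta Z$ with noise level $\delta>0$, where $Z$ is centered white noise with finite second moments, i.e. a family of real random variables $(Z,y)$, linear in $y\in\mathcal Y$, such that for all $y,y'\in\mathcal Y$: $\mathbb E[(Z,y)]=0$, $\mathbb E[(Z,y)(Z,y')]=(y,y')$, and $(Z,y)\stackrel{d}{=}\frac{\|y\|}{\|y'\|}(Z,y')$ (for $y'\neq0$). One writes $(y^\delta,u_j)=(y^\dagger,u_j)+\delta(Z,u_j)$. Landweber iteration: $P_m=\sum_{j=1}^m(u_j,\cdot)u_j$, and $x^\delta_{0,m}=0$, $x^\delta_{k+1,m}=x^\delta_{k,m}-(P_mK)^*(P_mKx^\delta_{k,m}-P_my^\delta)$; equivalently $x^\delta_{k,m}=\sum_{j=1}^m\frac{1-(1-\sigma_j^2)^k}{\sigma_j}(y^\delta,u_j)v_j$. Discrepancy principle: for fixed $\tau>1$, $k^\delta_{\mathrm{dp}}(m)=\min\{k\in\mathbb N:\|P_mKx^\delta_{k,m}-P_my^\delta\|\le\tau\sqrt m\,\delta\}$. Modified discrepancy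 principle: set $m^1=\min\{m\ge1: k^\delta_{\mathrm{dp}}(m)\ge\max_{m'\ge1}k^\delta_{\mathrm{dp}}(m')\}$ and, for $n\ge2$, $m^n=\min\{m>m^{n-1}: k^\delta_{\mathrm{dp}}(m)\ge\max_{m'>m^{n-1}}k^\delta_{\mathrm{dp}}(m')\}$. Let $$I_n=\frac{\|P_{m^n}Kx^\delta_{2k^\delta_{\mathrm{dp}}(m^n),m^n}-P_{m^n}y^\delta\|}{\|P_{m^n}Kx^\delta_{k^\delta_{\mathrm{dp}}(m^n),m^n}-P_{m^n}y^\delta\|}$$ (with $0/0:=0$), $n_*=\min\{n\in\mathbb N: I_n\ge\frac1{2\tau e^4}\}$, $m^\delta_{\mathrm{dp}}=m^{n_*}$, $k^\delta_{\mathrm{dp}}=k^\delta_{\mathrm{dp}}(m^\delta_{\mathrm{dp}})$. The output is $x^\delta_{k^\delta_{\mathrm{dp}},m^\delta_{\mathrm{dp}}}$; events involving it include that the procedure is well defined and terminates.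
   Formalization: The formal theorem additionally assumes that the noise coordinates (Z,u_j), j≥1, are independent; with only the listed white-noise properties the claim fails, e.g. Z=RG with G Gaussian white noise and R an independent random scale with E R²=1 that exceeds τ with positive probability. *)

theory Defs
  imports "HOL-Probability.Probability"
begin

definition compact_operator :: "('x::real_normed_vector \<Rightarrow> 'y::real_normed_vector) \<Rightarrow> bool" where
  "compact_operator K \<longleftrightarrow> bounded_linear K \<and> compact (closure (K ` cball 0 1))"

definition infinite_dimensional :: "'x::real_vector itself \<Rightarrow> bool" where
  "infinite_dimensional _ \<longleftrightarrow> \<not> (\<exists>B::'x set. finite B \<and> span B = UNIV)"

definition null_space :: "('x \<Rightarrow> 'y::zero) \<Rightarrow> 'x set" where
  "null_space K = {x. K x = 0}"

text \<open>The Moore--Penrose inverse is the linear extension of the inverse of \<open>K\<close> restricted to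
  \<open>N(K)\<^sup>\<bottom>\<close> to \<open>R(K) + R(K)\<^sup>\<bottom>\<close> that vanishes on \<open>R(K)\<^sup>\<bottom>\<close>; outside this domain the value below
  is meaningless.\<close>
definition moore_penrose :: "('x::real_inner \<Rightarrow> 'y::real_inner) \<Rightarrow> 'y \<Rightarrow> 'x" where
  "moore_penrose K y =
     (THE x. x \<in> orthogonal_comp (null_space K) \<and> y - K x \<in> orthogonal_comp (range K))"

text \<open>All sequences are indexed by the positive integers; their values at index \<open>0\<close> are irrelevant.\<close>
definition orthonormal_basis :: "(nat \<Rightarrow> 'x::real_inner) \<Rightarrow> 'x set \<Rightarrow> bool" where
  "orthonormal_basis e S \<longleftrightarrow>
     (\<forall>i\<ge>1. \<forall>j\<ge>1. e i \<bullet> e j = (if i = j then 1 else 0)) \<and> closure (span (e ` {1..})) = S"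

definition singular_value_decomposition ::
  "('x::real_inner \<Rightarrow> 'y::real_inner) \<Rightarrow> (nat \<Rightarrow> real) \<Rightarrow> (nat \<Rightarrow> 'x) \<Rightarrow> (nat \<Rightarrow> 'y) \<Rightarrow> bool" where
  "singular_value_decomposition K \<sigma> v u \<longleftrightarrow>
     (\<forall>j\<ge>1. 0 < \<sigma> j \<and> \<sigma> (Suc j) \<le> \<sigma> j) \<and>
     orthonormal_basis u UNIV \<and>
     orthonormal_basis v (orthogonal_comp (null_space K)) \<and>
     (\<forall>j\<ge>1. K (v j) = \<sigma> j *\<^sub>R u j \<and> adjoint K (u j) = \<sigma> j *\<^sub>R v j)"

text \<open>\<open>Z y\<close> is the random variable \<open>(Z, y)\<close>. Linearity is an identity between random variables and
  hence holds almost surely. Integrability is explicit because the Bochner integral of a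
  non-integrable function is \<open>0\<close>; the products are integrable by the Cauchy--Schwarz inequality.
  Note that uncorrelated coordinates need not be independent, e.g. for \<open>Z = R G\<close> with \<open>G\<close>
  Gaussian white noise and \<open>R\<close> an independent scalar with second moment \<open>1\<close>.\<close>
definition white_noise :: "'w measure \<Rightarrow> ('y::real_inner \<Rightarrow> 'w \<Rightarrow> real) \<Rightarrow> bool" where
  "white_noise M Z \<longleftrightarrow>
     (\<forall>y. Z y \<in> borel_measurable M) \<and>
     (\<forall>a b y y'. AE \<omega> in M. Z (a *\<^sub>R y + b *\<^sub>R y') \<omega> = a * Z y \<omega> + b * Z y' \<omega>) \<and>
     (\<forall>y. integrable M (\<lambda>\<omega>. (Z y \<omega>)\<^sup>2)) \<and>
     (\<forall>y. integral\<^sup>L M (Z y) = 0) \<and>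
     (\<forall>y y'. integral\<^sup>L M (\<lambda>\<omega>. Z y \<omega> * Z y' \<omega>) = y \<bullet> y') \<and>
     (\<forall>y y'. y' \<noteq> 0 \<longrightarrow>
        distr M borel (Z y) = distr M borel (\<lambda>\<omega>. norm y / norm y' * Z y' \<omega>))"

text \<open>Noisy data are not elements of the Hilbert space: only the pairings \<open>(y\<^sup>\<delta>, y)\<close> make sense.\<close>
definition noisy_data :: "'y::real_inner \<Rightarrow> real \<Rightarrow> ('y \<Rightarrow> 'w \<Rightarrow> real) \<Rightarrow> 'w \<Rightarrow> 'y \<Rightarrow> real" where
  "noisy_data y\<^sub>0 \<delta> Z \<omega> = (\<lambda>y. y\<^sub>0 \<bullet> y + \<delta> * Z y \<omega>)"

definition proj :: "(nat \<Rightarrow> 'y::real_inner) \<Rightarrow> nat \<Rightarrow> 'y \<Rightarrow> 'y" where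
  "proj u m y = (\<Sum>j\<in>{1..m}. (u j \<bullet> y) *\<^sub>R u j)"

definition proj_data :: "(nat \<Rightarrow> 'y::real_inner) \<Rightarrow> nat \<Rightarrow> ('y \<Rightarrow> real) \<Rightarrow> 'y" where
  "proj_data u m d = (\<Sum>j\<in>{1..m}. d (u j) *\<^sub>R u j)"

primrec landweber ::
  "('x::real_inner \<Rightarrow> 'y::real_inner) \<Rightarrow> (nat \<Rightarrow> 'y) \<Rightarrow> ('y \<Rightarrow> real) \<Rightarrow> nat \<Rightarrow> nat \<Rightarrow> 'x" where
  "landweber K u d m 0 = 0"
| "landweber K u d m (Suc k) = landweber K u d m k
     - adjoint (\<lambda>x. proj u m (K x)) (proj u m (K (landweber K u d m k)) - proj_data u m d)"

definition residual ::
  "('x::real_inner \<Rightarrow> 'y::real_inner) \<Rightarrow> (nat \<Rightarrow> 'y) \<Rightarrow> ('y \<Rightarrow> real) \<Rightarrow> nat \<Rightarrow> nat \<Rightarrow> real" where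
  "residual K u d m k = norm (proj u m (K (landweber K u d m k)) - proj_data u m d)"

text \<open>For \<open>m \<ge> 1\<close> and \<open>\<delta> > 0\<close> the minimum exists, since \<open>0 < \<sigma>\<^sub>j \<le> 1\<close> forces the residual to
  tend to \<open>0\<close> as \<open>k\<close> grows.\<close>
definition k_dp ::
  "('x::real_inner \<Rightarrow> 'y::real_inner) \<Rightarrow> (nat \<Rightarrow> 'y) \<Rightarrow> real \<Rightarrow> real \<Rightarrow> ('y \<Rightarrow> real) \<Rightarrow> nat \<Rightarrow> nat" where
  "k_dp K u \<tau> \<delta> d m = (LEAST k. 1 \<le> k \<and> residual K u d m k \<le> \<tau> * sqrt (real m) * \<delta>)"

definition least_option :: "(nat \<Rightarrow> bool) \<Rightarrow> nat option" where
  "least_option P = (if \<exists>n. P n then Some (LEAST n. P n) else None)"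

text \<open>The indices \<open>m\<^sup>n\<close> for a given function \<open>k\<close> of the truncation level, with \<open>m\<^sup>0 = 0\<close>.
  The maximum over all \<open>m' > m\<^sup>n\<close> need not exist; the image is a set of naturals, so it exists
  iff the image is finite. The value is \<open>None\<close> if \<open>m\<^sup>n\<close> is not defined.\<close>
primrec m_seq :: "(nat \<Rightarrow> nat) \<Rightarrow> nat \<Rightarrow> nat option" where
  "m_seq k 0 = Some 0"
| "m_seq k (Suc n) = Option.bind (m_seq k n)
     (\<lambda>p. least_option (\<lambda>m. p < m \<and> finite (k ` {p<..}) \<and> Max (k ` {p<..}) \<le> k m))"

text \<open>Division by zero yields \<open>0\<close>, in particular \<open>0 / 0 = 0\<close>; a vanishing denominator implies a
  vanishing numerator.\<close>
definition ratio ::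
  "('x::real_inner \<Rightarrow> 'y::real_inner) \<Rightarrow> (nat \<Rightarrow> 'y) \<Rightarrow> real \<Rightarrow> real \<Rightarrow> ('y \<Rightarrow> real) \<Rightarrow> nat \<Rightarrow> real" where
  "ratio K u \<tau> \<delta> d m =
     residual K u d m (2 * k_dp K u \<tau> \<delta> d m) / residual K u d m (k_dp K u \<tau> \<delta> d m)"

definition n_stop ::
  "('x::real_inner \<Rightarrow> 'y::real_inner) \<Rightarrow> (nat \<Rightarrow> 'y) \<Rightarrow> real \<Rightarrow> real \<Rightarrow> ('y \<Rightarrow> real) \<Rightarrow> nat option" where
  "n_stop K u \<tau> \<delta> d = least_option (\<lambda>n. 1 \<le> n \<and>
     (\<exists>m. m_seq (k_dp K u \<tau> \<delta> d) n = Some m \<and> 1 / (2 * \<tau> * exp 4) \<le> ratio K u \<tau> \<delta> d m))"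

definition m_dp ::
  "('x::real_inner \<Rightarrow> 'y::real_inner) \<Rightarrow> (nat \<Rightarrow> 'y) \<Rightarrow> real \<Rightarrow> real \<Rightarrow> ('y \<Rightarrow> real) \<Rightarrow> nat option" where
  "m_dp K u \<tau> \<delta> d = Option.bind (n_stop K u \<tau> \<delta> d) (m_seq (k_dp K u \<tau> \<delta> d))"

text \<open>\<open>None\<close> means that the procedure is not well defined or does not terminate.\<close>
definition modified_dp_output ::
  "('x::real_inner \<Rightarrow> 'y::real_inner) \<Rightarrow> (nat \<Rightarrow> 'y) \<Rightarrow> real \<Rightarrow> real \<Rightarrow> ('y \<Rightarrow> real) \<Rightarrow> 'x option" where
  "modified_dp_output K u \<tau> \<delta> d =
     map_option (\<lambda>m. landweber K u d m (k_dp K u \<tau> \<delta> d m)) (m_dp K u \<tau> \<delta> d)"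

end

theory Submission
  imports Defs
begin

text \<open>
  The convergence holds along almost every path of the noise, and this gives convergence in
  probability. The coordinates \<open>z\<^sub>j = (Z, u\<^sub>j)\<close> are independent and, by the scaling property of white
  noise, identically distributed with second moment \<open>1\<close>. Hence almost surely the means
  \<open>(z\<^sub>1\<^sup>2 + \<dots> + z\<^sub>m\<^sup>2) / m\<close> tend to \<open>1\<close>, by the strong law of large numbers
  (\<open>strong_law_of_large_numbers_nonneg\<close>, proved by Etemadi's method). For a fixed path with this
  property the limit \<open>\<delta> \<rightarrow> 0\<close> is a deterministic question (\<open>selected_error_small\<close>).

  In the singular basis put \<open>q\<^sub>j = 1 - \<sigma>\<^sub>j\<^sup>2\<close>, \<open>\<xi>\<^sub>j = (x\<^sub>0, v\<^sub>j)\<close> and \<open>y\<^sub>j = \<sigma>\<^sub>j \<xi>\<^sub>j\<close>. The squared residual at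
  level \<open>m\<close> after \<open>k\<close> steps is the sum of \<open>q\<^sub>j\<^bsup>2k\<^esup> (y\<^sub>j + \<delta> z\<^sub>j)\<^sup>2\<close> over \<open>j \<le> m\<close>. Let \<open>m\<close> be the selected
  level, \<open>k\<close> its stopping index, and \<open>p\<close> the level visited just before \<open>m\<close>. Then no level beyond \<open>p\<close>
  stops later than \<open>k\<close>, and \<open>p\<close> is \<open>0\<close> or was rejected by the ratio test. The argument has three parts.

  \<^item> If \<open>m\<close> and \<open>k\<close> are both large, the error is small (\<open>error_small_if_both_large\<close>). Before stopping the
    residual exceeds the noise level, so the signal part of the residual dominates \<open>m \<delta>\<^sup>2\<close>. That
    part, the sum of \<open>q\<^sub>j\<^bsup>2(k-1)\<^esup> \<sigma>\<^sub>j\<^sup>2 \<xi>\<^sub>j\<^sup>2\<close>, is \<open>o(1/k)\<close>, so \<open>k m \<delta>\<^sup>2\<close> is small, and it bounds the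
    propagated noise up to a constant.

  \<^item> A large \<open>k\<close> forces a large \<open>m\<close> (\<open>accepted_k_stop_bounded\<close>): the ratio at \<open>m\<close> is at most
    \<open>q\<^sub>m\<^sup>k\<close>, so a low level with large \<open>k\<close> fails the test.

  \<^item> If some \<open>q\<^sub>j y\<^sub>j\<close> is nonzero, then \<open>k \<rightarrow> \<infinity>\<close> (\<open>selected_k_stop_large\<close>). Every fixed level \<open>l \<ge> j\<close> has
    a stopping index that tends to \<open>\<infinity>\<close>, so if \<open>k\<close> stayed bounded, \<open>p\<close> would exceed every fixed level
    and would have been rejected. But such a \<open>p\<close> passes the test. If its stopping index is bounded,
    the noise alone keeps the residual of order \<open>\<delta> \<surd>p\<close> up to twice that index
    (\<open>accepted_if_k_stop_bounded\<close>). If its stopping index is large, the stopping index drops sharply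
    from \<open>p\<close> to \<open>p + 1\<close>, so the squared residual at level \<open>p\<close> loses at most half over a long range of
    steps, and by log-convexity it decreases no faster afterwards (\<open>accepted_before_drop\<close>).

  If all \<open>q\<^sub>j y\<^sub>j\<close> vanish, the residuals after the first step are pure noise, so the selection does not
  depend on \<open>\<delta>\<close> and the error is of order \<open>\<delta>\<close>.
\<close>

section \<open>The strong law of large numbers\<close>

lemma sum_split_at:
  fixes f :: "nat \<Rightarrow> 'a::comm_monoid_add"
  assumes "i \<le> p"
  shows "(\<Sum>j=1..p. f j) = (\<Sum>j=1..i. f j) + (\<Sum>j\<in>{i<..p}. f j)"
proof -
  have "{1..p} = {1..i} \<union> {i<..p}" using assms by auto
  then show ?thesis by (simp only:) (rule sum.union_disjoint, auto)
qed

lemma cesaro_mean_tendsto: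
  fixes a :: "nat \<Rightarrow> real"
  assumes "a \<longlonglongrightarrow> l"
  shows "(\<lambda>n. (\<Sum>i=1..n. a i) / real n) \<longlonglongrightarrow> l"
proof (rule LIMSEQ_I)
  fix e :: real assume "0 < e"
  from LIMSEQ_D[OF assms, of "e/2"] \<open>0 < e\<close>
  obtain N where N: "\<And>i. i \<ge> N \<Longrightarrow> norm (a i - l) < e/2" by auto
  define C where "C = (\<Sum>i=1..N. \<bar>a i - l\<bar>)"
  have C0: "C \<ge> 0" by (simp add: C_def sum_nonneg)
  obtain N' where N': "real N' > 2 * C / e" using reals_Archimedean2 by blast
  show "\<exists>no. \<forall>n\<ge>no. norm ((\<Sum>i=1..n. a i) / real n - l) < e"
  proof (intro exI allI impI)
    fix n assume n: "n \<ge> max 1 (max N N')"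
    have "(\<Sum>i=1..n. a i) / real n - l = (\<Sum>i=1..n. a i - l) / real n"
      using n by (simp add: sum_subtractf field_simps)
    moreover have "\<bar>\<Sum>i=1..n. a i - l\<bar> < real n * e"
    proof -
      have "\<bar>\<Sum>i=1..n. a i - l\<bar> \<le> (\<Sum>i=1..n. \<bar>a i - l\<bar>)" by (rule sum_abs)
      also have "\<dots> = C + (\<Sum>i\<in>{N<..n}. \<bar>a i - l\<bar>)"
        unfolding C_def using n by (intro sum_split_at) simp
      finally have 1: "\<bar>\<Sum>i=1..n. a i - l\<bar> \<le> C + (\<Sum>i\<in>{N<..n}. \<bar>a i - l\<bar>)" .
      have "(\<Sum>i\<in>{N<..n}. \<bar>a i - l\<bar>) \<le> (\<Sum>i\<in>{N<..n}. e/2)"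
        using N by (intro sum_mono) (force intro: less_imp_le)
      also have "\<dots> \<le> real n * (e/2)" using \<open>0 < e\<close> n by (simp add: field_simps)
      finally have 2: "(\<Sum>i\<in>{N<..n}. \<bar>a i - l\<bar>) \<le> real n * (e/2)" .
      have "C + real n * (e/2) < real n * e"
      proof -
        have "2 * C / e < real n" using N' n by (simp add: order_less_le_trans)
        then show ?thesis using \<open>0 < e\<close> by (simp add: field_simps)
      qed
      with 1 2 show ?thesis by linarith
    qed
    ultimately show "norm ((\<Sum>i=1..n. a i) / real n - l) < e"
      using n by (simp add: field_simps)
  qed
qed

text \<open>The minimum of \<open>\<alpha>\<^bsup>-2n\<^esup>\<close> and \<open>1 / i\<^sup>2\<close> is nonincreasing in \<open>n\<close>, and its decrements dominate
  the summands up to the factor \<open>1 - 1/\<alpha>\<^sup>2\<close>, so the sum telescopes.\<close>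
lemma sum_tail_inverse_geometric_le:
  fixes \<alpha> :: real and i :: real
  assumes "\<alpha> > 1" "i > 0"
  shows "(\<Sum>n<N. if i \<le> \<alpha> ^ n then 1 / (\<alpha>^n)\<^sup>2 else 0) \<le> 1 / (1 - 1/\<alpha>\<^sup>2) / i\<^sup>2"
proof -
  define b where "b = 1 / \<alpha>\<^sup>2"
  have b: "0 < b" "b < 1" using assms by (auto simp: b_def power_strict_mono one_less_power)
  have bn: "1 / (\<alpha>^n)\<^sup>2 = b ^ n" for n by (simp add: b_def power_divide power_mult[symmetric] mult.commute)
  define g where "g n = min (b ^ n) (1 / i\<^sup>2)" for n
  have "(if i \<le> \<alpha> ^ n then 1 / (\<alpha>^n)\<^sup>2 else 0) * (1 - b) \<le> g n - g (Suc n)" for n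
  proof (cases "i \<le> \<alpha> ^ n")
    case True
    then have "i\<^sup>2 \<le> (\<alpha>^n)\<^sup>2" using assms by (intro power_mono) auto
    then have "b ^ n \<le> 1 / i\<^sup>2" unfolding bn[symmetric] using assms by (intro divide_left_mono) auto
    moreover have "b ^ Suc n \<le> b ^ n" using b by (simp add: mult_left_le_one_le)
    ultimately show ?thesis using True b by (simp add: g_def bn algebra_simps)
  next
    case False
    have "b ^ Suc n \<le> b ^ n" using b by (simp add: mult_left_le_one_le)
    with False show ?thesis by (auto simp: g_def)
  qed
  then have "(\<Sum>n<N. (if i \<le> \<alpha> ^ n then 1 / (\<alpha>^n)\<^sup>2 else 0) * (1 - b)) \<le> (\<Sum>n<N. g n - g (Suc n))"
    by (intro sum_mono)
  also have "\<dots> = g 0 - g N" by (rule sum_lessThan_telescope')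
  also have "\<dots> \<le> 1 / i\<^sup>2"
  proof -
    have "g 0 \<le> 1 / i\<^sup>2" "g N \<ge> 0" using b by (auto simp: g_def)
    then show ?thesis by linarith
  qed
  finally have "(\<Sum>n<N. if i \<le> \<alpha> ^ n then 1 / (\<alpha>^n)\<^sup>2 else 0) * (1 - b) \<le> 1 / i\<^sup>2"
    by (simp add: sum_distrib_right)
  then show ?thesis using b assms unfolding b_def[symmetric] by (simp add: field_simps)
qed

text \<open>For variables distributed like \<open>X\<close>, truncated at their index, this makes the sum of the
  second moments divided by \<open>i\<^sup>2\<close> at most \<open>2 E X\<close>. A first moment is thus enough for the variance bound in
  the strong law. The sum telescopes in the same way as the previous one.\<close>
lemma sum_truncated_squares_le:
  fixes x :: real
  assumes "x \<ge> 0"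
  shows "(\<Sum>i=1..n. (if x \<le> real i then x else 0)\<^sup>2 / (real i)\<^sup>2) \<le> 2 * x"
proof (cases "x = 0")
  case False
  with assms have x: "x > 0" by simp
  define g where "g i = min (1 / real i) (1 / x)" for i
  have "(if x \<le> real i then x else 0)\<^sup>2 / (real i)\<^sup>2 \<le> 2 * x\<^sup>2 * (g i - g (Suc i))" if "i \<ge> 1" for i
  proof (cases "x \<le> real i")
    case True
    have "1 / (real i)\<^sup>2 \<le> 2 * (1 / real i - 1 / real (Suc i))"
    proof -
      have "1 / real i - 1 / real (Suc i) = 1 / (real i * real (Suc i))"
        using that by (simp add: field_simps)
      moreover have "1 / (real i)\<^sup>2 \<le> 2 / (real i * real (Suc i))"
      proof -
        have "1 / (real i)\<^sup>2 = 2 / (real i * (2 * real i))" using that by (simp add: power2_eq_square)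
        also have "\<dots> \<le> 2 / (real i * real (Suc i))"
          using that by (intro divide_left_mono mult_left_mono mult_pos_pos) auto
        finally show ?thesis .
      qed
      ultimately show ?thesis by simp
    qed
    moreover have "g i = 1 / real i" "g (Suc i) = 1 / real (Suc i)"
      using True x that by (auto simp: g_def min_def field_simps)
    ultimately have "1 / (real i)\<^sup>2 \<le> 2 * (g i - g (Suc i))" by simp
    then have "x\<^sup>2 * (1 / (real i)\<^sup>2) \<le> x\<^sup>2 * (2 * (g i - g (Suc i)))"
      by (intro mult_left_mono) auto
    with True show ?thesis by (simp add: algebra_simps)
  next
    case False
    have "g (Suc i) \<le> g i" using that x unfolding g_def by (intro min.mono divide_left_mono) auto
    with False show ?thesis by simp
  qed
  then have "(\<Sum>i=1..n. (if x \<le> real i then x else 0)\<^sup>2 / (real i)\<^sup>2) \<le> (\<Sum>i=1..n. 2 * x\<^sup>2 * (g i - g (Suc i)))"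
    by (intro sum_mono) auto
  also have "\<dots> = 2 * x\<^sup>2 * (\<Sum>i=1..n. g i - g (Suc i))" by (simp add: sum_distrib_left)
  also have "(\<Sum>i=1..n. g i - g (Suc i)) = g 1 - g (Suc n)"
    using sum_Suc_diff[of 1 n "\<lambda>i. - g i"] by simp
  also have "2 * x\<^sup>2 * (g 1 - g (Suc n)) \<le> 2 * x\<^sup>2 * (1 / x)"
  proof (rule mult_left_mono)
    have "g 1 \<le> 1 / x" "g (Suc n) \<ge> 0" using x by (auto simp: g_def)
    then show "g 1 - g (Suc n) \<le> 1 / x" by linarith
  qed simp
  also have "\<dots> = 2 * x" using x by (simp add: power2_eq_square)
  finally show ?thesis .
qed simp

text \<open>After integration: the probabilities that \<open>X\<close> exceeds \<open>i\<close> have sum at most \<open>E X\<close>.\<close>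
lemma sum_indicator_less_le:
  fixes x :: real
  assumes "x \<ge> 0"
  shows "(\<Sum>i=1..n. if real i < x then 1 else 0 :: real) \<le> x"
proof -
  have "(\<Sum>i=1..n. if real i < x then 1 else 0 :: real) = real (card {i\<in>{1..n}. real i < x})"
    by (simp add: sum.If_cases Int_def)
  also have "card {i\<in>{1..n}. real i < x} \<le> card {1..nat \<lfloor>x\<rfloor>}"
    by (intro card_mono) (auto simp: le_nat_iff le_floor_iff)
  then have "real (card {i\<in>{1..n}. real i < x}) \<le> real (nat \<lfloor>x\<rfloor>)" by simp
  also have "\<dots> \<le> x" using assms by simp
  finally show ?thesis .
qed

definition geometric_floor :: "real \<Rightarrow> nat \<Rightarrow> nat" where
  "geometric_floor \<alpha> n = nat \<lfloor>\<alpha> ^ n\<rfloor>"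

lemma geometric_floor_bounds:
  assumes "\<alpha> > 1"
  shows "real (geometric_floor \<alpha> n) \<le> \<alpha> ^ n" "\<alpha> ^ n < real (geometric_floor \<alpha> n) + 1" "geometric_floor \<alpha> n \<ge> 1" "\<alpha> ^ n \<le> 2 * real (geometric_floor \<alpha> n)"
proof -
  have 1: "\<alpha> ^ n \<ge> 1" using assms by simp
  then show a: "real (geometric_floor \<alpha> n) \<le> \<alpha> ^ n" "\<alpha> ^ n < real (geometric_floor \<alpha> n) + 1"
    by (auto simp: geometric_floor_def)
  show b: "geometric_floor \<alpha> n \<ge> 1" using 1 by (simp add: geometric_floor_def le_nat_iff)
  from b have "real (geometric_floor \<alpha> n) \<ge> 1" by linarith
  with a show "\<alpha> ^ n \<le> 2 * real (geometric_floor \<alpha> n)" by linarith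
qed

lemma filterlim_geometric_floor:
  assumes "\<alpha> > 1"
  shows "filterlim (geometric_floor \<alpha>) at_top sequentially"
proof -
  have "filterlim (\<lambda>n. \<alpha> ^ n) at_top sequentially" using assms by (intro filterlim_at_infinity_imp_filterlim_at_top filterlim_realpow_sequentially_gt1) auto
  then have "filterlim (\<lambda>n. -1 + \<alpha> ^ n) at_top sequentially"
    by (intro filterlim_tendsto_add_at_top[OF tendsto_const])
  then have "filterlim (\<lambda>n. real (geometric_floor \<alpha> n)) at_top sequentially"
    by (rule filterlim_at_top_mono) (use geometric_floor_bounds(2)[OF assms] in \<open>auto intro!: always_eventually simp: less_imp_le algebra_simps\<close>)
  then show ?thesis by (simp add: filterlim_sequentially_iff_filterlim_real)
qed

lemma geometric_floor_quotient_tendsto: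
  assumes "\<alpha> > 1"
  shows "(\<lambda>n. real (geometric_floor \<alpha> (Suc n)) / real (geometric_floor \<alpha> n)) \<longlonglongrightarrow> \<alpha>"
proof -
  have q: "(\<lambda>n. real (geometric_floor \<alpha> n) / \<alpha> ^ n) \<longlonglongrightarrow> 1"
  proof (rule tendsto_sandwich[OF _ _ _ tendsto_const])
    show "(\<lambda>n. 1 - (1/\<alpha>) ^ n) \<longlonglongrightarrow> 1"
      using tendsto_diff[OF tendsto_const LIMSEQ_realpow_zero[of "1/\<alpha>"], of 1] assms by simp
    show "\<forall>\<^sub>F n in sequentially. 1 - (1/\<alpha>) ^ n \<le> real (geometric_floor \<alpha> n) / \<alpha> ^ n"
    proof (intro always_eventually allI)
      fix n
      have "\<alpha> ^ n - 1 \<le> real (geometric_floor \<alpha> n)" using geometric_floor_bounds(2)[OF assms, of n] by linarith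
      then have "(\<alpha> ^ n - 1) / \<alpha> ^ n \<le> real (geometric_floor \<alpha> n) / \<alpha> ^ n" using assms by (intro divide_right_mono) auto
      then show "1 - (1/\<alpha>) ^ n \<le> real (geometric_floor \<alpha> n) / \<alpha> ^ n" using assms by (simp add: diff_divide_distrib power_divide)
    qed
    show "\<forall>\<^sub>F n in sequentially. real (geometric_floor \<alpha> n) / \<alpha> ^ n \<le> 1"
      using geometric_floor_bounds(1)[OF assms] assms by (intro always_eventually) simp
  qed
  have "(\<lambda>n. \<alpha> * ((real (geometric_floor \<alpha> (Suc n)) / \<alpha> ^ Suc n) / (real (geometric_floor \<alpha> n) / \<alpha> ^ n))) \<longlonglongrightarrow> \<alpha> * (1 / 1)"
    by (intro tendsto_mult tendsto_divide tendsto_const q LIMSEQ_Suc[OF q]) simp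
  then show ?thesis using assms by simp
qed

text \<open>A monotone sequence is controlled between consecutive points of a geometric subsequence of ratio
  \<open>\<alpha>\<close> up to the factor \<open>\<alpha>\<close>, and \<open>\<alpha> = 1 + 1/(r+1)\<close> is arbitrarily close to \<open>1\<close>. Countably many ratios
  are used so that they can be combined almost surely.\<close>
lemma mean_tendsto_if_geometric_means_tendsto:
  fixes S :: "nat \<Rightarrow> real"
  assumes mono: "mono S" and S0: "S 0 \<ge> 0"
    and lim: "\<And>r::nat. (\<lambda>n. S (geometric_floor (1 + 1 / real (Suc r)) n) / real (geometric_floor (1 + 1 / real (Suc r)) n)) \<longlonglongrightarrow> \<mu>"
  shows "(\<lambda>n. S n / real n) \<longlonglongrightarrow> \<mu>"
proof -
  have Spos: "S n \<ge> 0" for n using monoD[OF mono, of 0 n] S0 by simp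
  have squeeze: "\<forall>\<^sub>F n in sequentially. \<mu> / (1 + 1 / real (Suc r)) - e \<le> S n / real n \<and> S n / real n \<le> \<mu> * (1 + 1 / real (Suc r)) + e"
    if e: "e > 0" for e :: real and r
  proof -
    define \<alpha> where "\<alpha> = 1 + 1 / real (Suc r)"
    have \<alpha>: "\<alpha> > 1" by (simp add: \<alpha>_def)
    define k where "k = geometric_floor \<alpha>"
    have k1: "k j \<ge> 1" for j unfolding k_def using geometric_floor_bounds(3)[OF \<alpha>] .
    have limk: "(\<lambda>n. S (k n) / real (k n)) \<longlonglongrightarrow> \<mu>" using lim[of r] by (simp add: k_def \<alpha>_def)
    have quot: "(\<lambda>n. real (k (Suc n)) / real (k n)) \<longlonglongrightarrow> \<alpha>"
      unfolding k_def by (rule geometric_floor_quotient_tendsto[OF \<alpha>])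
    have "(\<lambda>j. S (k j) / real (k j) / (real (k (Suc j)) / real (k j))) \<longlonglongrightarrow> \<mu> / \<alpha>"
      using \<alpha> by (intro tendsto_divide limk quot) auto
    then have lo: "\<forall>\<^sub>F j in sequentially. \<mu> / \<alpha> - e < S (k j) / real (k j) / (real (k (Suc j)) / real (k j))"
      by (rule order_tendstoD) (use e in simp)
    have "(\<lambda>j. S (k (Suc j)) / real (k (Suc j)) * (real (k (Suc j)) / real (k j))) \<longlonglongrightarrow> \<mu> * \<alpha>"
      by (intro tendsto_mult LIMSEQ_Suc[OF limk] quot)
    then have hi: "\<forall>\<^sub>F j in sequentially. S (k (Suc j)) / real (k (Suc j)) * (real (k (Suc j)) / real (k j)) < \<mu> * \<alpha> + e"
      by (rule order_tendstoD) (use e in simp)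
    from eventually_conj[OF lo hi] obtain J where J: "\<And>j. j \<ge> J \<Longrightarrow>
        \<mu> / \<alpha> - e < S (k j) / real (k j) / (real (k (Suc j)) / real (k j)) \<and>
        S (k (Suc j)) / real (k (Suc j)) * (real (k (Suc j)) / real (k j)) < \<mu> * \<alpha> + e"
      unfolding eventually_sequentially by blast
    have "\<mu> / \<alpha> - e \<le> S n / real n \<and> S n / real n \<le> \<mu> * \<alpha> + e" if n: "real n \<ge> \<alpha> ^ J" for n
    proof -
      have n1: "real n \<ge> 1" using n \<alpha> one_le_power[of \<alpha> J] by linarith
      have ex: "\<exists>j. real n < \<alpha> ^ j" using real_arch_pow[OF \<alpha>] by blast
      define i where "i = (LEAST j. real n < \<alpha> ^ j)"
      have i1: "real n < \<alpha> ^ i" unfolding i_def using LeastI_ex[OF ex] .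
      have iJ: "i > J" using i1 n \<alpha> by (metis linorder_not_le order_less_le_trans order_less_irrefl power_increasing less_imp_le)
      obtain j where j: "i = Suc j" using iJ by (cases i) auto
      have "\<not> real n < \<alpha> ^ j" using not_less_Least[of j "\<lambda>j. real n < \<alpha> ^ j"] j unfolding i_def by simp
      then have "\<alpha> ^ j \<le> real n" by simp
      then have kj: "k j \<le> n" using geometric_floor_bounds(1)[OF \<alpha>, of j] unfolding k_def by linarith
      have kj': "n \<le> k (Suc j)" using geometric_floor_bounds(2)[OF \<alpha>, of "Suc j"] i1 unfolding k_def j by linarith
      have pos: "real (k j) > 0" "real (k (Suc j)) > 0" using k1[of j] k1[of "Suc j"] by auto
      have "\<mu> / \<alpha> - e < S (k j) / real (k (Suc j))" using J[of j] iJ j pos by simp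
      also have "\<dots> \<le> S n / real n"
        using monoD[OF mono kj] kj' n1 Spos pos by (intro frac_le) auto
      finally have 1: "\<mu> / \<alpha> - e \<le> S n / real n" by simp
      have "S n / real n \<le> S (k (Suc j)) / real (k j)"
        using monoD[OF mono kj'] kj n1 Spos pos by (intro frac_le) auto
      also have "\<dots> < \<mu> * \<alpha> + e" using J[of j] iJ j pos by simp
      finally show ?thesis using 1 by simp
    qed
    moreover have "\<forall>\<^sub>F n in sequentially. real n \<ge> \<alpha> ^ J"
      using filterlim_real_sequentially unfolding filterlim_at_top by blast
    ultimately show ?thesis unfolding \<alpha>_def[symmetric] by (rule eventually_mono[rotated])
  qed
  have a1: "(\<lambda>r. \<mu> * (1 + 1 / real (Suc r))) \<longlonglongrightarrow> \<mu> * (1 + 0)"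
    by (intro tendsto_intros) (use LIMSEQ_inverse_real_of_nat in \<open>simp add: inverse_eq_divide\<close>)
  have a2: "(\<lambda>r. \<mu> / (1 + 1 / real (Suc r))) \<longlonglongrightarrow> \<mu> / (1 + 0)"
    by (intro tendsto_intros) (use LIMSEQ_inverse_real_of_nat in \<open>simp_all add: inverse_eq_divide\<close>)
  show ?thesis
  proof (rule order_tendstoI)
    fix a assume a: "a < \<mu>"
    then have "\<forall>\<^sub>F r in sequentially. (a + \<mu>) / 2 < \<mu> / (1 + 1 / real (Suc r))"
      by (intro order_tendstoD[OF a2]) auto
    then obtain r where r: "(a + \<mu>) / 2 < \<mu> / (1 + 1 / real (Suc r))"
      unfolding eventually_sequentially by blast
    have "x - (\<mu> - a) / 2 > a" if "(a + \<mu>) / 2 < x" for x using that by (simp add: field_simps)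
    from this[OF r] have "\<mu> / (1 + 1 / real (Suc r)) - (\<mu> - a) / 2 > a" .
    with squeeze[of "(\<mu> - a) / 2" r] a show "\<forall>\<^sub>F n in sequentially. a < S n / real n"
      by (auto elim!: eventually_mono simp del: of_nat_Suc)
  next
    fix a assume a: "\<mu> < a"
    then have "\<forall>\<^sub>F r in sequentially. \<mu> * (1 + 1 / real (Suc r)) < (a + \<mu>) / 2"
      by (intro order_tendstoD[OF a1]) auto
    then obtain r where r: "\<mu> * (1 + 1 / real (Suc r)) < (a + \<mu>) / 2"
      unfolding eventually_sequentially by blast
    have "x + (a - \<mu>) / 2 < a" if "x < (a + \<mu>) / 2" for x using that by (simp add: field_simps)
    from this[OF r] have "\<mu> * (1 + 1 / real (Suc r)) + (a - \<mu>) / 2 < a" .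
    with squeeze[of "(a - \<mu>) / 2" r] a show "\<forall>\<^sub>F n in sequentially. S n / real n < a"
      by (auto elim!: eventually_mono simp del: of_nat_Suc)
  qed
qed

text \<open>Independence removes the mixed terms, and each variance is at most the second moment.\<close>
lemma (in prob_space) expectation_square_centered_sum_le:
  fixes Y :: "nat \<Rightarrow> 'a \<Rightarrow> real"
  assumes fin: "finite I" and indep: "indep_vars (\<lambda>_. borel) Y I"
    and sq: "\<And>i. i \<in> I \<Longrightarrow> integrable M (\<lambda>\<omega>. (Y i \<omega>)\<^sup>2)"
  shows "integrable M (\<lambda>\<omega>. (\<Sum>i\<in>I. Y i \<omega> - expectation (Y i))\<^sup>2)"
    and "expectation (\<lambda>\<omega>. (\<Sum>i\<in>I. Y i \<omega> - expectation (Y i))\<^sup>2) \<le> (\<Sum>i\<in>I. expectation (\<lambda>\<omega>. (Y i \<omega>)\<^sup>2))"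
proof -
  define W where "W = (\<lambda>i \<omega>. Y i \<omega> - expectation (Y i))"
  have meas[measurable]: "Y i \<in> borel_measurable M" if "i \<in> I" for i
    using indep that by (auto simp: indep_vars_def)
  have int: "integrable M (Y i)" if "i \<in> I" for i
    using square_integrable_imp_integrable[OF meas[OF that] sq[OF that]] .
  have intW: "integrable M (W i)" and EW: "expectation (W i) = 0" if "i \<in> I" for i
    using int[OF that] by (auto simp: W_def prob_space)
  have sqW: "integrable M (\<lambda>\<omega>. (W i \<omega>)\<^sup>2)" if "i \<in> I" for i
    using int[OF that] sq[OF that] unfolding W_def by (simp add: power2_diff)
  have EsqW: "expectation (\<lambda>\<omega>. (W i \<omega>)\<^sup>2) \<le> expectation (\<lambda>\<omega>. (Y i \<omega>)\<^sup>2)" if "i \<in> I" for i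
    unfolding W_def using variance_eq[OF int[OF that] sq[OF that]] by simp
  have indepW: "indep_vars (\<lambda>_. borel) W I"
    unfolding W_def by (rule indep_vars_compose2[OF indep]) auto
  have prod: "integrable M (\<lambda>\<omega>. W i \<omega> * W j \<omega>) \<and>
      expectation (\<lambda>\<omega>. W i \<omega> * W j \<omega>) = (if i = j then expectation (\<lambda>\<omega>. (W i \<omega>)\<^sup>2) else 0)"
    if ij: "i \<in> I" "j \<in> I" for i j
  proof (cases "i = j")
    case True
    then show ?thesis using sqW[OF ij(1)] by (simp add: power2_eq_square)
  next
    case False
    have "indep_vars (\<lambda>_. borel) W {i, j}" using indep_vars_subset[OF indepW] ij by simp
    then have "integrable M (\<lambda>\<omega>. \<Prod>l\<in>{i,j}. W l \<omega>)"
      "expectation (\<lambda>\<omega>. \<Prod>l\<in>{i,j}. W l \<omega>) = (\<Prod>l\<in>{i,j}. expectation (W l))"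
      using intW ij by (auto intro!: indep_vars_integrable indep_vars_lebesgue_integral)
    with False EW ij show ?thesis by simp
  qed
  have eq: "(\<Sum>i\<in>I. W i \<omega>)\<^sup>2 = (\<Sum>i\<in>I. \<Sum>j\<in>I. W i \<omega> * W j \<omega>)" for \<omega>
    by (simp add: power2_eq_square sum_product)
  have "integrable M (\<lambda>\<omega>. (\<Sum>i\<in>I. W i \<omega>)\<^sup>2)"
    unfolding eq using prod by (intro Bochner_Integration.integrable_sum) auto
  then show "integrable M (\<lambda>\<omega>. (\<Sum>i\<in>I. Y i \<omega> - expectation (Y i))\<^sup>2)" by (simp add: W_def)
  have "expectation (\<lambda>\<omega>. (\<Sum>i\<in>I. W i \<omega>)\<^sup>2) = (\<Sum>i\<in>I. expectation (\<lambda>\<omega>. \<Sum>j\<in>I. W i \<omega> * W j \<omega>))"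
    unfolding eq using prod by (intro Bochner_Integration.integral_sum Bochner_Integration.integrable_sum) auto
  also have "\<dots> = (\<Sum>i\<in>I. \<Sum>j\<in>I. expectation (\<lambda>\<omega>. W i \<omega> * W j \<omega>))"
    using prod by (intro sum.cong refl Bochner_Integration.integral_sum) auto
  also have "\<dots> = (\<Sum>i\<in>I. expectation (\<lambda>\<omega>. (W i \<omega>)\<^sup>2))"
  proof (rule sum.cong[OF refl])
    fix i assume i: "i \<in> I"
    have "(\<Sum>j\<in>I. expectation (\<lambda>\<omega>. W i \<omega> * W j \<omega>)) = (\<Sum>j\<in>I. if i = j then expectation (\<lambda>\<omega>. (W i \<omega>)\<^sup>2) else 0)"
      using prod[OF i] by (intro sum.cong refl) auto
    also have "\<dots> = expectation (\<lambda>\<omega>. (W i \<omega>)\<^sup>2)" using fin i by simp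
    finally show "(\<Sum>j\<in>I. expectation (\<lambda>\<omega>. W i \<omega> * W j \<omega>)) = expectation (\<lambda>\<omega>. (W i \<omega>)\<^sup>2)" .
  qed
  also have "\<dots> \<le> (\<Sum>i\<in>I. expectation (\<lambda>\<omega>. (Y i \<omega>)\<^sup>2))" using EsqW by (rule sum_mono)
  finally show "expectation (\<lambda>\<omega>. (\<Sum>i\<in>I. Y i \<omega> - expectation (Y i))\<^sup>2) \<le> (\<Sum>i\<in>I. expectation (\<lambda>\<omega>. (Y i \<omega>)\<^sup>2))"
    by (simp add: W_def)
qed

lemma AE_summable_if_bounded_integrals:
  fixes f :: "nat \<Rightarrow> 'a \<Rightarrow> real"
  assumes int: "\<And>n. integrable M (f n)" and nonneg: "\<And>n \<omega>. 0 \<le> f n \<omega>"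
    and bound: "\<And>N. (\<Sum>n<N. integral\<^sup>L M (f n)) \<le> C"
  shows "AE \<omega> in M. summable (\<lambda>n. f n \<omega>)"
proof -
  have [measurable]: "f n \<in> borel_measurable M" for n using int by auto
  have "(\<integral>\<^sup>+\<omega>. (\<Sum>n. ennreal (f n \<omega>)) \<partial>M) = (\<Sum>n. \<integral>\<^sup>+\<omega>. ennreal (f n \<omega>) \<partial>M)"
    by (rule nn_integral_suminf) simp
  also have "\<dots> = (\<Sum>n. ennreal (integral\<^sup>L M (f n)))"
    using int nonneg by (simp add: nn_integral_eq_integral)
  also have "\<dots> \<le> ennreal C"
  proof (rule suminf_le_const)
    show "(\<Sum>n<N. ennreal (integral\<^sup>L M (f n))) \<le> ennreal C" for N
      using bound[of N] nonneg by (simp add: sum_ennreal ennreal_leI)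
  qed auto
  also have "\<dots> < \<infinity>" by simp
  finally have "AE \<omega> in M. (\<Sum>n. ennreal (f n \<omega>)) \<noteq> \<infinity>"
    by (intro nn_integral_PInf_AE) auto
  then show ?thesis
    using nonneg by (auto elim!: eventually_mono intro: summable_suminf_not_top)
qed

text \<open>Etemadi's argument. The variables are truncated at their index. The variances of the truncated
  means along a geometric subsequence are summable, so these means converge almost surely.
  Only finitely many variables are changed by the truncation, and since the summands are
  nonnegative, the partial sums are monotone and the subsequence determines the limit.\<close>
lemma (in prob_space) strong_law_of_large_numbers_nonneg:
  fixes X :: "nat \<Rightarrow> 'a \<Rightarrow> real"
  assumes indep: "indep_vars (\<lambda>_. borel) X {1..}"
    and dist: "\<And>i. i \<ge> 1 \<Longrightarrow> distr M borel (X i) = distr M borel (X 1)"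
    and nonneg: "\<And>i \<omega>. 0 \<le> X i \<omega>"
    and int: "integrable M (X 1)"
  shows "AE \<omega> in M. (\<lambda>n. (\<Sum>i=1..n. X i \<omega>) / real n) \<longlonglongrightarrow> expectation (X 1)"
proof -
  have meas[measurable]: "X i \<in> borel_measurable M" if "i \<ge> 1" for i
    using indep that by (auto simp: indep_vars_def)
  have X1[measurable]: "X 1 \<in> borel_measurable M" by (rule meas) simp
  have transfer: "expectation (\<lambda>\<omega>. h (X i \<omega>)) = expectation (\<lambda>\<omega>. h (X 1 \<omega>))"
    if "i \<ge> 1" "h \<in> borel_measurable borel" for i and h :: "real \<Rightarrow> real"
    using integral_distr[OF meas[OF that(1)] that(2)] integral_distr[OF X1 that(2)] dist[OF that(1)] by simp
  define t where "t i x = (if x \<le> real i then x else 0)" for i :: nat and x :: real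
  have [measurable]: "t i \<in> borel_measurable borel" for i unfolding t_def by measurable
  define Y where "Y = (\<lambda>i \<omega>. t i (X i \<omega>))"
  have Ymeas[measurable]: "Y i \<in> borel_measurable M" if "i \<ge> 1" for i
    unfolding Y_def using meas[OF that] by measurable
  have t_bound: "0 \<le> t i x" "t i x \<le> real i" "t i x \<le> x" if "0 \<le> x" for i x
    using that by (auto simp: t_def)
  have Ysq: "integrable M (\<lambda>\<omega>. (Y i \<omega>)\<^sup>2)" if "i \<ge> 1" for i
  proof (rule integrable_const_bound)
    show "AE \<omega> in M. norm ((Y i \<omega>)\<^sup>2) \<le> (real i)\<^sup>2"
      unfolding Y_def using t_bound nonneg by (intro always_eventually allI) (simp add: power_mono)
    show "(\<lambda>\<omega>. (Y i \<omega>)\<^sup>2) \<in> borel_measurable M" using Ymeas[OF that] by measurable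
  qed
  have indepY: "indep_vars (\<lambda>_. borel) Y {1..}"
    unfolding Y_def by (rule indep_vars_compose2[OF indep]) auto
  define \<mu> where "\<mu> = expectation (X 1)"
  define e where "e i = expectation (Y i)" for i
  define s where "s i = expectation (\<lambda>\<omega>. (Y i \<omega>)\<^sup>2)" for i
  have s0: "s i \<ge> 0" for i unfolding s_def by simp

  have "(\<lambda>i. expectation (\<lambda>\<omega>. t i (X 1 \<omega>))) \<longlonglongrightarrow> expectation (X 1)"
  proof (rule integral_dominated_convergence[OF X1 _ int])
    show "AE \<omega> in M. (\<lambda>i. t i (X 1 \<omega>)) \<longlonglongrightarrow> X 1 \<omega>"
    proof (intro always_eventually allI)
      fix \<omega>
      have "\<forall>\<^sub>F i in sequentially. X 1 \<omega> \<le> real i"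
        using filterlim_real_sequentially unfolding filterlim_at_top by blast
      then have "\<forall>\<^sub>F i in sequentially. t i (X 1 \<omega>) = X 1 \<omega>"
        by eventually_elim (simp add: t_def)
      then show "(\<lambda>i. t i (X 1 \<omega>)) \<longlonglongrightarrow> X 1 \<omega>" by (rule tendsto_eventually)
    qed
    show "AE \<omega> in M. norm (t i (X 1 \<omega>)) \<le> X 1 \<omega>" for i
      using t_bound nonneg by (intro always_eventually allI) simp
  qed simp
  moreover have "\<forall>\<^sub>F i in sequentially. expectation (\<lambda>\<omega>. t i (X 1 \<omega>)) = e i"
  proof (rule eventually_sequentiallyI[of 1])
    fix i :: nat assume "1 \<le> i"
    from transfer[OF this, of "t i"] show "expectation (\<lambda>\<omega>. t i (X 1 \<omega>)) = e i"
      by (simp add: e_def Y_def)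
  qed
  ultimately have "e \<longlonglongrightarrow> \<mu>" unfolding \<mu>_def by (rule Lim_transform_eventually)
  then have cesaro: "(\<lambda>n. (\<Sum>i=1..n. e i) / real n) \<longlonglongrightarrow> \<mu>" by (rule cesaro_mean_tendsto)

  have s_sum: "(\<Sum>i=1..L. s i / (real i)\<^sup>2) \<le> 2 * \<mu>" for L
  proof -
    have ti: "integrable M (\<lambda>\<omega>. (t i (X 1 \<omega>))\<^sup>2)" for i
    proof (rule integrable_const_bound)
      show "AE \<omega> in M. norm ((t i (X 1 \<omega>))\<^sup>2) \<le> (real i)\<^sup>2"
        using t_bound nonneg by (intro always_eventually allI) (simp add: power_mono)
    qed simp
    have "(\<Sum>i=1..L. s i / (real i)\<^sup>2) = (\<Sum>i=1..L. expectation (\<lambda>\<omega>. (t i (X 1 \<omega>))\<^sup>2 / (real i)\<^sup>2))"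
      unfolding s_def Y_def using transfer[of i "\<lambda>x. (t i x)\<^sup>2" for i] by (intro sum.cong) auto
    also have "\<dots> = expectation (\<lambda>\<omega>. \<Sum>i=1..L. (t i (X 1 \<omega>))\<^sup>2 / (real i)\<^sup>2)"
      using ti by (subst Bochner_Integration.integral_sum) auto
    also have "\<dots> \<le> expectation (\<lambda>\<omega>. 2 * X 1 \<omega>)"
    proof (rule integral_mono)
      show "(\<Sum>i=1..L. (t i (X 1 \<omega>))\<^sup>2 / (real i)\<^sup>2) \<le> 2 * X 1 \<omega>" for \<omega>
        unfolding t_def by (rule sum_truncated_squares_le[OF nonneg])
    qed (use ti int in \<open>auto intro!: Bochner_Integration.integrable_sum\<close>)
    finally show ?thesis by (simp add: \<mu>_def)
  qed

  have subseq: "AE \<omega> in M. (\<lambda>n. (\<Sum>i=1..geometric_floor \<alpha> n. Y i \<omega>) / real (geometric_floor \<alpha> n)) \<longlonglongrightarrow> \<mu>" if \<alpha>: "\<alpha> > 1" for \<alpha>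
  proof -
    define k where "k = geometric_floor \<alpha>"
    have k1: "k n \<ge> 1" for n unfolding k_def using geometric_floor_bounds(3)[OF \<alpha>] .
    define D where "D = (\<lambda>n \<omega>. ((\<Sum>i=1..k n. Y i \<omega> - e i) / real (k n))\<^sup>2)"
    have D: "integrable M (D n) \<and> expectation (D n) \<le> (\<Sum>i=1..k n. s i) / (real (k n))\<^sup>2" for n
    proof -
      have *: "integrable M (\<lambda>\<omega>. (\<Sum>i=1..k n. Y i \<omega> - e i)\<^sup>2) \<and>
        expectation (\<lambda>\<omega>. (\<Sum>i=1..k n. Y i \<omega> - e i)\<^sup>2) \<le> (\<Sum>i=1..k n. s i)"
        unfolding e_def s_def using indep_vars_subset[OF indepY, of "{1..k n}"] Ysq
        by (intro conjI expectation_square_centered_sum_le) auto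
      then show ?thesis unfolding D_def power_divide by (auto intro!: divide_right_mono)
    qed
    define c where "c = 1 / (1 - 1/\<alpha>\<^sup>2)"
    have "1/\<alpha>\<^sup>2 < 1" using \<alpha> by (simp add: one_less_power)
    then have c0: "c \<ge> 0" by (simp add: c_def)
    have "(\<Sum>n<N. expectation (D n)) \<le> 4 * c * (2 * \<mu>)" for N
    proof -
      obtain L where L: "\<And>n. n < N \<Longrightarrow> k n \<le> L"
        using finite_nat_set_iff_bounded_le[of "k ` {..<N}"] by auto
      \<comment> \<open>Exchanging the sums leaves, for each \<open>i\<close>, the tail of a geometric series, of order \<open>1 / i\<^sup>2\<close>.\<close>
      have "(\<Sum>n<N. expectation (D n)) \<le> (\<Sum>n<N. (\<Sum>i=1..k n. s i) / (real (k n))\<^sup>2)"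
        using D by (intro sum_mono) auto
      also have "\<dots> = (\<Sum>n<N. \<Sum>i=1..L. if i \<le> k n then s i / (real (k n))\<^sup>2 else 0)"
      proof (intro sum.cong refl)
        fix n assume "n \<in> {..<N}"
        then have "{i\<in>{1..L}. i \<le> k n} = {1..k n}" using L[of n] by auto
        then show "(\<Sum>i=1..k n. s i) / (real (k n))\<^sup>2 = (\<Sum>i=1..L. if i \<le> k n then s i / (real (k n))\<^sup>2 else 0)"
          by (simp add: sum_divide_distrib sum.inter_filter[symmetric])
      qed
      also have "\<dots> = (\<Sum>i=1..L. \<Sum>n<N. if i \<le> k n then s i / (real (k n))\<^sup>2 else 0)" by (rule sum.swap)
      also have "\<dots> \<le> (\<Sum>i=1..L. 4 * c * (s i / (real i)\<^sup>2))"
      proof (rule sum_mono)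
        fix i assume i: "i \<in> {1..L}"
        have "(\<Sum>n<N. if i \<le> k n then s i / (real (k n))\<^sup>2 else 0)
            \<le> (\<Sum>n<N. s i * 4 * (if real i \<le> \<alpha> ^ n then 1 / (\<alpha>^n)\<^sup>2 else 0))"
        proof (rule sum_mono)
          fix n
          have "s i / (real (k n))\<^sup>2 \<le> s i * 4 * (1 / (\<alpha>^n)\<^sup>2)"
          proof -
            have "(\<alpha>^n)\<^sup>2 \<le> (2 * real (k n))\<^sup>2"
              using geometric_floor_bounds(4)[OF \<alpha>, of n] \<alpha> unfolding k_def by (intro power_mono) auto
            then have "1 / (real (k n))\<^sup>2 \<le> 4 * (1 / (\<alpha>^n)\<^sup>2)"
              using \<alpha> k1[of n] by (simp add: field_simps power_mult_distrib)
            from mult_left_mono[OF this s0[of i]] show ?thesis by simp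
          qed
          moreover have "real i \<le> \<alpha> ^ n" if "i \<le> k n"
            using geometric_floor_bounds(1)[OF \<alpha>, of n] that unfolding k_def by linarith
          ultimately show "(if i \<le> k n then s i / (real (k n))\<^sup>2 else 0)
            \<le> s i * 4 * (if real i \<le> \<alpha> ^ n then 1 / (\<alpha>^n)\<^sup>2 else 0)"
            using s0[of i] \<alpha> by auto
        qed
        also have "\<dots> = s i * 4 * (\<Sum>n<N. if real i \<le> \<alpha> ^ n then 1 / (\<alpha>^n)\<^sup>2 else 0)"
          by (rule sum_distrib_left[symmetric])
        also have "\<dots> \<le> s i * 4 * (c / (real i)\<^sup>2)"
          unfolding c_def using sum_tail_inverse_geometric_le[OF \<alpha>, of "real i" N] i s0[of i]
          by (intro mult_left_mono) auto
        finally show "(\<Sum>n<N. if i \<le> k n then s i / (real (k n))\<^sup>2 else 0) \<le> 4 * c * (s i / (real i)\<^sup>2)"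
          by (simp add: mult_ac)
      qed
      also have "\<dots> = 4 * c * (\<Sum>i=1..L. s i / (real i)\<^sup>2)" by (rule sum_distrib_left[symmetric])
      also have "\<dots> \<le> 4 * c * (2 * \<mu>)" using s_sum c0 by (intro mult_left_mono) auto
      finally show ?thesis .
    qed
    then have "AE \<omega> in M. summable (\<lambda>n. D n \<omega>)"
      by (intro AE_summable_if_bounded_integrals) (use D in \<open>auto simp: D_def\<close>)
    then show ?thesis
    proof eventually_elim
      case (elim \<omega>)
      then have "(\<lambda>n. sqrt (D n \<omega>)) \<longlonglongrightarrow> sqrt 0" by (intro tendsto_real_sqrt summable_LIMSEQ_zero)
      then have "(\<lambda>n. \<bar>(\<Sum>i=1..k n. Y i \<omega> - e i) / real (k n)\<bar>) \<longlonglongrightarrow> 0"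
        unfolding D_def real_sqrt_abs real_sqrt_zero .
      then have "(\<lambda>n. (\<Sum>i=1..k n. Y i \<omega> - e i) / real (k n)) \<longlonglongrightarrow> 0"
        by (rule tendsto_rabs_zero_cancel)
      moreover have "(\<lambda>n. (\<Sum>i=1..k n. e i) / real (k n)) \<longlonglongrightarrow> \<mu>"
        by (rule filterlim_compose[OF cesaro]) (simp add: k_def filterlim_geometric_floor \<alpha>)
      ultimately have "(\<lambda>n. (\<Sum>i=1..k n. Y i \<omega> - e i) / real (k n) + (\<Sum>i=1..k n. e i) / real (k n)) \<longlonglongrightarrow> 0 + \<mu>"
        by (rule tendsto_add)
      then show ?case by (simp add: k_def sum_subtractf add_divide_distrib[symmetric])
    qed
  qed

  have "AE \<omega> in M. summable (\<lambda>i. if real (Suc i) < X (Suc i) \<omega> then 1 else 0 :: real)"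
  proof (rule AE_summable_if_bounded_integrals)
    fix N
    have int1: "integrable M (\<lambda>\<omega>. if real i < X 1 \<omega> then 1 else 0 :: real)" for i
      by (rule integrable_const_bound[where B=1]) auto
    have "(\<Sum>i<N. expectation (\<lambda>\<omega>. if real (Suc i) < X (Suc i) \<omega> then 1 else 0 :: real))
        = (\<Sum>i<N. expectation (\<lambda>\<omega>. if real (Suc i) < X 1 \<omega> then 1 else 0 :: real))"
      using transfer[of "Suc i" "\<lambda>x. if real (Suc i) < x then 1 else 0" for i] by (intro sum.cong) auto
    also have "\<dots> = (\<Sum>i=1..N. expectation (\<lambda>\<omega>. if real i < X 1 \<omega> then 1 else 0))"
      by (simp add: sum.atLeast1_atMost_eq)
    also have "\<dots> = expectation (\<lambda>\<omega>. \<Sum>i=1..N. if real i < X 1 \<omega> then 1 else 0)"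
      using int1 by (subst Bochner_Integration.integral_sum) auto
    also have "\<dots> \<le> \<mu>" unfolding \<mu>_def
      using int int1 sum_indicator_less_le[OF nonneg]
      by (intro integral_mono Bochner_Integration.integrable_sum) auto
    finally show "(\<Sum>i<N. expectation (\<lambda>\<omega>. if real (Suc i) < X (Suc i) \<omega> then 1 else 0 :: real)) \<le> \<mu>" .
  next
    fix i
    have [measurable]: "X (Suc i) \<in> borel_measurable M" by (rule meas) simp
    show "integrable M (\<lambda>\<omega>. if real (Suc i) < X (Suc i) \<omega> then 1 else 0 :: real)"
      by (rule integrable_const_bound[where B=1]) auto
  qed auto
  then have trunc: "AE \<omega> in M. \<forall>\<^sub>F i in sequentially. X i \<omega> = Y i \<omega>"
  proof eventually_elim
    case (elim \<omega>)
    then have "(\<lambda>i. if real (Suc i) < X (Suc i) \<omega> then 1 else 0 :: real) \<longlonglongrightarrow> 0" by (rule summable_LIMSEQ_zero)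
    then have "\<forall>\<^sub>F i in sequentially. (if real (Suc i) < X (Suc i) \<omega> then 1 else 0 :: real) < 1"
      by (rule order_tendstoD) simp
    then have "\<forall>\<^sub>F i in sequentially. X (Suc i) \<omega> = Y (Suc i) \<omega>"
      by eventually_elim (auto simp: Y_def t_def split: if_splits)
    then show ?case using eventually_sequentially_Suc[of "\<lambda>i. X i \<omega> = Y i \<omega>"] by simp
  qed

  have "AE \<omega> in M. \<forall>r. (\<lambda>n. (\<Sum>i=1..geometric_floor (1 + 1 / real (Suc r)) n. Y i \<omega>) / real (geometric_floor (1 + 1 / real (Suc r)) n)) \<longlonglongrightarrow> \<mu>"
    unfolding AE_all_countable using subseq by simp
  then show ?thesis using trunc
  proof eventually_elim
    case (elim \<omega>)
    have "(\<lambda>n. (\<Sum>i=1..n. Y i \<omega>) / real n) \<longlonglongrightarrow> \<mu>"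
    proof (rule mean_tendsto_if_geometric_means_tendsto)
      show "mono (\<lambda>n. \<Sum>i=1..n. Y i \<omega>)"
        using t_bound nonneg unfolding Y_def by (intro monoI sum_mono2) auto
    qed (use elim in auto)
    moreover have "(\<lambda>n. (\<Sum>i=1..n. X i \<omega> - Y i \<omega>) / real n) \<longlonglongrightarrow> 0"
    proof (rule cesaro_mean_tendsto, rule tendsto_eventually)
      show "\<forall>\<^sub>F i in sequentially. X i \<omega> - Y i \<omega> = 0" using elim(2) by eventually_elim simp
    qed
    ultimately have "(\<lambda>n. (\<Sum>i=1..n. Y i \<omega>) / real n + (\<Sum>i=1..n. X i \<omega> - Y i \<omega>) / real n) \<longlonglongrightarrow> \<mu> + 0"
      by (rule tendsto_add)
    then show ?case by (simp add: \<mu>_def sum_subtractf add_divide_distrib[symmetric])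
  qed
qed

section \<open>Orthonormal systems and adjoints in Hilbert spaces\<close>

text \<open>The representing vector minimizes \<open>\<parallel>x\<parallel>\<^sup>2 / 2 - f x\<close>. Minimizing sequences are Cauchy by the
  parallelogram law, and the first-order condition at the minimizer is the representation.\<close>
lemma riesz_representation:
  fixes f :: "'a::{real_inner,complete_space} \<Rightarrow> real"
  assumes "bounded_linear f"
  shows "\<exists>a. \<forall>x. f x = x \<bullet> a"
proof -
  interpret f: bounded_linear f by fact
  define J where "J x = (norm x)\<^sup>2 / 2 - f x" for x
  have ineq: "- r\<^sup>2 \<le> s\<^sup>2 / 2 - r * s" for r s :: real
  proof -
    have "0 \<le> (s - r)\<^sup>2 / 2 + r\<^sup>2 / 2" by simp
    then show ?thesis by (simp add: power2_diff field_simps)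
  qed
  have lower: "J x \<ge> - (onorm f)\<^sup>2" for x
  proof -
    have "f x \<le> onorm f * norm x" using onorm[OF assms, of x] by simp
    with ineq[of "onorm f" "norm x"] show ?thesis unfolding J_def by linarith
  qed
  then have bdd: "bdd_below (range J)" by (intro bdd_belowI) auto
  define I where "I = Inf (range J)"
  have I: "I \<le> J x" for x unfolding I_def by (intro cInf_lower bdd) simp
  have "\<exists>x. J x < I + 1 / real (Suc n)" for n
    using cInf_lessD[of "range J" "I + 1 / real (Suc n)"] unfolding I_def by auto
  then obtain X where X: "\<And>n. J (X n) < I + 1 / real (Suc n)" by metis
  have par: "(norm (x - y))\<^sup>2 = 4 * (J x + J y - 2 * J ((1/2) *\<^sub>R (x + y)))" for x y
    unfolding J_def power2_norm_eq_inner by (simp add: f.scaleR f.add inner_commute algebra_simps)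
  have "Cauchy X"
  proof (rule metric_CauchyI)
    fix e :: real assume "e > 0"
    then obtain N where N: "8 / e\<^sup>2 < real N" using reals_Archimedean2 by blast
    show "\<exists>N. \<forall>m\<ge>N. \<forall>n\<ge>N. dist (X m) (X n) < e"
    proof (intro exI allI impI)
      fix m n assume mn: "m \<ge> N" "n \<ge> N"
      have "8 / e\<^sup>2 > 0" using \<open>e > 0\<close> by simp
      then have N0: "real N > 0" using N by linarith
      have b: "J (X i) < I + 1 / real N" if "i \<ge> N" for i
      proof -
        have "1 / real (Suc i) \<le> 1 / real N" using that N0 by (intro divide_left_mono) auto
        then show ?thesis using X[of i] by linarith
      qed
      have aux: "n2 < 8 * t" if "n2 = 4 * (a + b - 2 * c)" "a < I + t" "b < I + t" "I \<le> c"
        for n2 a b c t :: real using that by (simp add: algebra_simps)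
      have "(norm (X m - X n))\<^sup>2 < 8 * (1 / real N)"
        by (rule aux[OF par b[OF mn(1)] b[OF mn(2)] I])
      also have "8 * (1 / real N) < e\<^sup>2" using N N0 \<open>e > 0\<close> by (simp add: field_simps)
      finally show "dist (X m) (X n) < e"
        unfolding dist_norm by (rule power2_less_imp_less) (use \<open>e > 0\<close> in simp)
    qed
  qed
  then obtain a where a: "X \<longlonglongrightarrow> a" using Cauchy_convergent convergent_def by blast
  have "(\<lambda>n. J (X n)) \<longlonglongrightarrow> J a" unfolding J_def by (intro tendsto_intros a f.tendsto) simp
  moreover have "(\<lambda>n. I + 1 / real (Suc n)) \<longlonglongrightarrow> I + 0"
    by (intro tendsto_intros) (use LIMSEQ_inverse_real_of_nat in \<open>simp add: inverse_eq_divide\<close>)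
  ultimately have "J a \<le> I"
    using X by (intro LIMSEQ_le[of "\<lambda>n. J (X n)" _ "\<lambda>n. I + 1 / real (Suc n)"]) (auto intro: less_imp_le)
  then have min: "J a \<le> J x" for x using I[of x] by (rule order_trans)
  have "f h = h \<bullet> a" for h
  proof -
    define d where "d = a \<bullet> h - f h"
    have "0 \<le> t * d + t\<^sup>2 * ((norm h)\<^sup>2 / 2)" for t
    proof -
      have "J (a + t *\<^sub>R h) - J a = t * d + t\<^sup>2 * ((norm h)\<^sup>2 / 2)"
        unfolding J_def d_def power2_norm_eq_inner
        by (simp add: f.scaleR f.add inner_commute algebra_simps power2_eq_square)
      then show ?thesis using min[of "a + t *\<^sub>R h"] by linarith
    qed
    note q = this
    have "d = 0"
    proof (rule ccontr)
      assume "d \<noteq> 0"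
      \<comment> \<open>The added \<open>1\<close> keeps the step \<open>t = - d / c\<close> meaningful for \<open>h = 0\<close>.\<close>
      define c where "c = (norm h)\<^sup>2 / 2 + 1"
      have c: "c > 0" unfolding c_def by (simp add: add_nonneg_pos)
      have "0 \<le> (- d / c) * d + (- d / c)\<^sup>2 * (c - 1)" using q[of "- d / c"] by (simp add: c_def)
      also have "\<dots> = - d\<^sup>2 / c\<^sup>2" using c by (simp add: field_simps power2_eq_square)
      also have "\<dots> < 0" using \<open>d \<noteq> 0\<close> c by (simp add: divide_neg_pos)
      finally show False by simp
    qed
    then show ?thesis by (simp add: d_def inner_commute)
  qed
  then show ?thesis by blast
qed

text \<open>The constant \<^const>\<open>adjoint\<close> is a choice; on a Hilbert space the chosen map has the adjoint
  property because Riesz representation provides one.\<close>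
lemma adjoint_works_complete:
  fixes K :: "'x::{real_inner,complete_space} \<Rightarrow> 'y::real_inner"
  assumes "bounded_linear K"
  shows "K x \<bullet> y = x \<bullet> adjoint K y"
proof -
  have "\<exists>a. \<forall>x. K x \<bullet> y = x \<bullet> a" for y
    using bounded_linear_compose[OF bounded_linear_inner_left assms, of y]
    by (intro riesz_representation) simp
  then obtain g where "\<And>y x. K x \<bullet> y = x \<bullet> g y" by metis
  then show ?thesis using adjoint_unique[of K g] by simp
qed

definition orthonormal_sequence :: "(nat \<Rightarrow> 'x::real_inner) \<Rightarrow> bool" where
  "orthonormal_sequence e \<longleftrightarrow> (\<forall>i\<ge>1. \<forall>j\<ge>1. e i \<bullet> e j = (if i = j then 1 else 0))"

lemma inner_orthonormal_sum:
  assumes "orthonormal_sequence e" "i \<ge> 1"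
  shows "e i \<bullet> (\<Sum>j=1..m. c j *\<^sub>R e j) = (if i \<le> m then c i else 0)"
proof -
  have "e i \<bullet> (\<Sum>j=1..m. c j *\<^sub>R e j) = (\<Sum>j=1..m. if i = j then c j else 0)"
    unfolding inner_sum_right using assms by (intro sum.cong) (auto simp: orthonormal_sequence_def)
  then show ?thesis using assms(2) by simp
qed

lemma norm_orthonormal_sum:
  assumes "orthonormal_sequence e" "finite A" "\<And>j. j \<in> A \<Longrightarrow> j \<ge> 1"
  shows "(norm (\<Sum>j\<in>A. c j *\<^sub>R e j))\<^sup>2 = (\<Sum>j\<in>A. (c j)\<^sup>2)"
proof -
  have "(norm (\<Sum>j\<in>A. c j *\<^sub>R e j))\<^sup>2 = (\<Sum>j\<in>A. \<Sum>i\<in>A. c j * (c i * (e j \<bullet> e i)))"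
    unfolding power2_norm_eq_inner inner_sum_left inner_sum_right by (simp add: inner_commute mult_ac)
  also have "\<dots> = (\<Sum>j\<in>A. \<Sum>i\<in>A. if j = i then (c j)\<^sup>2 else 0)"
    using assms by (intro sum.cong refl) (auto simp: orthonormal_sequence_def power2_eq_square)
  also have "\<dots> = (\<Sum>j\<in>A. (c j)\<^sup>2)" using assms(2) by (intro sum.cong refl) simp
  finally show ?thesis .
qed

lemma linear_proj: "linear (proj e m)"
  by (rule linearI) (simp_all add: proj_def inner_add_right scaleR_add_left sum.distrib scaleR_sum_right)

lemma norm_diff_proj:
  assumes "orthonormal_sequence e"
  shows "(norm (x - proj e m x))\<^sup>2 = (norm x)\<^sup>2 - (\<Sum>j=1..m. (e j \<bullet> x)\<^sup>2)"
proof -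
  have "x \<bullet> proj e m x = (\<Sum>j=1..m. (e j \<bullet> x)\<^sup>2)"
    by (simp add: proj_def inner_sum_right power2_eq_square inner_commute)
  moreover have "(norm (proj e m x))\<^sup>2 = (\<Sum>j=1..m. (e j \<bullet> x)\<^sup>2)"
    unfolding proj_def by (rule norm_orthonormal_sum[OF assms]) auto
  ultimately show ?thesis
    by (simp add: power2_norm_eq_inner inner_diff_left inner_diff_right inner_commute)
qed

lemma bessel_inequality:
  assumes "orthonormal_sequence e"
  shows "(\<Sum>j=1..m. (e j \<bullet> x)\<^sup>2) \<le> (norm x)\<^sup>2"
proof -
  have "0 \<le> (norm (x - proj e m x))\<^sup>2" by simp
  then show ?thesis unfolding norm_diff_proj[OF assms] by simp
qed

lemma summable_squares_fourier:
  assumes "orthonormal_sequence e"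
  shows "summable (\<lambda>j. (e (Suc j) \<bullet> x)\<^sup>2)"
proof (rule summableI_nonneg_bounded)
  show "(\<Sum>j<n. (e (Suc j) \<bullet> x)\<^sup>2) \<le> (norm x)\<^sup>2" for n
    using bessel_inequality[OF assms, of x n] by (simp add: sum.atLeast1_atMost_eq)
qed simp

text \<open>An element of the span uses finitely many basis vectors.\<close>
lemma proj_eventually_id_on_span:
  assumes "orthonormal_sequence e" "y \<in> span (e ` {1..})"
  shows "\<exists>m0. \<forall>m\<ge>m0. proj e m y = y"
proof (rule span_induct[OF assms(2)])
  show "subspace {y. \<exists>m0. \<forall>m\<ge>m0. proj e m y = y}"
  proof (rule subspaceI)
    show "0 \<in> {y. \<exists>m0. \<forall>m\<ge>m0. proj e m y = y}" by (simp add: linear_0[OF linear_proj])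
  next
    fix x y assume "x \<in> {y. \<exists>m0. \<forall>m\<ge>m0. proj e m y = y}" "y \<in> {y. \<exists>m0. \<forall>m\<ge>m0. proj e m y = y}"
    then obtain a b where "\<forall>m\<ge>a. proj e m x = x" "\<forall>m\<ge>b. proj e m y = y" by auto
    then show "x + y \<in> {y. \<exists>m0. \<forall>m\<ge>m0. proj e m y = y}"
      by (auto simp: linear_add[OF linear_proj] intro!: exI[of _ "max a b"])
  next
    fix c x assume "x \<in> {y. \<exists>m0. \<forall>m\<ge>m0. proj e m y = y}"
    then show "c *\<^sub>R x \<in> {y. \<exists>m0. \<forall>m\<ge>m0. proj e m y = y}"
      by (auto simp: linear_cmul[OF linear_proj])
  qed
next
  fix y assume "y \<in> e ` {1..}"
  then obtain i where i: "i \<ge> 1" "y = e i" by auto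
  have "proj e m y = y" if "m \<ge> i" for m
  proof -
    have "proj e m y = (\<Sum>j=1..m. if j = i then e i else 0)"
      unfolding proj_def using assms(1) i by (intro sum.cong) (auto simp: orthonormal_sequence_def)
    then show ?thesis using i that by simp
  qed
  then show "\<exists>m0. \<forall>m\<ge>m0. proj e m y = y" by blast
qed

text \<open>Projections fix an approximating element of the span, and \<open>x \<mapsto> x - P x\<close> does not increase norms.\<close>
lemma fourier_series_tendsto:
  assumes on: "orthonormal_sequence e" and x: "x \<in> closure (span (e ` {1..}))"
  shows "(\<lambda>m. proj e m x) \<longlonglongrightarrow> x"
proof (rule metric_LIMSEQ_I)
  fix r :: real assume "r > 0"
  then obtain y where y: "y \<in> span (e ` {1..})" "dist y x < r"
    using x unfolding closure_approachable by blast
  obtain m0 where m0: "\<And>m. m \<ge> m0 \<Longrightarrow> proj e m y = y"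
    using proj_eventually_id_on_span[OF on y(1)] by blast
  have "dist (proj e m x) x < r" if "m \<ge> m0" for m
  proof -
    have "x - proj e m x = (x - y) - proj e m (x - y)"
      using m0[OF that] by (simp add: linear_diff[OF linear_proj])
    moreover have "(norm ((x - y) - proj e m (x - y)))\<^sup>2 \<le> (norm (x - y))\<^sup>2"
      unfolding norm_diff_proj[OF on] by (simp add: sum_nonneg)
    ultimately have "(norm (x - proj e m x))\<^sup>2 \<le> (norm (x - y))\<^sup>2" by metis
    then have "norm (x - proj e m x) \<le> norm (x - y)" by (rule power2_le_imp_le) simp
    with y(2) show ?thesis by (simp add: dist_norm norm_minus_commute)
  qed
  then show "\<exists>no. \<forall>m\<ge>no. dist (proj e m x) x < r" by blast
qed

lemma fourier_coefficients_zero: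
  assumes "orthonormal_sequence e" "x \<in> closure (span (e ` {1..}))" "\<And>j. j \<ge> 1 \<Longrightarrow> e j \<bullet> x = 0"
  shows "x = 0"
proof -
  have "proj e m x = 0" for m unfolding proj_def using assms(3) by (intro sum.neutral) auto
  with fourier_series_tendsto[OF assms(1,2)] show ?thesis by (simp add: LIMSEQ_const_iff)
qed

lemma convergent_proj:
  fixes x :: "'a::{real_inner,complete_space}"
  assumes on: "orthonormal_sequence e"
  shows "convergent (\<lambda>m. proj e m x)"
proof (rule Cauchy_convergent, rule metric_CauchyI)
  fix r :: real assume r: "r > 0"
  have "Cauchy (\<lambda>m. \<Sum>j<m. (e (Suc j) \<bullet> x)\<^sup>2)"
    using summable_squares_fourier[OF on] by (intro convergent_Cauchy) (simp add: summable_iff_convergent)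
  then obtain N where N: "\<And>m n. m \<ge> N \<Longrightarrow> n \<ge> N \<Longrightarrow>
      dist (\<Sum>j<m. (e (Suc j) \<bullet> x)\<^sup>2) (\<Sum>j<n. (e (Suc j) \<bullet> x)\<^sup>2) < r\<^sup>2"
    using metric_CauchyD[of "\<lambda>m. \<Sum>j<m. (e (Suc j) \<bullet> x)\<^sup>2" "r\<^sup>2"] r by auto
  have le: "dist (proj e m x) (proj e n x) < r" if "N \<le> m" "m \<le> n" for m n
  proof -
    have "proj e n x - proj e m x = (\<Sum>j\<in>{m<..n}. (e j \<bullet> x) *\<^sub>R e j)"
      unfolding proj_def sum_split_at[OF that(2)] by simp
    then have "(norm (proj e n x - proj e m x))\<^sup>2 = (\<Sum>j\<in>{m<..n}. (e j \<bullet> x)\<^sup>2)"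
      using norm_orthonormal_sum[OF on, of "{m<..n}"] by simp
    also have "\<dots> = (\<Sum>j=1..n. (e j \<bullet> x)\<^sup>2) - (\<Sum>j=1..m. (e j \<bullet> x)\<^sup>2)"
      unfolding sum_split_at[OF that(2)] by simp
    also have "\<dots> < r\<^sup>2"
      using N[of m n] that by (simp add: sum.atLeast1_atMost_eq dist_real_def)
    finally have "norm (proj e n x - proj e m x) < r" by (rule power2_less_imp_less) (use r in simp)
    then show ?thesis by (simp add: dist_norm norm_minus_commute)
  qed
  show "\<exists>N. \<forall>m\<ge>N. \<forall>n\<ge>N. dist (proj e m x) (proj e n x) < r"
  proof (intro exI allI impI)
    fix m n assume "m \<ge> N" "n \<ge> N"
    then show "dist (proj e m x) (proj e n x) < r"
      using le[of m n] le[of n m] by (cases "m \<le> n") (auto simp: dist_commute)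
  qed
qed

section \<open>Landweber iteration in the singular basis\<close>

context
  fixes K :: "'x::{real_inner,complete_space} \<Rightarrow> 'y::real_inner" and \<sigma> v u
  assumes bl: "bounded_linear K" and svd: "singular_value_decomposition K \<sigma> v u"
begin

lemma svd_orthonormal: "orthonormal_sequence v" "orthonormal_sequence u"
  using svd by (simp_all add: singular_value_decomposition_def orthonormal_basis_def orthonormal_sequence_def)

lemma svd_sigma_pos: "j \<ge> 1 \<Longrightarrow> \<sigma> j > 0"
  using svd by (simp add: singular_value_decomposition_def)

lemma svd_sigma_antimono: "1 \<le> i \<Longrightarrow> i \<le> j \<Longrightarrow> \<sigma> j \<le> \<sigma> i"
proof (induction j)
  case (Suc j)
  show ?case
  proof (cases "i = Suc j")
    case False
    with Suc have "\<sigma> j \<le> \<sigma> i" "j \<ge> 1" by auto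
    moreover from \<open>j \<ge> 1\<close> have "\<sigma> (Suc j) \<le> \<sigma> j"
      using svd unfolding singular_value_decomposition_def by blast
    ultimately show ?thesis by simp
  qed simp
qed simp

lemma svd_map: "j \<ge> 1 \<Longrightarrow> K (v j) = \<sigma> j *\<^sub>R u j"
  using svd by (simp add: singular_value_decomposition_def)

lemma svd_closure_span:
  "closure (span (u ` {1..})) = UNIV" "closure (span (v ` {1..})) = orthogonal_comp (null_space K)"
  using svd by (simp_all add: singular_value_decomposition_def orthonormal_basis_def)

text \<open>The adjoint of \<open>K\<close> maps \<open>u j\<close> to \<open>\<sigma> j *\<^sub>R v j\<close>. So \<open>K\<close> is diagonal on the whole space, including
  the null space, whereas \<open>K (v j) = \<sigma> j *\<^sub>R u j\<close> alone describes it on the span of the \<open>v j\<close>.\<close>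
lemma svd_coefficient:
  assumes "j \<ge> 1"
  shows "u j \<bullet> K x = \<sigma> j * (v j \<bullet> x)"
  using adjoint_works_complete[OF bl, of x "u j"] svd assms
  by (simp add: singular_value_decomposition_def inner_commute)

lemma svd_sigma_le_1:
  assumes "onorm K \<le> 1" "j \<ge> 1"
  shows "\<sigma> j \<le> 1"
proof -
  have n: "norm (v j) = 1" "norm (u j) = 1"
    using svd_orthonormal assms(2) by (auto simp: orthonormal_sequence_def norm_eq_1)
  have "norm (K (v j)) \<le> onorm K * norm (v j)" by (rule onorm[OF bl])
  then show ?thesis using assms svd_sigma_pos[OF assms(2)] by (simp add: svd_map n)
qed

text \<open>If \<open>y\<^sub>0 = K w\<close>, the limit \<open>x\<close> of the projections of \<open>w\<close> onto the \<open>v\<^sub>j\<close> lies in the orthogonal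
  complement of the null space, and \<open>K x = K w\<close> because all coefficients agree. Any other candidate
  differs from \<open>x\<close> by an element of the null space that is orthogonal to itself.\<close>
lemma moore_penrose_in_range:
  assumes "y\<^sub>0 \<in> range K"
  shows "moore_penrose K y\<^sub>0 \<in> orthogonal_comp (null_space K)" "K (moore_penrose K y\<^sub>0) = y\<^sub>0"
proof -
  interpret K: bounded_linear K by fact
  obtain w where w: "y\<^sub>0 = K w" using assms by auto
  obtain x where x: "(\<lambda>m. proj v m w) \<longlonglongrightarrow> x"
    using convergent_proj[OF svd_orthonormal(1), of w] by (auto simp: convergent_def)
  have "proj v m w \<in> span (v ` {1..})" for m
    unfolding proj_def by (intro span_sum span_scale span_base) auto
  then have xN: "x \<in> orthogonal_comp (null_space K)"
    unfolding svd_closure_span(2)[symmetric] closure_sequential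
    by (intro exI[of _ "\<lambda>m. proj v m w"] conjI allI x)
  have "v j \<bullet> x = v j \<bullet> w" if "j \<ge> 1" for j
  proof -
    have "(\<lambda>m. v j \<bullet> proj v m w) \<longlonglongrightarrow> v j \<bullet> x" by (intro tendsto_intros x)
    moreover have "\<forall>\<^sub>F m in sequentially. v j \<bullet> proj v m w = v j \<bullet> w"
      using inner_orthonormal_sum[OF svd_orthonormal(1) that]
      by (intro eventually_sequentiallyI[of j]) (simp add: proj_def)
    ultimately show ?thesis by (metis tendsto_eventually LIMSEQ_unique)
  qed
  then have "u j \<bullet> (y\<^sub>0 - K x) = 0" if "j \<ge> 1" for j
    using that by (simp add: w inner_diff_right svd_coefficient)
  then have "y\<^sub>0 - K x = 0"
    by (intro fourier_coefficients_zero[OF svd_orthonormal(2)]) (auto simp: svd_closure_span(1)[simplified])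
  then have Kx: "K x = y\<^sub>0" by simp
  have "moore_penrose K y\<^sub>0 = x"
    unfolding moore_penrose_def
  proof (rule the_equality)
    show "x \<in> orthogonal_comp (null_space K) \<and> y\<^sub>0 - K x \<in> orthogonal_comp (range K)"
      using xN Kx by (simp add: orthogonal_comp_def orthogonal_def)
  next
    fix x' assume x': "x' \<in> orthogonal_comp (null_space K) \<and> y\<^sub>0 - K x' \<in> orthogonal_comp (range K)"
    have "orthogonal (K (x - x')) (y\<^sub>0 - K x')" using x' by (auto simp: orthogonal_comp_def)
    then have "K (x - x') = 0" using Kx by (simp add: orthogonal_def K.diff)
    then have "x - x' \<in> null_space K" by (simp add: null_space_def)
    then have "orthogonal (x - x') x" "orthogonal (x - x') x'"
      using x' xN by (auto simp: orthogonal_comp_def)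
    then have "(x - x') \<bullet> (x - x') = 0" by (simp add: orthogonal_def inner_diff_right)
    then show "x' = x" by simp
  qed
  then show "moore_penrose K y\<^sub>0 \<in> orthogonal_comp (null_space K)" "K (moore_penrose K y\<^sub>0) = y\<^sub>0"
    using xN Kx by auto
qed

text \<open>Otherwise \<open>K v\<^sub>j = \<sigma>\<^sub>j u\<^sub>j\<close> would be a sequence in a compact set whose members keep a fixed positive
  distance from each other.\<close>
lemma singular_values_tendsto_0:
  assumes "compact_operator K"
  shows "\<sigma> \<longlonglongrightarrow> 0"
proof -
  have on: "u i \<bullet> u j = (if i = j then 1 else 0)" if "i \<ge> 1" "j \<ge> 1" for i j
    using svd_orthonormal(2) that by (simp add: orthonormal_sequence_def)
  have small: "\<exists>j\<ge>1. \<sigma> j < s" if s: "s > 0" for s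
  proof (rule ccontr)
    assume "\<not> (\<exists>j\<ge>1. \<sigma> j < s)"
    then have big: "\<sigma> j \<ge> s" if "j \<ge> 1" for j using that by force
    define f where "f n = K (v (Suc n))" for n
    have "norm (v (Suc n)) = 1" for n
      using svd_orthonormal(1) by (auto simp: orthonormal_sequence_def norm_eq_1)
    then have "f n \<in> closure (K ` cball 0 1)" for n
      unfolding f_def by (intro subsetD[OF closure_subset] imageI) simp
    then obtain l r where r: "strict_mono r" and l: "(f \<circ> r) \<longlonglongrightarrow> l"
      using assms unfolding compact_operator_def compact_def by metis
    have "Cauchy (f \<circ> r)" using l by (rule LIMSEQ_imp_Cauchy)
    then obtain N where N: "\<And>m n. m \<ge> N \<Longrightarrow> n \<ge> N \<Longrightarrow> dist ((f \<circ> r) m) ((f \<circ> r) n) < s"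
      using metric_CauchyD s by meson
    define a b where "a = Suc (r N)" and "b = Suc (r (Suc N))"
    have ab: "a \<noteq> b" "a \<ge> 1" "b \<ge> 1" using strict_monoD[OF r, of N "Suc N"] by (auto simp: a_def b_def)
    have "norm (\<sigma> a *\<^sub>R u a - \<sigma> b *\<^sub>R u b) < s"
      using N[of N "Suc N"] by (simp add: dist_norm f_def svd_map a_def b_def)
    then have "(norm (\<sigma> a *\<^sub>R u a - \<sigma> b *\<^sub>R u b))\<^sup>2 < s\<^sup>2" using s by (intro power_strict_mono) auto
    moreover have "(norm (\<sigma> a *\<^sub>R u a - \<sigma> b *\<^sub>R u b))\<^sup>2 = (\<sigma> a)\<^sup>2 + (\<sigma> b)\<^sup>2"
      unfolding power2_norm_eq_inner using on ab
      by (simp add: inner_diff_left inner_diff_right power2_eq_square)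
    moreover have "s\<^sup>2 \<le> (\<sigma> a)\<^sup>2" using big[OF ab(2)] s by (intro power_mono) auto
    ultimately show False using zero_le_power2[of "\<sigma> b"] by linarith
  qed
  show ?thesis
  proof (rule LIMSEQ_I)
    fix s :: real assume "s > 0"
    then obtain j where j: "j \<ge> 1" "\<sigma> j < s" using small by blast
    have "norm (\<sigma> n - 0) < s" if "n \<ge> j" for n
      using svd_sigma_antimono[OF j(1) that] svd_sigma_pos[of n] j that by simp
    then show "\<exists>no. \<forall>n\<ge>no. norm (\<sigma> n - 0) < s" by blast
  qed
qed

lemma proj_orthonormal_sum: "proj u m (\<Sum>j=1..m. c j *\<^sub>R u j) = (\<Sum>j=1..m. c j *\<^sub>R u j)"
  unfolding proj_def[of u m] using inner_orthonormal_sum[OF svd_orthonormal(2)]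
  by (intro sum.cong) auto

lemma adjoint_projected:
  "adjoint (\<lambda>x. proj u m (K x)) = (\<lambda>y. \<Sum>j=1..m. (\<sigma> j * (u j \<bullet> y)) *\<^sub>R v j)"
proof (rule adjoint_unique, intro allI)
  show "proj u m (K x) \<bullet> y = x \<bullet> (\<Sum>j=1..m. (\<sigma> j * (u j \<bullet> y)) *\<^sub>R v j)" for x y
    unfolding proj_def inner_sum_left inner_sum_right
  proof (rule sum.cong[OF refl])
    fix j assume "j \<in> {1..m}"
    then have "(u j \<bullet> K x) *\<^sub>R u j \<bullet> y = \<sigma> j * (v j \<bullet> x) * (u j \<bullet> y)" by (simp add: svd_coefficient)
    also have "\<dots> = x \<bullet> (\<sigma> j * (u j \<bullet> y)) *\<^sub>R v j" unfolding inner_commute[of "v j" x] by simp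
    finally show "(u j \<bullet> K x) *\<^sub>R u j \<bullet> y = x \<bullet> (\<sigma> j * (u j \<bullet> y)) *\<^sub>R v j" .
  qed
qed

lemma svd_map_sum: "K (\<Sum>j=1..m. c j *\<^sub>R v j) = (\<Sum>j=1..m. (c j * \<sigma> j) *\<^sub>R u j)"
proof -
  interpret K: bounded_linear K by fact
  show ?thesis by (simp add: K.sum K.scaleR svd_map)
qed

text \<open>Each step contracts the error of the \<open>j\<close>-th coefficient by the factor \<open>1 - \<sigma>\<^sub>j\<^sup>2\<close>.\<close>
lemma landweber_spectral:
  "landweber K u d m k = (\<Sum>j=1..m. ((1 - (1 - (\<sigma> j)\<^sup>2) ^ k) / \<sigma> j * d (u j)) *\<^sub>R v j)"
proof (induction k)
  case (Suc k)
  define c where "c j = (1 - (1 - (\<sigma> j)\<^sup>2) ^ k) / \<sigma> j * d (u j)" for j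
  have IH: "landweber K u d m k = (\<Sum>j=1..m. c j *\<^sub>R v j)" using Suc by (simp add: c_def)
  have "proj u m (K (landweber K u d m k)) - proj_data u m d = (\<Sum>j=1..m. (c j * \<sigma> j - d (u j)) *\<^sub>R u j)"
    unfolding IH svd_map_sum proj_orthonormal_sum proj_data_def
    by (simp add: sum_subtractf scaleR_diff_left)
  then have "landweber K u d m (Suc k) =
      (\<Sum>j=1..m. c j *\<^sub>R v j) - (\<Sum>j=1..m. (\<sigma> j * (c j * \<sigma> j - d (u j))) *\<^sub>R v j)"
    unfolding landweber.simps adjoint_projected IH
    using inner_orthonormal_sum[OF svd_orthonormal(2)] by simp
  also have "\<dots> = (\<Sum>j=1..m. (c j - \<sigma> j * (c j * \<sigma> j - d (u j))) *\<^sub>R v j)"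
    by (simp add: sum_subtractf scaleR_diff_left)
  also have "\<dots> = (\<Sum>j=1..m. ((1 - (1 - (\<sigma> j)\<^sup>2) ^ Suc k) / \<sigma> j * d (u j)) *\<^sub>R v j)"
  proof (intro sum.cong refl arg_cong2[of _ _ _ _ scaleR])
    fix j assume "j \<in> {1..m}"
    then have "\<sigma> j > 0" using svd_sigma_pos by simp
    then show "c j - \<sigma> j * (c j * \<sigma> j - d (u j)) = (1 - (1 - (\<sigma> j)\<^sup>2) ^ Suc k) / \<sigma> j * d (u j)"
      unfolding c_def by (simp add: field_simps power2_eq_square)
  qed
  finally show ?case .
qed simp

lemma residual_spectral:
  "(residual K u d m k)\<^sup>2 = (\<Sum>j=1..m. ((1 - (\<sigma> j)\<^sup>2) ^ k * d (u j))\<^sup>2)"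
proof -
  have "proj u m (K (landweber K u d m k)) - proj_data u m d =
      (\<Sum>j=1..m. ((1 - (1 - (\<sigma> j)\<^sup>2) ^ k) / \<sigma> j * d (u j) * \<sigma> j - d (u j)) *\<^sub>R u j)"
    unfolding landweber_spectral svd_map_sum proj_orthonormal_sum proj_data_def
    by (simp add: sum_subtractf scaleR_diff_left)
  also have "\<dots> = (\<Sum>j=1..m. (- ((1 - (\<sigma> j)\<^sup>2) ^ k * d (u j))) *\<^sub>R u j)"
  proof (intro sum.cong refl arg_cong2[of _ _ _ _ scaleR])
    fix j assume "j \<in> {1..m}"
    then have "\<sigma> j > 0" using svd_sigma_pos by simp
    then show "(1 - (1 - (\<sigma> j)\<^sup>2) ^ k) / \<sigma> j * d (u j) * \<sigma> j - d (u j) = - ((1 - (\<sigma> j)\<^sup>2) ^ k * d (u j))"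
      by (simp add: field_simps)
  qed
  finally have eq: "proj u m (K (landweber K u d m k)) - proj_data u m d =
      (\<Sum>j=1..m. (- ((1 - (\<sigma> j)\<^sup>2) ^ k * d (u j))) *\<^sub>R u j)" .
  show ?thesis
    unfolding residual_def eq by (subst norm_orthonormal_sum[OF svd_orthonormal(2)]) auto
qed

text \<open>The first sum is the error inside the span of \<open>v\<^sub>1, \<dots>, v\<^sub>m\<close>, the second term the squared norm of the
  part of \<open>x\<close> outside of it; Pythagoras applies.\<close>
lemma landweber_error_spectral:
  assumes "x \<in> orthogonal_comp (null_space K)"
  shows "(norm (landweber K u d m k - x))\<^sup>2 =
    (\<Sum>j=1..m. ((1 - (1 - (\<sigma> j)\<^sup>2) ^ k) / \<sigma> j * d (u j) - v j \<bullet> x)\<^sup>2) + ((norm x)\<^sup>2 - (\<Sum>j=1..m. (v j \<bullet> x)\<^sup>2))"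
proof -
  define s where "s = (\<Sum>j=1..m. ((1 - (1 - (\<sigma> j)\<^sup>2) ^ k) / \<sigma> j * d (u j) - v j \<bullet> x) *\<^sub>R v j)"
  define w where "w = x - proj v m x"
  have eq: "landweber K u d m k - x = s - w"
    by (simp add: landweber_spectral s_def w_def proj_def sum_subtractf scaleR_diff_left)
  have "s \<bullet> w = 0"
  proof -
    have "v j \<bullet> w = 0" if "j \<in> {1..m}" for j
      using that inner_orthonormal_sum[OF svd_orthonormal(1), of j] by (simp add: w_def proj_def inner_diff_right)
    then show ?thesis unfolding s_def inner_sum_left by (intro sum.neutral) simp
  qed
  then have pythagoras: "(norm (s - w))\<^sup>2 = (norm s)\<^sup>2 + (norm w)\<^sup>2"
    by (simp add: power2_norm_eq_inner inner_diff_left inner_diff_right inner_commute)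
  have s: "(norm s)\<^sup>2 = (\<Sum>j=1..m. ((1 - (1 - (\<sigma> j)\<^sup>2) ^ k) / \<sigma> j * d (u j) - v j \<bullet> x)\<^sup>2)"
    unfolding s_def by (rule norm_orthonormal_sum[OF svd_orthonormal(1)]) auto
  show ?thesis unfolding eq pythagoras s unfolding w_def norm_diff_proj[OF svd_orthonormal(1)] ..
qed

lemma parseval_tendsto:
  assumes "x \<in> orthogonal_comp (null_space K)"
  shows "(\<lambda>m. \<Sum>j=1..m. (v j \<bullet> x)\<^sup>2) \<longlonglongrightarrow> (norm x)\<^sup>2"
proof -
  have "x \<in> closure (span (v ` {1..}))" using assms svd_closure_span(2) by simp
  then have "(\<lambda>m. x - proj v m x) \<longlonglongrightarrow> x - x"
    by (rule tendsto_diff[OF tendsto_const fourier_series_tendsto[OF svd_orthonormal(1)]])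
  then have "(\<lambda>m. (norm x)\<^sup>2 - (norm (x - proj v m x))\<^sup>2) \<longlonglongrightarrow> (norm x)\<^sup>2 - (norm (x - x))\<^sup>2"
    by (rule tendsto_diff[OF tendsto_const tendsto_power[OF tendsto_norm]])
  then show ?thesis unfolding norm_diff_proj[OF svd_orthonormal(1)] by simp
qed

end

section \<open>The indices visited by the modified discrepancy principle\<close>

lemma least_option_eq_Some_iff: "least_option P = Some n \<longleftrightarrow> P n \<and> (\<forall>i<n. \<not> P i)"
proof
  assume "least_option P = Some n"
  then have "\<exists>n. P n" "n = (LEAST n. P n)" by (auto simp: least_option_def split: if_splits)
  then show "P n \<and> (\<forall>i<n. \<not> P i)" using LeastI_ex[of P] not_less_Least[of _ P] by blast
next
  assume n: "P n \<and> (\<forall>i<n. \<not> P i)"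
  then have "(LEAST n. P n) = n" by (intro Least_equality) (auto simp: not_less[symmetric])
  with n show "least_option P = Some n" by (auto simp: least_option_def)
qed

text \<open>The first position after \<open>p\<close> at which \<open>k\<close> attains its maximum over all positions after \<open>p\<close>.\<close>
definition is_next_record :: "(nat \<Rightarrow> nat) \<Rightarrow> nat \<Rightarrow> nat \<Rightarrow> bool" where
  "is_next_record k p m \<longleftrightarrow> p < m \<and> (\<forall>m'>p. k m' \<le> k m) \<and> (\<forall>m'. p < m' \<longrightarrow> m' < m \<longrightarrow> k m' < k m)"

lemma finite_Max_le_iff:
  fixes k :: "nat \<Rightarrow> nat"
  assumes "A \<noteq> {}"
  shows "finite (k ` A) \<and> Max (k ` A) \<le> b \<longleftrightarrow> (\<forall>a\<in>A. k a \<le> b)"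
proof
  assume "finite (k ` A) \<and> Max (k ` A) \<le> b"
  then show "\<forall>a\<in>A. k a \<le> b" by (meson Max_ge image_eqI order_trans)
next
  assume *: "\<forall>a\<in>A. k a \<le> b"
  then have "finite (k ` A)" by (auto simp: finite_nat_set_iff_bounded_le)
  with * assms show "finite (k ` A) \<and> Max (k ` A) \<le> b" by simp
qed

text \<open>This replaces the finite maximum in the definition of the visited indices by inequalities, which
  suit both the convergence proof and measurability.\<close>
lemma m_seq_Suc_eq_Some_iff:
  "m_seq k (Suc n) = Some m \<longleftrightarrow> (\<exists>p. m_seq k n = Some p \<and> is_next_record k p m)"
proof -
  have *: "(p < m \<and> finite (k ` {p<..}) \<and> Max (k ` {p<..}) \<le> k m) \<longleftrightarrow> p < m \<and> (\<forall>m'>p. k m' \<le> k m)" for p m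
    using finite_Max_le_iff[of "{p<..}" k "k m"] by auto
  have "least_option (\<lambda>m. p < m \<and> finite (k ` {p<..}) \<and> Max (k ` {p<..}) \<le> k m) = Some m \<longleftrightarrow> is_next_record k p m" for p
  proof -
    have "(p < m \<and> (\<forall>m'>p. k m' \<le> k m)) \<and> (\<forall>i<m. \<not> (p < i \<and> (\<forall>m'>p. k m' \<le> k i))) \<longleftrightarrow> is_next_record k p m"
      unfolding is_next_record_def by (meson leD leI order_trans)
    then show ?thesis unfolding * least_option_eq_Some_iff .
  qed
  then show ?thesis by (simp add: bind_eq_Some_conv)
qed

lemma next_record_exists:
  assumes "\<And>m. m \<ge> M0 \<Longrightarrow> k m = (1::nat)"
  shows "\<exists>m. is_next_record k p m"
proof -
  have "finite (k ` {p<..})"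
  proof (rule finite_subset)
    show "k ` {p<..} \<subseteq> k ` {..<M0} \<union> {1}" using assms by (auto simp: not_less[symmetric])
  qed simp
  moreover have "k ` {p<..} \<noteq> {}" by auto
  ultimately obtain m1 where m1: "m1 > p" "Max (k ` {p<..}) = k m1" using Max_in by (metis (no_types, lifting) greaterThan_iff image_iff)
  have "k m' \<le> k m1" if "m' > p" for m'
    unfolding m1(2)[symmetric] using \<open>finite (k ` {p<..})\<close> that by (intro Max_ge) auto
  then have ex: "\<exists>m. p < m \<and> (\<forall>m'>p. k m' \<le> k m)" using m1(1) by blast
  define m where "m = (LEAST m. p < m \<and> (\<forall>m'>p. k m' \<le> k m))"
  have "p < m \<and> (\<forall>m'>p. k m' \<le> k m)" unfolding m_def by (rule LeastI_ex[OF ex])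
  moreover have "\<not> (p < i \<and> (\<forall>m'>p. k m' \<le> k i))" if "i < m" for i
    using not_less_Least that unfolding m_def by blast
  ultimately show ?thesis unfolding is_next_record_def by (meson leI order_trans)
qed

text \<open>If \<open>k\<close> is eventually \<open>1\<close>, every record has a successor, so the procedure visits indices
  without end and meets an accepted one. The index \<open>p\<close> visited just before it is the initial value \<open>0\<close>
  or was rejected; this is what the convergence proof uses about the selection.\<close>
lemma first_accepted_index:
  fixes k :: "nat \<Rightarrow> nat"
  assumes M0: "\<And>m. m \<ge> M0 \<Longrightarrow> k m = 1 \<and> Acc m"
  shows "\<exists>n m p. least_option (\<lambda>n. 1 \<le> n \<and> (\<exists>m. m_seq k n = Some m \<and> Acc m)) = Some n \<and>
    m_seq k n = Some m \<and> Acc m \<and> is_next_record k p m \<and> (p = 0 \<or> \<not> Acc p)"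
proof -
  have "\<exists>m\<ge>n. m_seq k n = Some m" for n
  proof (induction n)
    case (Suc n)
    then obtain p where p: "p \<ge> n" "m_seq k n = Some p" by blast
    obtain m where m: "is_next_record k p m" using next_record_exists[of M0 k p] M0 by blast
    then have "m_seq k (Suc n) = Some m" using p m_seq_Suc_eq_Some_iff by blast
    moreover have "m \<ge> Suc n" using m p by (simp add: is_next_record_def)
    ultimately show ?case by blast
  qed simp
  then obtain m where "m \<ge> Suc M0" "m_seq k (Suc M0) = Some m" by blast
  then have "\<exists>n. 1 \<le> n \<and> (\<exists>m. m_seq k n = Some m \<and> Acc m)" using M0 by (intro exI[of _ "Suc M0"]) auto
  then obtain n where n: "least_option (\<lambda>n. 1 \<le> n \<and> (\<exists>m. m_seq k n = Some m \<and> Acc m)) = Some n"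
    unfolding least_option_def by simp
  then have n1: "1 \<le> n" and ex: "\<exists>m. m_seq k n = Some m \<and> Acc m"
    and min: "\<And>i. i < n \<Longrightarrow> 1 \<le> i \<Longrightarrow> \<not> (\<exists>m. m_seq k i = Some m \<and> Acc m)"
    unfolding least_option_eq_Some_iff by auto
  obtain m where m: "m_seq k n = Some m" "Acc m" using ex by blast
  obtain l where l: "n = Suc l" using n1 by (cases n) auto
  obtain p where p: "m_seq k l = Some p" "is_next_record k p m" using m l m_seq_Suc_eq_Some_iff by blast
  have "p = 0 \<or> \<not> Acc p"
  proof (cases "l = 0")
    case False
    then show ?thesis using min[of l] p l by auto
  qed (use p in simp)
  with n m p show ?thesis by blast
qed

section \<open>Convergence for a fixed noise sequence\<close>

lemma square_add_le:
  fixes a b t :: real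
  assumes "t > 0"
  shows "(a + b)\<^sup>2 \<le> (1 + 1 / t) * a\<^sup>2 + (1 + t) * b\<^sup>2"
proof -
  have "0 \<le> (a - t * b)\<^sup>2 / t" using assms by simp
  also have "(a - t * b)\<^sup>2 / t = a\<^sup>2 / t + t * b\<^sup>2 - 2 * a * b"
    using assms by (simp add: field_simps power2_eq_square)
  finally show ?thesis by (simp add: field_simps power2_eq_square)
qed

lemma square_add_ge:
  fixes a b :: real
  shows "b\<^sup>2 / 2 - a\<^sup>2 \<le> (a + b)\<^sup>2"
  using square_add_le[of 1 "a + b" "- a"] by (simp add: field_simps)

text \<open>With \<open>1 - q = \<sigma>\<^sup>2\<close> this is the estimate \<open>\<sigma>\<^sup>2 (1 - \<sigma>\<^sup>2)\<^sup>k = O(1/k)\<close> that converts smoothing into decay.\<close>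
lemma power_times_gap_le_1:
  fixes q :: real
  assumes "0 \<le> q" "q \<le> 1"
  shows "real (Suc k) * q ^ k * (1 - q) \<le> 1"
proof -
  have "real (Suc k) * q ^ k = (\<Sum>i<Suc k. q ^ k)" by simp
  also have "\<dots> \<le> (\<Sum>i<Suc k. q ^ i)" using assms by (intro sum_mono power_decreasing) auto
  finally have "real (Suc k) * q ^ k * (1 - q) \<le> (\<Sum>i<Suc k. q ^ i) * (1 - q)"
    using assms by (intro mult_right_mono) auto
  also have "\<dots> = 1 - q ^ Suc k" using one_diff_power_eq[of q "Suc k"] by (simp add: mult.commute)
  also have "\<dots> \<le> 1" using assms by simp
  finally show ?thesis .
qed

text \<open>The data of a single noise path in the singular basis: \<open>\<xi> j\<close> are the coefficients of the exact
  solution, \<open>X\<close> is its squared norm, and \<open>z j\<close> are the coefficients of the noise, whose mean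
  square tends to \<open>1\<close>.\<close>
locale spectral_data =
  fixes \<sigma> \<xi> z :: "nat \<Rightarrow> real" and X \<tau> :: real
  assumes sigma_pos: "\<And>j. 1 \<le> j \<Longrightarrow> 0 < \<sigma> j"
    and sigma_le_1: "\<And>j. 1 \<le> j \<Longrightarrow> \<sigma> j \<le> 1"
    and sigma_antimono: "\<And>i j. 1 \<le> i \<Longrightarrow> i \<le> j \<Longrightarrow> \<sigma> j \<le> \<sigma> i"
    and sigma_tendsto_0: "\<sigma> \<longlonglongrightarrow> 0"
    and parseval: "(\<lambda>m. \<Sum>j=1..m. (\<xi> j)\<^sup>2) \<longlonglongrightarrow> X"
    and noise_mean: "(\<lambda>m. (\<Sum>j=1..m. (z j)\<^sup>2) / real m) \<longlonglongrightarrow> 1"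
    and tau_gt_1: "\<tau> > 1"
begin

definition q where "q j = 1 - (\<sigma> j)\<^sup>2"

definition y where "y j = \<sigma> j * \<xi> j"

text \<open>The squared residual at level \<open>m\<close> after \<open>k\<close> steps.\<close>
definition sq_res where "sq_res \<delta> m k = (\<Sum>j=1..m. (q j ^ k * (y j + \<delta> * z j))\<^sup>2)"

definition k_stop where "k_stop \<delta> m = (LEAST k. 1 \<le> k \<and> sq_res \<delta> m k \<le> \<tau>\<^sup>2 * real m * \<delta>\<^sup>2)"

definition threshold :: real where "threshold = 1 / (2 * \<tau> * exp 4)"

text \<open>The ratio test for squared residuals, with the convention \<open>0 / 0 = 0\<close>.\<close>
definition accepted where
  "accepted \<delta> m \<longleftrightarrow> 0 < sq_res \<delta> m (k_stop \<delta> m) \<and>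
     threshold\<^sup>2 * sq_res \<delta> m (k_stop \<delta> m) \<le> sq_res \<delta> m (2 * k_stop \<delta> m)"

definition selected where
  "selected \<delta> m \<longleftrightarrow> accepted \<delta> m \<and> (\<exists>p. is_next_record (k_stop \<delta>) p m \<and> (p = 0 \<or> \<not> accepted \<delta> p))"

text \<open>The squared distance of the \<open>k\<close>-th iterate at level \<open>m\<close> from the exact solution.\<close>
definition sq_error where
  "sq_error \<delta> m k = (\<Sum>j=1..m. ((1 - q j ^ k) / \<sigma> j * (y j + \<delta> * z j) - \<xi> j)\<^sup>2) + (X - (\<Sum>j=1..m. (\<xi> j)\<^sup>2))"

lemma q_bounds: "1 \<le> j \<Longrightarrow> 0 \<le> q j" "1 \<le> j \<Longrightarrow> q j < 1"
  using sigma_pos[of j] sigma_le_1[of j] by (auto simp: q_def power_le_one)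

lemma q_mono: "1 \<le> i \<Longrightarrow> i \<le> j \<Longrightarrow> q i \<le> q j"
  using sigma_antimono[of i j] sigma_pos[of j] by (auto simp: q_def intro!: power_mono)

lemma q_tendsto_1: "q \<longlonglongrightarrow> 1"
proof -
  have "(\<lambda>j. 1 - (\<sigma> j)\<^sup>2) \<longlonglongrightarrow> 1 - 0\<^sup>2" by (intro tendsto_intros sigma_tendsto_0)
  then show ?thesis by (simp add: q_def[abs_def])
qed

lemma threshold_bounds: "0 < threshold" "threshold\<^sup>2 \<le> 1/8" "threshold\<^sup>2 * \<tau>\<^sup>2 \<le> 1/8"
proof -
  have e: "exp (4::real) \<ge> 5" using exp_ge_add_one_self[of 4] by simp
  show "0 < threshold" using tau_gt_1 by (simp add: threshold_def)
  have "threshold * \<tau> = 1 / (2 * exp 4)" using tau_gt_1 by (simp add: threshold_def)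
  also have "\<dots> \<le> 1 / 10" using e by (intro divide_left_mono) auto
  finally have 1: "threshold * \<tau> \<le> 1/10" .
  have "threshold\<^sup>2 * \<tau>\<^sup>2 = (threshold * \<tau>)\<^sup>2" by (simp add: power_mult_distrib)
  also have "\<dots> \<le> (1/10)\<^sup>2" using 1 \<open>0 < threshold\<close> tau_gt_1 by (intro power_mono) auto
  also have "\<dots> \<le> 1/8" by (simp add: power2_eq_square)
  finally show ct: "threshold\<^sup>2 * \<tau>\<^sup>2 \<le> 1/8" .
  have "threshold\<^sup>2 * 1 \<le> threshold\<^sup>2 * \<tau>\<^sup>2" using tau_gt_1 by (intro mult_left_mono) auto
  with ct show "threshold\<^sup>2 \<le> 1/8" by simp
qed

lemma partial_le_X: "(\<Sum>j=1..m. (\<xi> j)\<^sup>2) \<le> X"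
proof (rule incseq_le[OF _ parseval])
  show "incseq (\<lambda>m. \<Sum>j=1..m. (\<xi> j)\<^sup>2)" by (intro monoI sum_mono2) auto
qed

lemma sq_res_nonneg: "0 \<le> sq_res \<delta> m k" unfolding sq_res_def by (intro sum_nonneg) simp

lemma sq_res_antimono:
  assumes "k \<le> l"
  shows "sq_res \<delta> m l \<le> sq_res \<delta> m k"
  unfolding sq_res_def power_mult_distrib
proof (rule sum_mono)
  fix j assume "j \<in> {1..m}"
  then have "0 \<le> q j" "q j \<le> 1" using q_bounds[of j] by auto
  then have "(q j ^ l)\<^sup>2 \<le> (q j ^ k)\<^sup>2" using assms by (intro power_mono power_decreasing) auto
  then show "(q j ^ l)\<^sup>2 * (y j + \<delta> * z j)\<^sup>2 \<le> (q j ^ k)\<^sup>2 * (y j + \<delta> * z j)\<^sup>2"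
    by (intro mult_right_mono) auto
qed

lemma sq_res_mono_m: "m \<le> n \<Longrightarrow> sq_res \<delta> m k \<le> sq_res \<delta> n k"
  unfolding sq_res_def by (intro sum_mono2) auto

lemma sq_res_ge_term: "1 \<le> j \<Longrightarrow> j \<le> m \<Longrightarrow> (q j ^ k * (y j + \<delta> * z j))\<^sup>2 \<le> sq_res \<delta> m k"
  unfolding sq_res_def by (rule member_le_sum) auto

lemma sq_res_tendsto_0: "(\<lambda>k. sq_res \<delta> m k) \<longlonglongrightarrow> 0"
proof -
  have "(\<lambda>k. sq_res \<delta> m k) \<longlonglongrightarrow> (\<Sum>j=1..m. (0 * (y j + \<delta> * z j))\<^sup>2)"
    unfolding sq_res_def
  proof (intro tendsto_sum tendsto_power tendsto_mult tendsto_const)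
    fix j assume "j \<in> {1..m}"
    then show "(\<lambda>k. q j ^ k) \<longlonglongrightarrow> 0" using q_bounds[of j] by (intro LIMSEQ_realpow_zero) auto
  qed
  then show ?thesis by simp
qed

lemma k_stop_props:
  assumes "\<delta> > 0"
  shows "1 \<le> k_stop \<delta> m" "sq_res \<delta> m (k_stop \<delta> m) \<le> \<tau>\<^sup>2 * real m * \<delta>\<^sup>2"
    and "1 \<le> k \<Longrightarrow> k < k_stop \<delta> m \<Longrightarrow> \<tau>\<^sup>2 * real m * \<delta>\<^sup>2 < sq_res \<delta> m k"
proof -
  have "\<exists>k. 1 \<le> k \<and> sq_res \<delta> m k \<le> \<tau>\<^sup>2 * real m * \<delta>\<^sup>2"
  proof (cases "m = 0")
    case True
    then show ?thesis by (intro exI[of _ 1]) (simp add: sq_res_def)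
  next
    case False
    then have "0 < \<tau>\<^sup>2 * real m * \<delta>\<^sup>2" using assms tau_gt_1 by simp
    from order_tendstoD(2)[OF sq_res_tendsto_0 this, of \<delta> m]
    have "\<forall>\<^sub>F k in sequentially. 1 \<le> k \<and> sq_res \<delta> m k \<le> \<tau>\<^sup>2 * real m * \<delta>\<^sup>2"
      using eventually_ge_at_top[of 1] by eventually_elim simp
    then show ?thesis unfolding eventually_sequentially by blast
  qed
  from LeastI_ex[OF this] show "1 \<le> k_stop \<delta> m" "sq_res \<delta> m (k_stop \<delta> m) \<le> \<tau>\<^sup>2 * real m * \<delta>\<^sup>2"
    unfolding k_stop_def by auto
  show "\<tau>\<^sup>2 * real m * \<delta>\<^sup>2 < sq_res \<delta> m k" if "1 \<le> k" "k < k_stop \<delta> m"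
    using not_less_Least[of k "\<lambda>k. 1 \<le> k \<and> sq_res \<delta> m k \<le> \<tau>\<^sup>2 * real m * \<delta>\<^sup>2"] that
    unfolding k_stop_def by simp
qed

lemma noise_upper:
  assumes "b > 1"
  shows "\<exists>P. \<forall>p\<ge>P. (\<Sum>j=1..p. (z j)\<^sup>2) \<le> b * real p"
proof -
  have "\<forall>\<^sub>F p in sequentially. (\<Sum>j=1..p. (z j)\<^sup>2) \<le> b * real p"
    using order_tendstoD(2)[OF noise_mean assms] eventually_gt_at_top[of 0]
    by eventually_elim (simp add: field_simps)
  then show ?thesis unfolding eventually_sequentially .
qed

lemma noise_lower:
  assumes "b < 1"
  shows "\<exists>P. \<forall>p\<ge>P. b * real p \<le> (\<Sum>j=1..p. (z j)\<^sup>2)"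
proof -
  have "\<forall>\<^sub>F p in sequentially. b * real p \<le> (\<Sum>j=1..p. (z j)\<^sup>2)"
    using order_tendstoD(1)[OF noise_mean assms] eventually_gt_at_top[of 0]
    by eventually_elim (simp add: field_simps)
  then show ?thesis unfolding eventually_sequentially .
qed

lemma tail_small:
  assumes "\<eta> > 0"
  shows "\<exists>J. \<forall>m\<ge>J. X - (\<Sum>j=1..m. (\<xi> j)\<^sup>2) \<le> \<eta>"
proof -
  have "\<forall>\<^sub>F m in sequentially. X - (\<Sum>j=1..m. (\<xi> j)\<^sup>2) \<le> \<eta>"
    using order_tendstoD(1)[OF parseval, of "X - \<eta>"] assms by (auto elim!: eventually_mono)
  then show ?thesis unfolding eventually_sequentially .
qed

lemma block_small:
  assumes "\<eta> > 0"
  shows "\<exists>J. \<forall>i\<ge>J. \<forall>p. (\<Sum>j\<in>{i<..p}. (\<xi> j)\<^sup>2) \<le> \<eta>"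
proof -
  obtain J where J: "\<And>m. m \<ge> J \<Longrightarrow> X - (\<Sum>j=1..m. (\<xi> j)\<^sup>2) \<le> \<eta>" using tail_small[OF assms] by blast
  have "(\<Sum>j\<in>{i<..p}. (\<xi> j)\<^sup>2) \<le> \<eta>" if "i \<ge> J" for i p
  proof (cases "i \<le> p")
    case True
    then have "(\<Sum>j=1..p. (\<xi> j)\<^sup>2) = (\<Sum>j=1..i. (\<xi> j)\<^sup>2) + (\<Sum>j\<in>{i<..p}. (\<xi> j)\<^sup>2)"
      by (rule sum_split_at)
    then show ?thesis using J[OF that] partial_le_X[of p] by linarith
  qed (use assms in simp)
  then show ?thesis by blast
qed

text \<open>All but finitely many components are barely damped during \<open>K0\<close> steps, and the signal in these
  components is small compared with \<open>\<eta>\<close>. So at high levels the noise keeps the squared residual of order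
  \<open>p \<delta>\<^sup>2\<close>, uniformly in \<open>\<delta>\<close> as long as \<open>p \<delta>\<^sup>2\<close> is bounded below.\<close>
lemma sq_res_lower_bound:
  assumes "\<eta> > 0"
  shows "\<exists>P. \<forall>p\<ge>P. \<forall>\<delta>>0. \<forall>k\<le>K0. \<eta> \<le> real p * \<delta>\<^sup>2 \<longrightarrow> real p * \<delta>\<^sup>2 / 8 \<le> sq_res \<delta> p k"
proof -
  obtain J1 where J1: "\<And>i p. i \<ge> J1 \<Longrightarrow> (\<Sum>j\<in>{i<..p}. (\<xi> j)\<^sup>2) \<le> \<eta> / 32"
    using block_small[of "\<eta> / 32"] assms by auto
  have "(\<lambda>j. (q j ^ K0)\<^sup>2) \<longlonglongrightarrow> (1 ^ K0)\<^sup>2" by (intro tendsto_intros q_tendsto_1)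
  then have "\<forall>\<^sub>F j in sequentially. 3/4 < (q j ^ K0)\<^sup>2" by (intro order_tendstoD) auto
  then obtain J2 where J2: "\<And>j. j \<ge> J2 \<Longrightarrow> 3/4 < (q j ^ K0)\<^sup>2" unfolding eventually_sequentially by blast
  define J where "J = max 1 (max J1 J2)"
  define B where "B = (\<Sum>j=1..J. (z j)\<^sup>2)"
  obtain P1 where P1: "\<And>p. p \<ge> P1 \<Longrightarrow> 7/8 * real p \<le> (\<Sum>j=1..p. (z j)\<^sup>2)"
    using noise_lower[of "7/8"] by auto
  obtain P2 where P2: "8 * B \<le> real P2" using real_arch_simple by blast
  have "real p * \<delta>\<^sup>2 / 8 \<le> sq_res \<delta> p k"
    if p: "p \<ge> max J (max P1 P2)" and "\<delta> > 0" "k \<le> K0" and eta: "\<eta> \<le> real p * \<delta>\<^sup>2" for p \<delta> k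
  proof -
    have "(\<Sum>j=1..p. (z j)\<^sup>2) = B + (\<Sum>j\<in>{J<..p}. (z j)\<^sup>2)"
      unfolding B_def using p by (intro sum_split_at) simp
    then have zb: "3/4 * real p \<le> (\<Sum>j\<in>{J<..p}. (z j)\<^sup>2)"
      using P1[of p] P2 p by simp
    have yb: "(\<Sum>j\<in>{J<..p}. (y j)\<^sup>2) \<le> \<eta> / 32"
    proof -
      have "(\<Sum>j\<in>{J<..p}. (y j)\<^sup>2) \<le> (\<Sum>j\<in>{J<..p}. (\<xi> j)\<^sup>2)"
      proof (rule sum_mono)
        fix j assume "j \<in> {J<..p}"
        then have "(\<sigma> j)\<^sup>2 \<le> 1" using sigma_pos[of j] sigma_le_1[of j] by (simp add: power_le_one)
        then show "(y j)\<^sup>2 \<le> (\<xi> j)\<^sup>2" unfolding y_def power_mult_distrib by (simp add: mult_left_le_one_le)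
      qed
      also have "\<dots> \<le> \<eta> / 32" by (rule J1) (simp add: J_def)
      finally show ?thesis .
    qed
    define D where "D = (\<Sum>j\<in>{J<..p}. (\<delta> * z j)\<^sup>2 / 2 - (y j)\<^sup>2)"
    have "D = \<delta>\<^sup>2 / 2 * (\<Sum>j\<in>{J<..p}. (z j)\<^sup>2) - (\<Sum>j\<in>{J<..p}. (y j)\<^sup>2)"
      unfolding D_def by (simp add: sum_subtractf power_mult_distrib sum_distrib_left)
    moreover have "\<delta>\<^sup>2 / 2 * (3/4 * real p) \<le> \<delta>\<^sup>2 / 2 * (\<Sum>j\<in>{J<..p}. (z j)\<^sup>2)"
      by (intro mult_left_mono zb) simp
    moreover have "\<delta>\<^sup>2 / 2 * (3/4 * real p) = 3/8 * (real p * \<delta>\<^sup>2)" by simp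
    moreover have "0 < real p * \<delta>\<^sup>2" using assms eta by linarith
    ultimately have D: "real p * \<delta>\<^sup>2 / 4 \<le> D" using yb eta by linarith
    have "3/4 * D \<le> 3/4 * (\<Sum>j\<in>{J<..p}. (y j + \<delta> * z j)\<^sup>2)"
      unfolding D_def using square_add_ge by (intro mult_left_mono sum_mono) auto
    also have "\<dots> = (\<Sum>j\<in>{J<..p}. 3/4 * (y j + \<delta> * z j)\<^sup>2)" by (rule sum_distrib_left)
    also have "\<dots> \<le> (\<Sum>j\<in>{J<..p}. (q j ^ k * (y j + \<delta> * z j))\<^sup>2)"
    proof (rule sum_mono)
      fix j assume j: "j \<in> {J<..p}"
      then have q: "0 \<le> q j" "q j \<le> 1" using q_bounds[of j] by auto
      have "3/4 \<le> (q j ^ K0)\<^sup>2" using J2[of j] j by (simp add: J_def less_imp_le)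
      also have "\<dots> \<le> (q j ^ k)\<^sup>2" using q \<open>k \<le> K0\<close> by (intro power_mono power_decreasing) auto
      finally show "3/4 * (y j + \<delta> * z j)\<^sup>2 \<le> (q j ^ k * (y j + \<delta> * z j))\<^sup>2"
        unfolding power_mult_distrib by (intro mult_right_mono) auto
    qed
    also have "\<dots> \<le> sq_res \<delta> p k" unfolding sq_res_def by (intro sum_mono2) (auto simp: J_def)
    finally have "3/4 * D \<le> sq_res \<delta> p k" .
    moreover have "0 \<le> real p * \<delta>\<^sup>2" by simp
    ultimately show ?thesis using D by linarith
  qed
  then show ?thesis by (metis (no_types, lifting))
qed

lemma accepted_if_sq_res_lower_bound:
  assumes "\<delta> > 0" "p \<ge> 1" "real p * \<delta>\<^sup>2 / 8 \<le> sq_res \<delta> p (2 * k_stop \<delta> p)"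
  shows "accepted \<delta> p"
proof -
  have pos: "0 < real p * \<delta>\<^sup>2" using assms by simp
  have "sq_res \<delta> p (2 * k_stop \<delta> p) \<le> sq_res \<delta> p (k_stop \<delta> p)" by (intro sq_res_antimono) simp
  moreover have "threshold\<^sup>2 * sq_res \<delta> p (k_stop \<delta> p) \<le> threshold\<^sup>2 * (\<tau>\<^sup>2 * real p * \<delta>\<^sup>2)"
    using k_stop_props(2)[OF assms(1)] by (intro mult_left_mono) auto
  moreover have "threshold\<^sup>2 * \<tau>\<^sup>2 * (real p * \<delta>\<^sup>2) \<le> 1/8 * (real p * \<delta>\<^sup>2)"
    using threshold_bounds(3) pos by (intro mult_right_mono) auto
  ultimately show ?thesis unfolding accepted_def using assms(3) pos by (simp add: mult.assoc)
qed

text \<open>Stopping within \<open>K0\<close> steps means that the damped \<open>j\<close>-th component is below the noise level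
  \<open>\<tau>\<^sup>2 p \<delta>\<^sup>2\<close>. The component is nonzero, so \<open>p \<delta>\<^sup>2\<close> is bounded below and \<open>sq_res_lower_bound\<close>
  applies up to twice the stopping index.\<close>
lemma accepted_if_k_stop_bounded:
  assumes j: "1 \<le> j" "q j * y j \<noteq> 0"
  shows "\<exists>P. \<forall>p\<ge>P. \<forall>\<delta>>0. k_stop \<delta> p \<le> K0 \<longrightarrow> accepted \<delta> p"
proof -
  define \<eta> where "\<eta> = (q j ^ K0 * y j)\<^sup>2 / (2 * \<tau>\<^sup>2 + 4)"
  have den: "2 * \<tau>\<^sup>2 + 4 > 0" by (simp add: add_nonneg_pos)
  have "\<eta> > 0" using j den by (simp add: \<eta>_def)
  from sq_res_lower_bound[OF this, of "2 * K0"] obtain P1 where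
    P1: "\<And>p \<delta> k. p \<ge> P1 \<Longrightarrow> \<delta> > 0 \<Longrightarrow> k \<le> 2 * K0 \<Longrightarrow> \<eta> \<le> real p * \<delta>\<^sup>2 \<Longrightarrow> real p * \<delta>\<^sup>2 / 8 \<le> sq_res \<delta> p k"
    by blast
  obtain P2 where P2: "\<And>p. p \<ge> P2 \<Longrightarrow> (\<Sum>j=1..p. (z j)\<^sup>2) \<le> 2 * real p" using noise_upper[of 2] by auto
  have "accepted \<delta> p" if p: "p \<ge> max j (max P1 P2)" and \<delta>: "\<delta> > 0" and k: "k_stop \<delta> p \<le> K0" for p \<delta>
  proof -
    define k where "k = k_stop \<delta> p"
    have qj: "0 \<le> q j" "q j \<le> 1" using q_bounds[of j] j by auto
    have "(z j)\<^sup>2 \<le> (\<Sum>j=1..p. (z j)\<^sup>2)" using p j by (intro member_le_sum) auto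
    then have zj: "(z j)\<^sup>2 \<le> 2 * real p" using P2[of p] p by simp
    have "(q j ^ k * y j)\<^sup>2 / 2 - (\<delta> * z j)\<^sup>2 \<le> (q j ^ k * (y j + \<delta> * z j))\<^sup>2"
    proof -
      have "(q j ^ k)\<^sup>2 * (\<delta> * z j)\<^sup>2 \<le> 1 * (\<delta> * z j)\<^sup>2"
        using qj by (intro mult_right_mono power_le_one) (auto intro: power_le_one)
      moreover have "(q j ^ k)\<^sup>2 * ((y j)\<^sup>2 / 2 - (\<delta> * z j)\<^sup>2) \<le> (q j ^ k)\<^sup>2 * (y j + \<delta> * z j)\<^sup>2"
        using square_add_ge[of "y j" "\<delta> * z j"] square_add_ge[of "\<delta> * z j" "y j"]
        by (intro mult_left_mono) (auto simp: add.commute)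
      ultimately show ?thesis
        unfolding power_mult_distrib[of "q j ^ k"] by (simp add: right_diff_distrib)
    qed
    also have "\<dots> \<le> sq_res \<delta> p k" using p j by (intro sq_res_ge_term) auto
    also have "\<dots> \<le> \<tau>\<^sup>2 * real p * \<delta>\<^sup>2" unfolding k_def by (rule k_stop_props(2)[OF \<delta>])
    finally have 1: "(q j ^ k * y j)\<^sup>2 / 2 - \<delta>\<^sup>2 * (z j)\<^sup>2 \<le> \<tau>\<^sup>2 * real p * \<delta>\<^sup>2" by (simp add: power_mult_distrib)
    have "\<delta>\<^sup>2 * (z j)\<^sup>2 \<le> \<delta>\<^sup>2 * (2 * real p)" using zj by (intro mult_left_mono) auto
    with 1 have 2: "(q j ^ k * y j)\<^sup>2 \<le> (2 * \<tau>\<^sup>2 + 4) * (real p * \<delta>\<^sup>2)" by (simp add: algebra_simps)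
    have "q j ^ K0 \<le> q j ^ k" using qj k by (intro power_decreasing) (auto simp: k_def)
    then have "(q j ^ K0 * y j)\<^sup>2 \<le> (q j ^ k * y j)\<^sup>2"
      unfolding power_mult_distrib using qj by (intro mult_right_mono power_mono) auto
    with 2 have "\<eta> \<le> real p * \<delta>\<^sup>2" unfolding \<eta>_def using den by (simp add: field_simps)
    then have "real p * \<delta>\<^sup>2 / 8 \<le> sq_res \<delta> p (2 * k)" using P1[of p \<delta> "2 * k"] p \<delta> k by (simp add: k_def)
    then show ?thesis using p j \<delta> unfolding k_def by (intro accepted_if_sq_res_lower_bound) auto
  qed
  then show ?thesis by blast
qed

text \<open>The weights are chosen so that the noise part has a factor \<open>\<tau> (1 + \<tau>) / 2 < \<tau>\<^sup>2\<close>: below the level of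
  the discrepancy principle there is room left for the signal.\<close>
lemma sq_res_upper_bound:
  assumes "(\<Sum>j=1..m. (z j)\<^sup>2) \<le> (1 + \<tau>) / 2 * real m"
  shows "sq_res \<delta> m k \<le> \<tau> / (\<tau> - 1) * (\<Sum>j=1..m. (q j ^ k * y j)\<^sup>2) + \<tau> * ((1 + \<tau>) / 2) * (real m * \<delta>\<^sup>2)"
proof -
  define t where "t = \<tau> - 1"
  have t: "t > 0" "1 + t = \<tau>" "1 + 1 / t = \<tau> / (\<tau> - 1)" using tau_gt_1 by (auto simp: t_def field_simps)
  have "sq_res \<delta> m k \<le> (\<Sum>j=1..m. \<tau> / (\<tau> - 1) * (q j ^ k * y j)\<^sup>2 + \<tau> * (\<delta>\<^sup>2 * (z j)\<^sup>2))"
    unfolding sq_res_def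
  proof (rule sum_mono)
    fix j assume "j \<in> {1..m}"
    then have "(q j ^ k)\<^sup>2 \<le> 1" using q_bounds[of j] by (intro power_le_one) (auto intro: power_le_one)
    then have "(q j ^ k)\<^sup>2 * (\<delta> * z j)\<^sup>2 \<le> 1 * (\<delta> * z j)\<^sup>2" by (intro mult_right_mono) auto
    then have "\<tau> * (q j ^ k * (\<delta> * z j))\<^sup>2 \<le> \<tau> * (\<delta>\<^sup>2 * (z j)\<^sup>2)"
      using tau_gt_1 by (intro mult_left_mono) (auto simp: power_mult_distrib)
    moreover have "(q j ^ k * (y j + \<delta> * z j))\<^sup>2 \<le> \<tau> / (\<tau> - 1) * (q j ^ k * y j)\<^sup>2 + \<tau> * (q j ^ k * (\<delta> * z j))\<^sup>2"
      using square_add_le[OF t(1), of "q j ^ k * y j" "q j ^ k * (\<delta> * z j)"] by (simp add: t distrib_left)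
    ultimately show "(q j ^ k * (y j + \<delta> * z j))\<^sup>2 \<le> \<tau> / (\<tau> - 1) * (q j ^ k * y j)\<^sup>2 + \<tau> * (\<delta>\<^sup>2 * (z j)\<^sup>2)"
      by linarith
  qed
  also have "\<dots> = \<tau> / (\<tau> - 1) * (\<Sum>j=1..m. (q j ^ k * y j)\<^sup>2) + \<tau> * \<delta>\<^sup>2 * (\<Sum>j=1..m. (z j)\<^sup>2)"
    by (simp add: sum.distrib sum_distrib_left mult.assoc)
  also have "\<tau> * \<delta>\<^sup>2 * (\<Sum>j=1..m. (z j)\<^sup>2) \<le> \<tau> * \<delta>\<^sup>2 * ((1 + \<tau>) / 2 * real m)"
    using assms tau_gt_1 by (intro mult_left_mono) auto
  finally show ?thesis by (simp add: mult_ac)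
qed

lemma signal_le_X: "(\<Sum>j=1..m. (q j ^ k * y j)\<^sup>2) \<le> X"
proof -
  have "(\<Sum>j=1..m. (q j ^ k * y j)\<^sup>2) \<le> (\<Sum>j=1..m. (\<xi> j)\<^sup>2)"
  proof (rule sum_mono)
    fix j assume j: "j \<in> {1..m}"
    have "(q j ^ k)\<^sup>2 \<le> 1" using q_bounds[of j] j by (intro power_le_one) (auto intro: power_le_one)
    moreover have "(\<sigma> j)\<^sup>2 \<le> 1" using sigma_pos[of j] sigma_le_1[of j] j by (simp add: power_le_one)
    ultimately have "(q j ^ k)\<^sup>2 * (\<sigma> j)\<^sup>2 * (\<xi> j)\<^sup>2 \<le> 1 * 1 * (\<xi> j)\<^sup>2"
      by (intro mult_right_mono mult_mono) auto
    then show "(q j ^ k * y j)\<^sup>2 \<le> (\<xi> j)\<^sup>2" by (simp add: y_def power_mult_distrib mult.assoc)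
  qed
  with partial_le_X show ?thesis by (rule order_trans[rotated])
qed

text \<open>At a fixed noise level the signal is negligible against \<open>m \<delta>\<^sup>2\<close> for large \<open>m\<close>. This makes the
  procedure well defined and lets it terminate.\<close>
lemma eventually_stops_at_first_step:
  assumes \<delta>: "\<delta> > 0"
  shows "\<exists>M0. \<forall>m\<ge>M0. k_stop \<delta> m = 1 \<and> accepted \<delta> m"
proof -
  obtain P1 where P1: "\<And>p \<delta> k. p \<ge> P1 \<Longrightarrow> \<delta> > 0 \<Longrightarrow> k \<le> 2 \<Longrightarrow> 1 \<le> real p * \<delta>\<^sup>2 \<Longrightarrow> real p * \<delta>\<^sup>2 / 8 \<le> sq_res \<delta> p k"
    using sq_res_lower_bound[of 1 2] by auto
  obtain P2 where P2: "\<And>p. p \<ge> P2 \<Longrightarrow> (\<Sum>j=1..p. (z j)\<^sup>2) \<le> (1 + \<tau>) / 2 * real p"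
    using noise_upper[of "(1 + \<tau>) / 2"] tau_gt_1 by auto
  define g where "g = \<tau>\<^sup>2 - \<tau> * ((1 + \<tau>) / 2)"
  have "g = \<tau> * (\<tau> - 1) / 2" by (simp add: g_def power2_eq_square field_simps)
  moreover have "0 < \<tau> * (\<tau> - 1) / 2" using tau_gt_1 by simp
  ultimately have g: "g > 0" by (simp only:)
  obtain P3 where P3: "max 1 (\<tau> / (\<tau> - 1) * X / g) / \<delta>\<^sup>2 \<le> real P3" using real_arch_simple by blast
  have "k_stop \<delta> m = 1 \<and> accepted \<delta> m" if m: "m \<ge> max 1 (max P1 (max P2 P3))" for m
  proof -
    have "max 1 (\<tau> / (\<tau> - 1) * X / g) / \<delta>\<^sup>2 \<le> real m" using P3 m by simp
    then have m': "max 1 (\<tau> / (\<tau> - 1) * X / g) \<le> real m * \<delta>\<^sup>2" using \<delta> by (simp add: pos_divide_le_eq)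
    have "sq_res \<delta> m 1 \<le> \<tau> / (\<tau> - 1) * (\<Sum>j=1..m. (q j ^ 1 * y j)\<^sup>2) + \<tau> * ((1 + \<tau>) / 2) * (real m * \<delta>\<^sup>2)"
      using P2 m by (intro sq_res_upper_bound) auto
    also have "\<tau> / (\<tau> - 1) * (\<Sum>j=1..m. (q j ^ 1 * y j)\<^sup>2) \<le> \<tau> / (\<tau> - 1) * X"
      using tau_gt_1 by (intro mult_left_mono signal_le_X) auto
    also have "\<tau> / (\<tau> - 1) * X \<le> g * (real m * \<delta>\<^sup>2)"
    proof -
      have "\<tau> / (\<tau> - 1) * X / g \<le> real m * \<delta>\<^sup>2" using m' by (simp only: max.bounded_iff)
      then show ?thesis by (simp only: pos_divide_le_eq[OF g] mult.commute[of g])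
    qed
    finally have "sq_res \<delta> m 1 \<le> \<tau>\<^sup>2 * real m * \<delta>\<^sup>2" by (simp add: g_def algebra_simps)
    then have k1: "k_stop \<delta> m = 1" unfolding k_stop_def by (intro Least_equality) auto
    have "real m * \<delta>\<^sup>2 / 8 \<le> sq_res \<delta> m (2 * k_stop \<delta> m)" unfolding k1 using P1[of m \<delta> 2] m \<delta> m' by simp
    then show ?thesis using k1 m \<delta> by (auto intro: accepted_if_sq_res_lower_bound)
  qed
  then show ?thesis by blast
qed

text \<open>The \<open>j\<close>-th component of the residual tends to a positive limit, whereas the level required by the
  discrepancy principle tends to \<open>0\<close>.\<close>
lemma k_stop_large_for_small_noise:
  assumes j: "1 \<le> j" "q j * y j \<noteq> 0" and l: "j \<le> l"
  shows "\<forall>\<^sub>F \<delta> in at_right 0. K1 < k_stop \<delta> l"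
proof -
  have "((\<lambda>\<delta>. (q j ^ K1 * (y j + \<delta> * z j))\<^sup>2 - \<tau>\<^sup>2 * real l * \<delta>\<^sup>2) \<longlongrightarrow>
      (q j ^ K1 * (y j + 0 * z j))\<^sup>2 - \<tau>\<^sup>2 * real l * 0\<^sup>2) (at_right 0)"
    by (intro tendsto_intros)
  moreover have "0 < (q j ^ K1 * (y j + 0 * z j))\<^sup>2 - \<tau>\<^sup>2 * real l * 0\<^sup>2" using j by simp
  ultimately have "\<forall>\<^sub>F \<delta> in at_right 0. 0 < (q j ^ K1 * (y j + \<delta> * z j))\<^sup>2 - \<tau>\<^sup>2 * real l * \<delta>\<^sup>2"
    by (rule order_tendstoD)
  then show ?thesis using eventually_at_right_less[of 0]
  proof eventually_elim
    case (elim \<delta>)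
    show ?case
    proof (rule ccontr)
      assume "\<not> K1 < k_stop \<delta> l"
      then have "sq_res \<delta> l K1 \<le> sq_res \<delta> l (k_stop \<delta> l)" by (intro sq_res_antimono) simp
      with k_stop_props(2)[OF elim(2), of l] sq_res_ge_term[OF j(1) l, of K1 \<delta>] elim(1) show False by linarith
    qed
  qed
qed

text \<open>Log-convexity in the number of steps, by the Cauchy--Schwarz inequality.\<close>
lemma sq_res_log_convex: "(sq_res \<delta> m (a + h))\<^sup>2 \<le> sq_res \<delta> m a * sq_res \<delta> m (a + 2 * h)"
proof -
  define f where "f k j = q j ^ k * (y j + \<delta> * z j)" for k j
  have "f (a + h) j * f (a + h) j = f a j * f (a + 2 * h) j" for j
    by (simp add: f_def power_add power2_eq_square power_mult mult_ac)
  then have "sq_res \<delta> m (a + h) = (\<Sum>j=1..m. f a j * f (a + 2 * h) j)"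
    unfolding sq_res_def f_def[symmetric] by (simp add: power2_eq_square)
  then have "(sq_res \<delta> m (a + h))\<^sup>2 = (\<Sum>j=1..m. f a j * f (a + 2 * h) j)\<^sup>2" by simp
  also have "\<dots> \<le> (\<Sum>j=1..m. (f a j)\<^sup>2) * (\<Sum>j=1..m. (f (a + 2 * h) j)\<^sup>2)"
    by (rule Cauchy_Schwarz_ineq_sum)
  finally show ?thesis by (simp add: sq_res_def f_def)
qed

text \<open>Let \<open>k\<close> be the stopping index at \<open>p\<close>. At level \<open>p + 1\<close> the squared residual is below
  \<open>\<tau>\<^sup>2 (p + 1) \<delta>\<^sup>2\<close> after \<open>K1\<close> steps, and at level \<open>p\<close> it is above \<open>\<tau>\<^sup>2 p \<delta>\<^sup>2\<close> after \<open>k - 1\<close> steps. So at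
  level \<open>p\<close> it loses at most the factor \<open>2\<close> during \<open>h = k - 1 - K1\<close> steps, and by log-convexity at most
  the factor \<open>2\<close> in each of the next two blocks of \<open>h\<close> steps, which reach step \<open>2 k\<close>.\<close>
lemma accepted_before_drop:
  assumes \<delta>: "\<delta> > 0" and p: "p \<ge> 1" and K1: "K1 \<ge> 1"
    and high: "2 * K1 + 3 \<le> k_stop \<delta> p" and low: "k_stop \<delta> (Suc p) \<le> K1"
  shows "accepted \<delta> p"
proof -
  define k where "k = k_stop \<delta> p"
  define h where "h = k - 1 - K1"
  define s where "s i = sq_res \<delta> p (K1 + i * h)" for i
  have k: "k - 1 = K1 + h" "2 * k \<le> K1 + 3 * h" using high by (auto simp: k_def h_def)
  have "s 0 \<le> sq_res \<delta> (Suc p) K1" unfolding s_def using sq_res_mono_m[of p "Suc p"] by simp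
  also have "\<dots> \<le> sq_res \<delta> (Suc p) (k_stop \<delta> (Suc p))" by (rule sq_res_antimono[OF low])
  also have "\<dots> \<le> \<tau>\<^sup>2 * real (Suc p) * \<delta>\<^sup>2" by (rule k_stop_props(2)[OF \<delta>])
  also have "\<dots> \<le> 2 * (\<tau>\<^sup>2 * real p * \<delta>\<^sup>2)"
  proof -
    have "\<tau>\<^sup>2 * real (Suc p) * \<delta>\<^sup>2 \<le> \<tau>\<^sup>2 * (2 * real p) * \<delta>\<^sup>2"
      using p by (intro mult_left_mono mult_right_mono) auto
    then show ?thesis by simp
  qed
  finally have s0: "s 0 \<le> 2 * (\<tau>\<^sup>2 * real p * \<delta>\<^sup>2)" .
  have s1: "\<tau>\<^sup>2 * real p * \<delta>\<^sup>2 < s 1"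
    using k_stop_props(3)[OF \<delta>, of "k - 1" p] k high K1 by (simp add: s_def k_def[symmetric])
  have pos: "0 < \<tau>\<^sup>2 * real p * \<delta>\<^sup>2" using \<delta> p tau_gt_1 by simp
  have conv: "(s (Suc i))\<^sup>2 \<le> s i * s (Suc (Suc i))" for i
  proof -
    have "K1 + Suc i * h = K1 + i * h + h" "K1 + Suc (Suc i) * h = K1 + i * h + 2 * h" by auto
    then show ?thesis unfolding s_def using sq_res_log_convex[of \<delta> p "K1 + i * h" h] by (simp only:)
  qed
  have half: "s 1 / 2 \<le> s 2"
  proof -
    have "s 1 * s 1 \<le> s 0 * s 2" using conv[of 0] by (simp add: power2_eq_square numeral_2_eq_2)
    also have "\<dots> \<le> (2 * s 1) * s 2" using s0 s1 sq_res_nonneg by (intro mult_right_mono) (auto simp: s_def)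
    finally show ?thesis using s1 pos by (simp add: field_simps)
  qed
  have "s 2 / 2 \<le> s 3"
  proof -
    have "s 2 * s 2 \<le> s 1 * s 3" using conv[of 1] by (simp add: power2_eq_square numeral_2_eq_2 numeral_3_eq_3)
    also have "\<dots> \<le> (2 * s 2) * s 3" using half sq_res_nonneg by (intro mult_right_mono) (auto simp: s_def)
    finally show ?thesis using half s1 pos by (simp add: field_simps)
  qed
  with half have "s 1 / 4 \<le> s 3" by linarith
  also have "s 3 \<le> sq_res \<delta> p (2 * k)" unfolding s_def using k by (intro sq_res_antimono) simp
  finally have A: "s 1 / 4 \<le> sq_res \<delta> p (2 * k)" .
  have B: "sq_res \<delta> p k \<le> s 1" unfolding s_def using k by (intro sq_res_antimono) simp
  have "sq_res \<delta> p (2 * k) \<le> sq_res \<delta> p k" by (intro sq_res_antimono) simp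
  then have "0 < sq_res \<delta> p k" using A s1 pos by linarith
  moreover have "threshold\<^sup>2 * sq_res \<delta> p k \<le> 1/8 * sq_res \<delta> p k" by (intro mult_right_mono threshold_bounds sq_res_nonneg)
  ultimately show ?thesis unfolding accepted_def k_def[symmetric] using A B by linarith
qed

text \<open>If the selected level stopped within \<open>K\<close> steps, so would all levels beyond its predecessor \<open>p\<close>. A
  fixed level \<open>l\<close> stops later than that, hence \<open>p \<ge> l\<close>. Whether \<open>p\<close> stops early or late, it is accepted,
  contrary to the choice of \<open>p\<close>.\<close>
lemma selected_k_stop_large:
  assumes j: "1 \<le> j" "q j * y j \<noteq> 0"
  shows "\<forall>\<^sub>F \<delta> in at_right 0. \<forall>m. selected \<delta> m \<longrightarrow> K1 < k_stop \<delta> m"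
proof -
  define K where "K = max 1 K1"
  obtain P where P: "\<And>p \<delta>. p \<ge> P \<Longrightarrow> \<delta> > 0 \<Longrightarrow> k_stop \<delta> p \<le> 2 * K + 2 \<Longrightarrow> accepted \<delta> p"
    using accepted_if_k_stop_bounded[OF j] by blast
  define l where "l = max j P"
  have "\<forall>\<^sub>F \<delta> in at_right 0. K < k_stop \<delta> l" by (rule k_stop_large_for_small_noise[OF j]) (simp add: l_def)
  then show ?thesis using eventually_at_right_less[of 0]
  proof eventually_elim
    case (elim \<delta>)
    show ?case
    proof (intro allI impI, rule ccontr)
      fix m assume sel: "selected \<delta> m" and "\<not> K1 < k_stop \<delta> m"
      then have km: "k_stop \<delta> m \<le> K" by (simp add: K_def)
      obtain p where p: "is_next_record (k_stop \<delta>) p m" "p = 0 \<or> \<not> accepted \<delta> p" using sel by (auto simp: selected_def)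
      have le: "k_stop \<delta> m' \<le> K" if "m' > p" for m'
        using p(1) km that by (auto simp: is_next_record_def intro: order_trans)
      have "l \<le> p" using le[of l] elim(1) by (meson leD leI)
      then have p1: "p \<ge> 1" "p \<ge> P" using j by (auto simp: l_def)
      have "accepted \<delta> p"
      proof (cases "k_stop \<delta> p \<le> 2 * K + 2")
        case True
        then show ?thesis using P[OF p1(2) elim(2)] by simp
      next
        case False
        then show ?thesis using le[of "Suc p"] p1
          by (intro accepted_before_drop[OF elim(2), of p K]) (auto simp: K_def)
      qed
      with p(2) p1(1) show False by simp
    qed
  qed
qed

text \<open>At levels up to \<open>M1\<close> all components are damped at least by the factor \<open>q (M1 + 1) < 1\<close> per step, so
  after many steps doubling their number brings the ratio of the residuals below the threshold.\<close>
lemma accepted_k_stop_bounded: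
  "\<exists>K2. \<forall>\<delta>>0. \<forall>m\<le>M1. accepted \<delta> m \<longrightarrow> k_stop \<delta> m < K2"
proof -
  \<comment> \<open>The index \<open>Suc M1\<close> is positive also for \<open>M1 = 0\<close>.\<close>
  define r where "r = q (Suc M1)"
  have r: "0 \<le> r" "r < 1" using q_bounds[of "Suc M1"] by (auto simp: r_def)
  have "(\<lambda>k. (r ^ k)\<^sup>2) \<longlonglongrightarrow> 0\<^sup>2" using r by (intro tendsto_power LIMSEQ_realpow_zero) auto
  then have "\<forall>\<^sub>F k in sequentially. (r ^ k)\<^sup>2 < threshold\<^sup>2" by (rule order_tendstoD) (use threshold_bounds in simp)
  then obtain K2 where K2: "\<And>k. k \<ge> K2 \<Longrightarrow> (r ^ k)\<^sup>2 < threshold\<^sup>2" unfolding eventually_sequentially by blast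
  have "k_stop \<delta> m < K2" if m: "m \<le> M1" and accepted: "accepted \<delta> m" for \<delta> m
  proof (rule ccontr)
    assume "\<not> k_stop \<delta> m < K2"
    define k where "k = k_stop \<delta> m"
    have k: "(r ^ k)\<^sup>2 < threshold\<^sup>2" using K2[of k] \<open>\<not> k_stop \<delta> m < K2\<close> by (simp add: k_def)
    have "sq_res \<delta> m (2 * k) \<le> (\<Sum>j=1..m. (r ^ k)\<^sup>2 * (q j ^ k * (y j + \<delta> * z j))\<^sup>2)"
      unfolding sq_res_def
    proof (rule sum_mono)
      fix j assume j: "j \<in> {1..m}"
      then have "(q j ^ k)\<^sup>2 \<le> (r ^ k)\<^sup>2"
        unfolding r_def using q_bounds[of j] q_mono[of j "Suc M1"] m by (intro power_mono) auto
      then have *: "(q j ^ k)\<^sup>2 * (q j ^ k * (y j + \<delta> * z j))\<^sup>2 \<le> (r ^ k)\<^sup>2 * (q j ^ k * (y j + \<delta> * z j))\<^sup>2"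
        by (intro mult_right_mono) auto
      show "(q j ^ (2 * k) * (y j + \<delta> * z j))\<^sup>2 \<le> (r ^ k)\<^sup>2 * (q j ^ k * (y j + \<delta> * z j))\<^sup>2"
      proof -
        have "q j ^ (2 * k) = q j ^ k * q j ^ k" by (simp add: mult_2 power_add)
        then have "(q j ^ (2 * k) * (y j + \<delta> * z j))\<^sup>2 = (q j ^ k)\<^sup>2 * (q j ^ k * (y j + \<delta> * z j))\<^sup>2"
          by (simp only: power2_eq_square mult_ac)
        then show ?thesis using * by simp
      qed
    qed
    also have "\<dots> = (r ^ k)\<^sup>2 * sq_res \<delta> m k" unfolding sq_res_def by (rule sum_distrib_left[symmetric])
    also have "\<dots> < threshold\<^sup>2 * sq_res \<delta> m k"
      using k accepted by (intro mult_strict_right_mono) (auto simp: accepted_def k_def)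
    finally show False using accepted by (simp add: accepted_def k_def)
  qed
  then show ?thesis by blast
qed

text \<open>Uniformly in \<open>m\<close>: the tail of the squared coefficients is small, and the finitely many remaining
  ones are damped geometrically.\<close>
lemma damped_source_small:
  assumes "\<eta> > 0"
  shows "\<exists>K. \<forall>k\<ge>K. \<forall>m. (\<Sum>j=1..m. q j ^ k * (\<xi> j)\<^sup>2) \<le> \<eta>"
proof -
  obtain J0 where J0: "\<And>i p. i \<ge> J0 \<Longrightarrow> (\<Sum>j\<in>{i<..p}. (\<xi> j)\<^sup>2) \<le> \<eta> / 2"
    using block_small[of "\<eta> / 2"] assms by auto
  define J where "J = max 1 J0"
  have qJ: "0 \<le> q J" "q J < 1" using q_bounds[of J] by (auto simp: J_def)
  have "(\<lambda>k. q J ^ k * X) \<longlonglongrightarrow> 0 * X" using qJ by (intro tendsto_mult LIMSEQ_realpow_zero tendsto_const) auto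
  then have "\<forall>\<^sub>F k in sequentially. q J ^ k * X < \<eta> / 2" by (rule order_tendstoD) (use assms in simp)
  then obtain K where K: "\<And>k. k \<ge> K \<Longrightarrow> q J ^ k * X < \<eta> / 2" unfolding eventually_sequentially by blast
  have "(\<Sum>j=1..m. q j ^ k * (\<xi> j)\<^sup>2) \<le> \<eta>" if "k \<ge> K" for k m
  proof -
    have "(\<Sum>j=1..m. q j ^ k * (\<xi> j)\<^sup>2) \<le> (\<Sum>j\<in>{1..J} \<union> {J<..m}. q j ^ k * (\<xi> j)\<^sup>2)"
      using q_bounds by (intro sum_mono2) auto
    also have "\<dots> = (\<Sum>j=1..J. q j ^ k * (\<xi> j)\<^sup>2) + (\<Sum>j\<in>{J<..m}. q j ^ k * (\<xi> j)\<^sup>2)"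
      by (rule sum.union_disjoint) auto
    also have "(\<Sum>j=1..J. q j ^ k * (\<xi> j)\<^sup>2) \<le> (\<Sum>j=1..J. q J ^ k * (\<xi> j)\<^sup>2)"
      using q_bounds q_mono by (intro sum_mono mult_right_mono power_mono) auto
    also have "\<dots> = q J ^ k * (\<Sum>j=1..J. (\<xi> j)\<^sup>2)" by (rule sum_distrib_left[symmetric])
    also have "\<dots> \<le> q J ^ k * X" using qJ by (intro mult_left_mono partial_le_X) auto
    also have "\<dots> \<le> \<eta> / 2" using K[OF that] by simp
    also have "(\<Sum>j\<in>{J<..m}. q j ^ k * (\<xi> j)\<^sup>2) \<le> (\<Sum>j\<in>{J<..m}. 1 * (\<xi> j)\<^sup>2)"
    proof (intro sum_mono mult_right_mono)
      fix j assume "j \<in> {J<..m}"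
      then show "q j ^ k \<le> 1" using q_bounds[of j] by (intro power_le_one) auto
    qed simp
    also have "\<dots> \<le> \<eta> / 2" using J0[of J m] by (simp add: J_def)
    finally show ?thesis by simp
  qed
  then show ?thesis by blast
qed

text \<open>Bounds for the squared factor by which the iteration amplifies the noise in the \<open>j\<close>-th component.\<close>
lemma filter_square_le:
  assumes "1 \<le> j"
  shows "((1 - q j ^ k) / \<sigma> j)\<^sup>2 \<le> real k" "((1 - q j ^ k) / \<sigma> j)\<^sup>2 \<le> 1 / (\<sigma> j)\<^sup>2"
proof -
  have q: "0 \<le> q j" "q j \<le> 1" using q_bounds[OF assms] by auto
  have qk: "0 \<le> 1 - q j ^ k" "1 - q j ^ k \<le> 1" using q by (auto simp: power_le_one)
  have s: "0 < (\<sigma> j)\<^sup>2" using sigma_pos[OF assms] by simp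
  have "(1 - q j ^ k)\<^sup>2 \<le> 1" using qk by (intro power_le_one) auto
  then show "((1 - q j ^ k) / \<sigma> j)\<^sup>2 \<le> 1 / (\<sigma> j)\<^sup>2" using s by (simp add: power_divide divide_right_mono)
  have "(1 - q j ^ k)\<^sup>2 \<le> 1 - q j ^ k" using qk by (simp add: power2_eq_square mult_left_le_one_le)
  also have "\<dots> = (1 - q j) * (\<Sum>i<k. q j ^ i)" by (rule one_diff_power_eq)
  also have "\<dots> \<le> (1 - q j) * (\<Sum>i<k. 1)"
    using q by (intro mult_left_mono sum_mono power_le_one) auto
  also have "\<dots> = real k * (\<sigma> j)\<^sup>2" by (simp add: q_def)
  finally show "((1 - q j ^ k) / \<sigma> j)\<^sup>2 \<le> real k" using s by (simp add: power_divide pos_divide_le_eq)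
qed

text \<open>Bias plus propagated noise.\<close>
lemma error_component:
  assumes "1 \<le> j"
  shows "(1 - q j ^ k) / \<sigma> j * (y j + \<delta> * z j) - \<xi> j = - (q j ^ k * \<xi> j) + \<delta> * ((1 - q j ^ k) / \<sigma> j * z j)"
  using sigma_pos[OF assms] by (simp add: y_def field_simps)

text \<open>The discrepancy principle fails one step before stopping, so the damped signal dominates \<open>m \<delta>\<^sup>2\<close>.
  Multiplied by the number of steps, the damped signal is bounded by \<open>G\<close>, the squared coefficients of
  the exact solution damped by \<open>q\<^sub>j\<^sup>l\<close>, which tends to \<open>0\<close>. Bias and propagated noise are bounded by
  multiples of \<open>G\<close>.\<close>
lemma error_small_if_both_large:
  assumes "\<eta> > 0"
  shows "\<exists>K1 M1. \<forall>\<delta>>0. \<forall>m\<ge>M1. K1 \<le> k_stop \<delta> m \<longrightarrow> sq_error \<delta> m (k_stop \<delta> m) \<le> \<eta>"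
proof -
  \<comment> \<open>The constant in \<open>m \<delta>\<^sup>2 \<le> C \<cdot> signal\<close>: the quotient of \<open>\<tau> / (\<tau> - 1)\<close> and the gap \<open>\<tau> (\<tau> - 1) / 2\<close>.\<close>
  define C where "C = 2 / (\<tau> - 1)\<^sup>2"
  have C: "C > 0" using tau_gt_1 by (simp add: C_def)
  define \<eta>' where "\<eta>' = \<eta> / (3 + 4 * C)"
  have \<eta>': "\<eta>' > 0" using assms C by (simp add: \<eta>'_def)
  obtain K where K: "\<And>k m. k \<ge> K \<Longrightarrow> (\<Sum>j=1..m. q j ^ k * (\<xi> j)\<^sup>2) \<le> \<eta>'"
    using damped_source_small[OF \<eta>'] by blast
  obtain J where J: "\<And>m. m \<ge> J \<Longrightarrow> X - (\<Sum>j=1..m. (\<xi> j)\<^sup>2) \<le> \<eta>'" using tail_small[OF \<eta>'] by blast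
  obtain P1 where P1: "\<And>p. p \<ge> P1 \<Longrightarrow> (\<Sum>j=1..p. (z j)\<^sup>2) \<le> (1 + \<tau>) / 2 * real p"
    using noise_upper[of "(1 + \<tau>) / 2"] tau_gt_1 by auto
  obtain P2 where P2: "\<And>p. p \<ge> P2 \<Longrightarrow> (\<Sum>j=1..p. (z j)\<^sup>2) \<le> 2 * real p" using noise_upper[of 2] by auto
  have "sq_error \<delta> m (k_stop \<delta> m) \<le> \<eta>"
    if \<delta>: "\<delta> > 0" and m: "m \<ge> max J (max P1 P2)" and kK: "k_stop \<delta> m \<ge> K + 2" for \<delta> m
  proof -
    define l where "l = k_stop \<delta> m - 1"
    have l: "k_stop \<delta> m = Suc l" "l \<ge> K" "1 \<le> l" "l < k_stop \<delta> m" using kK by (auto simp: l_def)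
    define G where "G = (\<Sum>j=1..m. q j ^ l * (\<xi> j)\<^sup>2)"
    have G: "G \<le> \<eta>'" unfolding G_def by (rule K[OF l(2)])
    have "\<tau>\<^sup>2 * real m * \<delta>\<^sup>2 < sq_res \<delta> m l" by (rule k_stop_props(3)[OF \<delta> l(3,4)])
    also have "\<dots> \<le> \<tau> / (\<tau> - 1) * (\<Sum>j=1..m. (q j ^ l * y j)\<^sup>2) + \<tau> * ((1 + \<tau>) / 2) * (real m * \<delta>\<^sup>2)"
      using P1 m by (intro sq_res_upper_bound) auto
    finally have "(\<tau>\<^sup>2 - \<tau> * ((1 + \<tau>) / 2)) * (real m * \<delta>\<^sup>2) \<le> \<tau> / (\<tau> - 1) * (\<Sum>j=1..m. (q j ^ l * y j)\<^sup>2)"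
      by (simp add: algebra_simps)
    moreover have "\<tau>\<^sup>2 - \<tau> * ((1 + \<tau>) / 2) = \<tau> / (\<tau> - 1) / C"
      using tau_gt_1 by (simp add: C_def field_simps power2_eq_square)
    ultimately have "\<tau> / (\<tau> - 1) * (real m * \<delta>\<^sup>2 / C) \<le> \<tau> / (\<tau> - 1) * (\<Sum>j=1..m. (q j ^ l * y j)\<^sup>2)"
      by simp
    then have "real m * \<delta>\<^sup>2 / C \<le> (\<Sum>j=1..m. (q j ^ l * y j)\<^sup>2)"
      by (rule mult_left_le_imp_le) (use tau_gt_1 in simp)
    then have "real m * \<delta>\<^sup>2 \<le> C * (\<Sum>j=1..m. (q j ^ l * y j)\<^sup>2)" using C by (simp add: field_simps)
    then have "real (Suc l) * (real m * \<delta>\<^sup>2) \<le> real (Suc l) * (C * (\<Sum>j=1..m. (q j ^ l * y j)\<^sup>2))"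
      by (intro mult_left_mono) auto
    also have "\<dots> = C * (\<Sum>j=1..m. real (Suc l) * (q j ^ l * y j)\<^sup>2)" by (simp add: sum_distrib_left mult_ac)
    also have "\<dots> \<le> C * G"
      unfolding G_def
    proof (intro mult_left_mono sum_mono)
      fix j assume "j \<in> {1..m}"
      then have q: "0 \<le> q j" "q j \<le> 1" using q_bounds[of j] by auto
      have "real (Suc l) * (q j ^ l * y j)\<^sup>2 = (real (Suc l) * q j ^ l * (1 - q j)) * (q j ^ l * (\<xi> j)\<^sup>2)"
        by (simp add: y_def q_def power_mult_distrib power2_eq_square mult_ac)
      also have "\<dots> \<le> 1 * (q j ^ l * (\<xi> j)\<^sup>2)"
        using q by (intro mult_right_mono power_times_gap_le_1) auto
      finally show "real (Suc l) * (q j ^ l * y j)\<^sup>2 \<le> q j ^ l * (\<xi> j)\<^sup>2" by simp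
    qed (use C in simp)
    finally have kmd: "real (Suc l) * (real m * \<delta>\<^sup>2) \<le> C * G" .
    have "(\<Sum>j=1..m. ((1 - q j ^ Suc l) / \<sigma> j * (y j + \<delta> * z j) - \<xi> j)\<^sup>2)
        \<le> (\<Sum>j=1..m. 2 * (q j ^ l * (\<xi> j)\<^sup>2) + 2 * \<delta>\<^sup>2 * (real (Suc l) * (z j)\<^sup>2))"
    proof (rule sum_mono)
      fix j assume "j \<in> {1..m}"
      then have j: "1 \<le> j" by simp
      then have q: "0 \<le> q j" "q j \<le> 1" using q_bounds[of j] by auto
      define w where "w = (1 - q j ^ Suc l) / \<sigma> j"
      have "((1 - q j ^ Suc l) / \<sigma> j * (y j + \<delta> * z j) - \<xi> j)\<^sup>2 = (- (q j ^ Suc l * \<xi> j) + \<delta> * (w * z j))\<^sup>2"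
        unfolding error_component[OF j] w_def ..
      also have "\<dots> \<le> 2 * (q j ^ Suc l * \<xi> j)\<^sup>2 + 2 * (\<delta> * (w * z j))\<^sup>2"
        using square_add_le[of 1 "- (q j ^ Suc l * \<xi> j)" "\<delta> * (w * z j)"] by simp
      also have "(q j ^ Suc l * \<xi> j)\<^sup>2 \<le> q j ^ l * (\<xi> j)\<^sup>2"
      proof -
        have "(q j ^ Suc l)\<^sup>2 = q j ^ (2 * Suc l)" by (simp only: power_mult[symmetric] mult.commute)
        also have "\<dots> \<le> q j ^ l" using q by (intro power_decreasing) auto
        finally show ?thesis unfolding power_mult_distrib by (intro mult_right_mono) auto
      qed
      also have "(\<delta> * (w * z j))\<^sup>2 \<le> \<delta>\<^sup>2 * (real (Suc l) * (z j)\<^sup>2)"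
        unfolding power_mult_distrib w_def using filter_square_le(1)[OF j, of "Suc l"]
        by (intro mult_left_mono mult_right_mono) auto
      finally show "((1 - q j ^ Suc l) / \<sigma> j * (y j + \<delta> * z j) - \<xi> j)\<^sup>2
          \<le> 2 * (q j ^ l * (\<xi> j)\<^sup>2) + 2 * \<delta>\<^sup>2 * (real (Suc l) * (z j)\<^sup>2)" by simp
    qed
    also have "\<dots> = 2 * G + 2 * \<delta>\<^sup>2 * real (Suc l) * (\<Sum>j=1..m. (z j)\<^sup>2)"
      by (simp add: G_def sum.distrib sum_distrib_left mult_ac)
    also have "2 * \<delta>\<^sup>2 * real (Suc l) * (\<Sum>j=1..m. (z j)\<^sup>2) \<le> 2 * \<delta>\<^sup>2 * real (Suc l) * (2 * real m)"
      using P2[of m] m by (intro mult_left_mono) auto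
    also have "\<dots> = 4 * (real (Suc l) * (real m * \<delta>\<^sup>2))" by (simp add: mult_ac)
    also have "\<dots> \<le> 4 * (C * G)" using kmd by simp
    finally have "sq_error \<delta> m (k_stop \<delta> m) \<le> 2 * G + 4 * (C * G) + \<eta>'"
      unfolding sq_error_def l(1) using J[of m] m by simp
    also have "\<dots> \<le> 2 * \<eta>' + 4 * (C * \<eta>') + \<eta>'"
      using G C by (intro add_mono mult_left_mono) auto
    also have "\<dots> = \<eta>' * (3 + 4 * C)" by (simp add: algebra_simps)
    also have "\<dots> = \<eta>" using C by (simp add: \<eta>'_def)
    finally show ?thesis .
  qed
  then show ?thesis by blast
qed

text \<open>If some \<open>q\<^sub>j y\<^sub>j\<close> is nonzero, stopping index and level of the selection both become large. If all \<open>q\<^sub>j y\<^sub>j\<close> vanish, then after one step the squared residual is exactly \<open>\<delta>\<^sup>2\<close> times its value for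
  \<open>\<delta> = 1\<close>, so that stopping indices and acceptance do not depend on \<open>\<delta>\<close>.\<close>
lemma selected_error_small:
  assumes \<eta>: "\<eta> > 0"
  shows "\<forall>\<^sub>F \<delta> in at_right 0. \<forall>m. selected \<delta> m \<longrightarrow> sq_error \<delta> m (k_stop \<delta> m) \<le> \<eta>"
proof (cases "\<exists>j\<ge>1. q j * y j \<noteq> 0")
  case True
  then obtain j where j: "1 \<le> j" "q j * y j \<noteq> 0" by blast
  obtain K1 M1 where KM: "\<And>\<delta> m. \<delta> > 0 \<Longrightarrow> m \<ge> M1 \<Longrightarrow> K1 \<le> k_stop \<delta> m \<Longrightarrow> sq_error \<delta> m (k_stop \<delta> m) \<le> \<eta>"
    using error_small_if_both_large[OF \<eta>] by blast
  obtain K2 where K2: "\<And>\<delta> m. \<delta> > 0 \<Longrightarrow> m \<le> M1 \<Longrightarrow> accepted \<delta> m \<Longrightarrow> k_stop \<delta> m < K2"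
    using accepted_k_stop_bounded[of M1] by blast
  show ?thesis using selected_k_stop_large[OF j, of "max K1 K2"] eventually_at_right_less[of 0]
  proof eventually_elim
    case (elim \<delta>)
    show ?case
    proof (intro allI impI)
      fix m assume sel: "selected \<delta> m"
      then have k: "max K1 K2 < k_stop \<delta> m" using elim by blast
      have "M1 \<le> m"
      proof (rule ccontr)
        assume "\<not> M1 \<le> m"
        then have "k_stop \<delta> m < K2" using K2[OF elim(2)] sel by (auto simp: selected_def)
        with k show False by simp
      qed
      then show "sq_error \<delta> m (k_stop \<delta> m) \<le> \<eta>" using KM[OF elim(2)] k by simp
    qed
  qed
next
  case False
  then have deg: "q j * y j = 0" if "1 \<le> j" for j using that by blast
  have degk: "q j ^ k * y j = 0" if "1 \<le> j" "1 \<le> k" for j k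
    using deg[OF that(1)] that(2) by (cases "y j = 0") (auto simp: power_0_left)
  have sq_res_scale: "sq_res \<delta> m k = \<delta>\<^sup>2 * sq_res 1 m k" if "1 \<le> k" for \<delta> m k
    unfolding sq_res_def sum_distrib_left
  proof (rule sum.cong[OF refl])
    fix j assume "j \<in> {1..m}"
    then have "q j ^ k * y j = 0" using degk[of j k] that by (metis atLeastAtMost_iff)
    then show "(q j ^ k * (y j + \<delta> * z j))\<^sup>2 = \<delta>\<^sup>2 * (q j ^ k * (y j + 1 * z j))\<^sup>2"
      unfolding distrib_left by (simp only:) (simp add: power_mult_distrib)
  qed
  have k_stop_eq: "k_stop \<delta> m = k_stop 1 m" if "\<delta> > 0" for \<delta> m
  proof -
    have "(1 \<le> k \<and> sq_res \<delta> m k \<le> \<tau>\<^sup>2 * real m * \<delta>\<^sup>2) \<longleftrightarrow> (1 \<le> k \<and> sq_res 1 m k \<le> \<tau>\<^sup>2 * real m * 1\<^sup>2)" for k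
      using sq_res_scale[of k \<delta> m] that by (auto simp: mult.commute)
    then show ?thesis unfolding k_stop_def by simp
  qed
  have accepted_eq: "accepted \<delta> m \<longleftrightarrow> accepted 1 m" if "\<delta> > 0" for \<delta> m
    using k_stop_props(1)[of 1 m] that unfolding accepted_def k_stop_eq[OF that]
    by (simp add: sq_res_scale[of _ \<delta>] zero_less_mult_iff mult.left_commute[of "threshold\<^sup>2"])
  obtain M0' where M0': "\<And>m. m \<ge> M0' \<Longrightarrow> k_stop 1 m = 1 \<and> accepted 1 m" using eventually_stops_at_first_step[of 1] by auto
  define M0 where "M0 = max 1 M0'"
  have M0: "k_stop 1 m = 1" "accepted 1 m" if "m \<ge> M0" for m using M0'[of m] that by (auto simp: M0_def)
  define B where "B = (\<Sum>j=1..M0. (z j)\<^sup>2 / (\<sigma> j)\<^sup>2)"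
  have "((\<lambda>\<delta>. \<delta>\<^sup>2 * B) \<longlongrightarrow> 0\<^sup>2 * B) (at_right 0)" by (intro tendsto_intros)
  then have "\<forall>\<^sub>F \<delta> in at_right 0. \<delta>\<^sup>2 * B < \<eta>" by (rule order_tendstoD) (use \<eta> in simp)
  then show ?thesis using eventually_at_right_less[of 0]
  proof eventually_elim
    case (elim \<delta>)
    show ?case
    proof (intro allI impI)
      fix m assume "selected \<delta> m"
      then obtain p where accepted: "accepted \<delta> m" and p: "is_next_record (k_stop \<delta>) p m" "p = 0 \<or> \<not> accepted \<delta> p"
        by (auto simp: selected_def)
      define k where "k = k_stop \<delta> m"
      have k: "1 \<le> k" unfolding k_def by (rule k_stop_props(1)[OF elim(2)])
      have pM: "p < M0"
      proof (cases "p = 0")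
        case False
        then have "\<not> accepted 1 p" using p(2) accepted_eq[OF elim(2)] by simp
        then show ?thesis using M0(2)[of p] by (meson leI)
      qed (simp add: M0_def)
      have mM: "m \<le> M0"
      proof (rule ccontr)
        assume "\<not> m \<le> M0"
        then have "k_stop \<delta> M0 < k_stop \<delta> m" using p(1) pM by (simp add: is_next_record_def)
        then show False using M0(1)[of m] M0(1)[of M0] \<open>\<not> m \<le> M0\<close> by (simp add: k_stop_eq[OF elim(2)])
      qed
      have m1: "1 \<le> m" using p(1) by (simp add: is_next_record_def)
      \<comment> \<open>Otherwise all components up to \<open>m\<close> are annihilated in one step and the ratio is \<open>0 / 0\<close>.\<close>
      have "q m \<noteq> 0"
      proof
        assume "q m = 0"
        then have "q j = 0" if "j \<in> {1..m}" for j using that q_mono[of j m] q_bounds[of j] by auto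
        then have "sq_res \<delta> m k = 0" unfolding sq_res_def using k by (intro sum.neutral) (auto simp: power_0_left)
        with accepted show False by (simp add: accepted_def k_def)
      qed
      then have qm: "q m > 0" using q_bounds[of m] m1 by simp
      \<comment> \<open>The signal lives on components with \<open>q j = 0\<close>, and these come first.\<close>
      have xi0: "\<xi> j = 0" if "j > m" for j
      proof -
        have "q j > 0" using q_mono[of m j] that qm m1 by simp
        then have "y j = 0" using deg[of j] that m1 by simp
        then show ?thesis using sigma_pos[of j] that by (simp add: y_def)
      qed
      have "(\<Sum>j=1..n. (\<xi> j)\<^sup>2) = (\<Sum>j=1..m. (\<xi> j)\<^sup>2)" if "n \<ge> m" for n
        using that xi0 by (intro sum.mono_neutral_right) auto
      then have "(\<lambda>n. \<Sum>j=1..n. (\<xi> j)\<^sup>2) \<longlonglongrightarrow> (\<Sum>j=1..m. (\<xi> j)\<^sup>2)"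
        by (intro tendsto_eventually eventually_sequentiallyI[of m])
      then have tail: "X = (\<Sum>j=1..m. (\<xi> j)\<^sup>2)" using parseval LIMSEQ_unique by blast
      have "(\<Sum>j=1..m. ((1 - q j ^ k) / \<sigma> j * (y j + \<delta> * z j) - \<xi> j)\<^sup>2) \<le> (\<Sum>j=1..m. \<delta>\<^sup>2 * ((z j)\<^sup>2 / (\<sigma> j)\<^sup>2))"
      proof (rule sum_mono)
        fix j assume "j \<in> {1..m}"
        then have j: "1 \<le> j" by simp
        have no_bias: "q j ^ k * \<xi> j = 0" using degk[OF j k] sigma_pos[OF j] by (simp add: y_def)
        then have "((1 - q j ^ k) / \<sigma> j * (y j + \<delta> * z j) - \<xi> j)\<^sup>2 = \<delta>\<^sup>2 * (((1 - q j ^ k) / \<sigma> j)\<^sup>2 * (z j)\<^sup>2)"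
          unfolding error_component[OF j] no_bias by (simp only: minus_zero add_0_left power_mult_distrib)
        also have "\<dots> \<le> \<delta>\<^sup>2 * (1 / (\<sigma> j)\<^sup>2 * (z j)\<^sup>2)"
          using filter_square_le(2)[OF j] by (intro mult_left_mono mult_right_mono) auto
        finally show "((1 - q j ^ k) / \<sigma> j * (y j + \<delta> * z j) - \<xi> j)\<^sup>2 \<le> \<delta>\<^sup>2 * ((z j)\<^sup>2 / (\<sigma> j)\<^sup>2)" by simp
      qed
      also have "\<dots> = \<delta>\<^sup>2 * (\<Sum>j=1..m. (z j)\<^sup>2 / (\<sigma> j)\<^sup>2)" by (rule sum_distrib_left[symmetric])
      also have "\<dots> \<le> \<delta>\<^sup>2 * B" unfolding B_def using mM by (intro mult_left_mono sum_mono2) auto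
      finally show "sq_error \<delta> m (k_stop \<delta> m) \<le> \<eta>"
        unfolding sq_error_def k_def[symmetric] tail[symmetric] using elim(1) by simp
    qed
  qed
qed

end

text \<open>Translation of the deterministic result: in the singular basis, residuals, stopping indices,
  acceptance and error become those of \<^locale>\<open>spectral_data\<close>.\<close>
lemma pathwise_convergence:
  fixes K :: "'x::{real_inner,complete_space} \<Rightarrow> 'y::{real_inner,complete_space}"
    and Z :: "'y \<Rightarrow> 'w \<Rightarrow> real"
  assumes cK: "compact_operator K" and nK: "onorm K \<le> 1"
    and svd: "singular_value_decomposition K \<sigma> v u"
    and y0: "y\<^sub>0 \<in> range K" and x0: "x\<^sub>0 = moore_penrose K y\<^sub>0"
    and tau: "\<tau> > 1" and eps: "\<epsilon> > 0"
    and noise: "(\<lambda>m. (\<Sum>j=1..m. (Z (u j) \<omega>)\<^sup>2) / real m) \<longlonglongrightarrow> 1"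
  shows "\<forall>\<^sub>F \<delta> in at_right 0. \<exists>x. modified_dp_output K u \<tau> \<delta> (noisy_data y\<^sub>0 \<delta> Z \<omega>) = Some x \<and> norm (x - x\<^sub>0) \<le> \<epsilon>"
proof -
  have bl: "bounded_linear K" using cK by (simp add: compact_operator_def)
  have x0N: "x\<^sub>0 \<in> orthogonal_comp (null_space K)" and Kx0: "K x\<^sub>0 = y\<^sub>0"
    unfolding x0 by (rule moore_penrose_in_range[OF bl svd y0])+
  define \<xi> where "\<xi> j = v j \<bullet> x\<^sub>0" for j
  have xi: "v j \<bullet> x\<^sub>0 = \<xi> j" for j by (simp add: \<xi>_def)
  define z where "z j = Z (u j) \<omega>" for j
  interpret sd: spectral_data \<sigma> \<xi> z "(norm x\<^sub>0)\<^sup>2" \<tau>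
  proof
    show "0 < \<sigma> j" if "1 \<le> j" for j using svd_sigma_pos[OF bl svd that] .
    show "\<sigma> j \<le> 1" if "1 \<le> j" for j using svd_sigma_le_1[OF bl svd nK that] .
    show "\<sigma> j \<le> \<sigma> i" if "1 \<le> i" "i \<le> j" for i j using svd_sigma_antimono[OF bl svd that] .
    show "\<sigma> \<longlonglongrightarrow> 0" by (rule singular_values_tendsto_0[OF bl svd cK])
    show "(\<lambda>m. \<Sum>j=1..m. (\<xi> j)\<^sup>2) \<longlonglongrightarrow> (norm x\<^sub>0)\<^sup>2"
      unfolding \<xi>_def by (rule parseval_tendsto[OF bl svd x0N])
    show "(\<lambda>m. (\<Sum>j=1..m. (z j)\<^sup>2) / real m) \<longlonglongrightarrow> 1" using noise by (simp add: z_def)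
  qed (rule tau)
  define d where "d \<delta> = noisy_data y\<^sub>0 \<delta> Z \<omega>" for \<delta>
  have d: "d \<delta> (u j) = sd.y j + \<delta> * z j" if "1 \<le> j" for \<delta> j
    using svd_coefficient[OF bl svd that, of x\<^sub>0]
    by (simp add: d_def noisy_data_def sd.y_def \<xi>_def z_def Kx0 inner_commute)
  have res: "(residual K u (d \<delta>) m k)\<^sup>2 = sd.sq_res \<delta> m k" for \<delta> m k
    unfolding residual_spectral[OF bl svd] sd.sq_res_def sd.q_def by (intro sum.cong) (auto simp: d)
  have res0: "0 \<le> residual K u (d \<delta>) m k" for \<delta> m k by (simp add: residual_def)
  have err: "(norm (landweber K u (d \<delta>) m k - x\<^sub>0))\<^sup>2 = sd.sq_error \<delta> m k" for \<delta> m k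
    unfolding landweber_error_spectral[OF bl svd x0N] sd.sq_error_def sd.q_def xi
    by (intro arg_cong2[of _ _ _ _ "(+)"] sum.cong refl) (simp add: d)
  have k_dp_eq: "k_dp K u \<tau> \<delta> (d \<delta>) = sd.k_stop \<delta>" if "\<delta> > 0" for \<delta>
  proof
    fix m
    have "residual K u (d \<delta>) m k \<le> \<tau> * sqrt (real m) * \<delta> \<longleftrightarrow> sd.sq_res \<delta> m k \<le> \<tau>\<^sup>2 * real m * \<delta>\<^sup>2" for k
    proof -
      have "0 \<le> \<tau> * sqrt (real m) * \<delta>" using tau that by simp
      then have "residual K u (d \<delta>) m k \<le> \<tau> * sqrt (real m) * \<delta> \<longleftrightarrow>
          (residual K u (d \<delta>) m k)\<^sup>2 \<le> (\<tau> * sqrt (real m) * \<delta>)\<^sup>2"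
        using res0 by (simp add: power2_le_iff_abs_le)
      then show ?thesis unfolding res by (simp add: power_mult_distrib)
    qed
    then show "k_dp K u \<tau> \<delta> (d \<delta>) m = sd.k_stop \<delta> m" by (simp add: k_dp_def sd.k_stop_def)
  qed
  have ratio: "1 / (2 * \<tau> * exp 4) \<le> ratio K u \<tau> \<delta> (d \<delta>) m \<longleftrightarrow> sd.accepted \<delta> m" if "\<delta> > 0" for \<delta> m
  proof -
    define r1 r2 where "r1 = residual K u (d \<delta>) m (sd.k_stop \<delta> m)" and "r2 = residual K u (d \<delta>) m (2 * sd.k_stop \<delta> m)"
    have r: "0 \<le> r1" "0 \<le> r2" using res0 by (auto simp: r1_def r2_def)
    have c: "0 < sd.threshold" by (rule sd.threshold_bounds)
    have "sd.threshold \<le> r2 / r1 \<longleftrightarrow> 0 < r1 \<and> sd.threshold * r1 \<le> r2"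
      using r c by (cases "r1 = 0") (auto simp: pos_le_divide_eq)
    also have "\<dots> \<longleftrightarrow> 0 < r1\<^sup>2 \<and> (sd.threshold * r1)\<^sup>2 \<le> r2\<^sup>2"
      using r c by (auto simp: power2_le_iff_abs_le)
    also have "\<dots> \<longleftrightarrow> sd.accepted \<delta> m"
      unfolding power_mult_distrib r1_def r2_def res sd.accepted_def ..
    finally show ?thesis
      by (simp add: ratio_def k_dp_eq[OF that] sd.threshold_def r1_def r2_def)
  qed
  have eps2: "0 < \<epsilon>\<^sup>2" using eps by simp
  show ?thesis using sd.selected_error_small[OF eps2] eventually_at_right_less[of 0]
  proof eventually_elim
    case (elim \<delta>)
    have small: "sd.selected \<delta> m \<Longrightarrow> sd.sq_error \<delta> m (sd.k_stop \<delta> m) \<le> \<epsilon>\<^sup>2" for m using elim(1) by simp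
    obtain M0 where "\<And>m. m \<ge> M0 \<Longrightarrow> sd.k_stop \<delta> m = 1 \<and> sd.accepted \<delta> m"
      using sd.eventually_stops_at_first_step[OF elim(2)] by blast
    from first_accepted_index[of M0 "sd.k_stop \<delta>" "sd.accepted \<delta>", OF this] obtain n m p where
      n: "least_option (\<lambda>n. 1 \<le> n \<and> (\<exists>m. m_seq (sd.k_stop \<delta>) n = Some m \<and> sd.accepted \<delta> m)) = Some n"
      and m: "m_seq (sd.k_stop \<delta>) n = Some m" "sd.accepted \<delta> m" "is_next_record (sd.k_stop \<delta>) p m" "p = 0 \<or> \<not> sd.accepted \<delta> p"
      by blast
    have "n_stop K u \<tau> \<delta> (d \<delta>) = Some n"
      unfolding n_stop_def k_dp_eq[OF elim(2)] ratio[OF elim(2)] by (rule n)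
    then have "modified_dp_output K u \<tau> \<delta> (d \<delta>) = Some (landweber K u (d \<delta>) m (sd.k_stop \<delta> m))"
      by (simp add: modified_dp_output_def m_dp_def k_dp_eq[OF elim(2)] m)
    moreover have "sd.selected \<delta> m" unfolding sd.selected_def using m by blast
    then have "(norm (landweber K u (d \<delta>) m (sd.k_stop \<delta> m) - x\<^sub>0))\<^sup>2 \<le> \<epsilon>\<^sup>2"
      unfolding err by (rule small)
    then have "norm (landweber K u (d \<delta>) m (sd.k_stop \<delta> m) - x\<^sub>0) \<le> \<epsilon>"
      by (rule power2_le_imp_le) (use eps in simp)
    ultimately show ?case by (simp add: d_def)
  qed
qed

section \<open>From paths to probabilities\<close>

lemma pred_least_option_eq_Some:
  assumes [measurable]: "\<And>n. Measurable.pred M (\<lambda>\<omega>. P \<omega> n)"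
  shows "Measurable.pred M (\<lambda>\<omega>. least_option (P \<omega>) = Some n)"
  unfolding least_option_eq_Some_iff by measurable

text \<open>In the form with inequalities the recursion involves only countable quantifiers.\<close>
lemma pred_m_seq_eq_Some:
  fixes k :: "'w \<Rightarrow> nat \<Rightarrow> nat"
  assumes k: "\<And>m. (\<lambda>\<omega>. k \<omega> m) \<in> measurable M (count_space UNIV)"
  shows "Measurable.pred M (\<lambda>\<omega>. m_seq (k \<omega>) n = Some m)"
proof (induction n arbitrary: m)
  case (Suc n)
  have rel: "Measurable.pred M (\<lambda>\<omega>. R (k \<omega> i) (k \<omega> j))" for R i j
    by (rule measurable_compose_countable[where f = "\<lambda>a \<omega>. R a (k \<omega> j)", OF measurable_compose[OF k] k]) simp
  show ?case
    unfolding m_seq_Suc_eq_Some_iff is_next_record_def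
    by (intro pred_intros_countable pred_intros_logic Suc rel)
qed simp

text \<open>The solution space need not be separable, so measurability is not obtained from an \<open>X\<close>-valued
  random variable. Instead the event is written with countably many integer parameters and finite
  sums over the coordinates of the data.\<close>
lemma sets_output_near:
  fixes K :: "'x::{real_inner,complete_space} \<Rightarrow> 'y::{real_inner,complete_space}"
    and Z :: "'y \<Rightarrow> 'w \<Rightarrow> real"
  assumes bl: "bounded_linear K" and svd: "singular_value_decomposition K \<sigma> v u"
    and x: "x\<^sub>0 \<in> orthogonal_comp (null_space K)"
    and Z[measurable]: "\<And>y. Z y \<in> borel_measurable M" and eps: "\<epsilon> > 0"
  shows "{\<omega> \<in> space M. \<exists>x. modified_dp_output K u \<tau> \<delta> (noisy_data y\<^sub>0 \<delta> Z \<omega>) = Some x \<and> norm (x - x\<^sub>0) \<le> \<epsilon>} \<in> sets M"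
proof -
  define d where "d = noisy_data y\<^sub>0 \<delta> Z"
  have [measurable]: "(\<lambda>\<omega>. d \<omega> y) \<in> borel_measurable M" for y
    unfolding d_def noisy_data_def by measurable
  have "residual K u (d \<omega>) m k = sqrt (\<Sum>j=1..m. ((1 - (\<sigma> j)\<^sup>2) ^ k * d \<omega> (u j))\<^sup>2)" for \<omega> m k
    unfolding residual_spectral[OF bl svd, symmetric] by (simp add: residual_def)
  then have res[measurable]: "(\<lambda>\<omega>. residual K u (d \<omega>) m k) \<in> borel_measurable M" for m k
    by simp
  have k[measurable]: "(\<lambda>\<omega>. k_dp K u \<tau> \<delta> (d \<omega>) m) \<in> measurable M (count_space UNIV)" for m
    unfolding k_dp_def by measurable
  have seq: "Measurable.pred M (\<lambda>\<omega>. m_seq (k_dp K u \<tau> \<delta> (d \<omega>)) n = Some m)" for n m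
    by (rule pred_m_seq_eq_Some[OF k])
  have ratio[measurable]: "(\<lambda>\<omega>. ratio K u \<tau> \<delta> (d \<omega>) m) \<in> borel_measurable M" for m
    unfolding ratio_def
    by (intro borel_measurable_divide measurable_compose_countable[where f = "\<lambda>i \<omega>. residual K u (d \<omega>) m (2 * i)" and g = "\<lambda>\<omega>. k_dp K u \<tau> \<delta> (d \<omega>) m"]
      measurable_compose_countable[where f = "\<lambda>i \<omega>. residual K u (d \<omega>) m i" and g = "\<lambda>\<omega>. k_dp K u \<tau> \<delta> (d \<omega>) m"] res k)
  have stop: "Measurable.pred M (\<lambda>\<omega>. n_stop K u \<tau> \<delta> (d \<omega>) = Some n)" for n
    unfolding n_stop_def
    by (intro pred_least_option_eq_Some pred_intros_countable pred_intros_logic seq) measurable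
  have near: "norm (landweber K u (d \<omega>) m i - x\<^sub>0) \<le> \<epsilon> \<longleftrightarrow>
    (\<Sum>j=1..m. ((1 - (1 - (\<sigma> j)\<^sup>2) ^ i) / \<sigma> j * d \<omega> (u j) - v j \<bullet> x\<^sub>0)\<^sup>2) + ((norm x\<^sub>0)\<^sup>2 - (\<Sum>j=1..m. (v j \<bullet> x\<^sub>0)\<^sup>2)) \<le> \<epsilon>\<^sup>2" for \<omega> m i
    unfolding landweber_error_spectral[OF bl svd x, symmetric] using eps by (simp add: power2_le_iff_abs_le)
  have "(\<exists>x. modified_dp_output K u \<tau> \<delta> (d \<omega>) = Some x \<and> norm (x - x\<^sub>0) \<le> \<epsilon>) \<longleftrightarrow>
    (\<exists>n m i. n_stop K u \<tau> \<delta> (d \<omega>) = Some n \<and> m_seq (k_dp K u \<tau> \<delta> (d \<omega>)) n = Some m \<and>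
      k_dp K u \<tau> \<delta> (d \<omega>) m = i \<and> norm (landweber K u (d \<omega>) m i - x\<^sub>0) \<le> \<epsilon>)" for \<omega>
    by (auto simp: modified_dp_output_def m_dp_def bind_eq_Some_conv)
  then have "{\<omega> \<in> space M. \<exists>x. modified_dp_output K u \<tau> \<delta> (d \<omega>) = Some x \<and> norm (x - x\<^sub>0) \<le> \<epsilon>} =
    {\<omega> \<in> space M. \<exists>n m i. n_stop K u \<tau> \<delta> (d \<omega>) = Some n \<and> m_seq (k_dp K u \<tau> \<delta> (d \<omega>)) n = Some m \<and>
      k_dp K u \<tau> \<delta> (d \<omega>) m = i \<and> norm (landweber K u (d \<omega>) m i - x\<^sub>0) \<le> \<epsilon>}" by simp
  also have "\<dots> \<in> sets M"
  proof (intro predE pred_intros_countable pred_intros_logic stop seq)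
    show "Measurable.pred M (\<lambda>\<omega>. k_dp K u \<tau> \<delta> (d \<omega>) m = i)" for m i by measurable
    show "Measurable.pred M (\<lambda>\<omega>. norm (landweber K u (d \<omega>) m i - x\<^sub>0) \<le> \<epsilon>)" for m i
      unfolding near by measurable
  qed
  finally show ?thesis by (simp add: d_def)
qed

text \<open>Dominated convergence along sequences of noise levels.\<close>
lemma (in prob_space) prob_tendsto_1_if_AE_eventually:
  fixes E :: "real \<Rightarrow> 'a set"
  assumes sets: "\<And>\<delta>. E \<delta> \<in> events" and ae: "AE \<omega> in M. \<forall>\<^sub>F \<delta> in at_right 0. \<omega> \<in> E \<delta>"
  shows "((\<lambda>\<delta>. prob (E \<delta>)) \<longlongrightarrow> 1) (at_right 0)"
proof (rule tendsto_at_right_sequentially[of _ 1])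
  fix s :: "nat \<Rightarrow> real" assume s: "\<And>n. 0 < s n" "s \<longlonglongrightarrow> 0"
  have fl: "filterlim s (at_right 0) sequentially"
    unfolding filterlim_at using s by (auto simp: less_imp_neq[symmetric])
  have "(\<lambda>n. expectation (indicator (E (s n)) :: 'a \<Rightarrow> real)) \<longlonglongrightarrow> expectation (\<lambda>_. 1)"
  proof (rule integral_dominated_convergence[where w = "\<lambda>_. 1"])
    show "AE \<omega> in M. (\<lambda>n. indicator (E (s n)) \<omega> :: real) \<longlonglongrightarrow> 1"
      using ae
    proof eventually_elim
      case (elim \<omega>)
      then have "\<forall>\<^sub>F n in sequentially. \<omega> \<in> E (s n)" using fl by (rule eventually_compose_filterlim)
      then show ?case by (intro tendsto_eventually) (auto elim: eventually_mono)
    qed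
  qed (use sets in auto)
  then show "(\<lambda>n. prob (E (s n))) \<longlonglongrightarrow> 1" using sets by (simp add: prob_space)
qed simp

text \<open>The vectors \<open>u j\<close> have equal norm, so the scaling property makes the coordinates identically
  distributed, and their second moment is \<open>u 1 \<bullet> u 1 = 1\<close>.\<close>
lemma white_noise_mean_square:
  fixes u :: "nat \<Rightarrow> 'y::real_inner" and Z :: "'y \<Rightarrow> 'w \<Rightarrow> real"
  assumes "prob_space M" and wn: "white_noise M Z" and on: "orthonormal_sequence u"
    and indep: "prob_space.indep_vars M (\<lambda>_. borel) (\<lambda>j. Z (u j)) {1..}"
  shows "AE \<omega> in M. (\<lambda>m. (\<Sum>j=1..m. (Z (u j) \<omega>)\<^sup>2) / real m) \<longlonglongrightarrow> 1"
proof -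
  interpret prob_space M by fact
  have [measurable]: "Z y \<in> borel_measurable M" for y using wn by (simp add: white_noise_def)
  have norm1: "norm (u j) = 1" if "j \<ge> 1" for j
    using on that by (auto simp: orthonormal_sequence_def norm_eq_1)
  have dist: "distr M borel (Z (u j)) = distr M borel (Z (u 1))" if "j \<ge> 1" for j
  proof -
    have "u 1 \<noteq> 0" using norm1[of 1] by auto
    then have "distr M borel (Z (u j)) = distr M borel (\<lambda>\<omega>. norm (u j) / norm (u 1) * Z (u 1) \<omega>)"
      using wn unfolding white_noise_def by blast
    then show ?thesis using norm1[OF that] norm1[of 1] by simp
  qed
  have "AE \<omega> in M. (\<lambda>m. (\<Sum>j=1..m. (Z (u j) \<omega>)\<^sup>2) / real m) \<longlonglongrightarrow> expectation (\<lambda>\<omega>. (Z (u 1) \<omega>)\<^sup>2)"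
  proof (rule strong_law_of_large_numbers_nonneg[of "\<lambda>j \<omega>. (Z (u j) \<omega>)\<^sup>2"])
    show "indep_vars (\<lambda>_. borel) (\<lambda>j \<omega>. (Z (u j) \<omega>)\<^sup>2) {1..}"
      by (rule indep_vars_compose2[OF indep]) auto
    show "distr M borel (\<lambda>\<omega>. (Z (u j) \<omega>)\<^sup>2) = distr M borel (\<lambda>\<omega>. (Z (u 1) \<omega>)\<^sup>2)" if "j \<ge> 1" for j
    proof -
      have "distr M borel (\<lambda>\<omega>. (Z (u i) \<omega>)\<^sup>2) = distr (distr M borel (Z (u i))) borel (\<lambda>x. x\<^sup>2)" for i
        by (subst distr_distr) (auto simp: comp_def)
      then show ?thesis using dist[OF that] by simp
    qed
    show "integrable M (\<lambda>\<omega>. (Z (u 1) \<omega>)\<^sup>2)" using wn by (simp add: white_noise_def)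
  qed simp
  moreover have "expectation (\<lambda>\<omega>. (Z (u 1) \<omega>)\<^sup>2) = u 1 \<bullet> u 1"
    using wn unfolding white_noise_def by (simp add: power2_eq_square)
  ultimately show ?thesis using on by (simp add: orthonormal_sequence_def)
qed

theorem corollary1p1:
  fixes K :: "'x::{real_inner,complete_space} \<Rightarrow> 'y::{real_inner,complete_space}"
    and \<sigma> :: "nat \<Rightarrow> real" and v :: "nat \<Rightarrow> 'x" and u :: "nat \<Rightarrow> 'y"
    and x\<^sub>0 :: 'x and y\<^sub>0 :: 'y and \<tau> \<epsilon> :: real
    and M :: "'w measure" and Z :: "'y \<Rightarrow> 'w \<Rightarrow> real"
  assumes "infinite_dimensional TYPE('x)" and "infinite_dimensional TYPE('y)"
    and "compact_operator K" and "closure (range K) = UNIV" and "onorm K \<le> 1"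
    and "singular_value_decomposition K \<sigma> v u"
    and "y\<^sub>0 \<in> range K" and "x\<^sub>0 = moore_penrose K y\<^sub>0"
    and "\<tau> > 1"
    and "prob_space M" and "white_noise M Z"
    and "prob_space.indep_vars M (\<lambda>_. borel) (\<lambda>j. Z (u j)) {1..}"
    and "\<epsilon> > 0"
  shows "((\<lambda>\<delta>. measure M {\<omega> \<in> space M.
            \<exists>x. modified_dp_output K u \<tau> \<delta> (noisy_data y\<^sub>0 \<delta> Z \<omega>) = Some x \<and> norm (x - x\<^sub>0) \<le> \<epsilon>})
          \<longlongrightarrow> 1) (at_right 0)"
proof -
  interpret prob_space M by fact
  have bl: "bounded_linear K" using assms(3) by (simp add: compact_operator_def)
  note svd = assms(6)
  show ?thesis
  proof (rule prob_tendsto_1_if_AE_eventually)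
    show "{\<omega> \<in> space M. \<exists>x. modified_dp_output K u \<tau> \<delta> (noisy_data y\<^sub>0 \<delta> Z \<omega>) = Some x \<and> norm (x - x\<^sub>0) \<le> \<epsilon>} \<in> events" for \<delta>
      using moore_penrose_in_range(1)[OF bl svd assms(7)] assms(8,11,13)
      by (intro sets_output_near[OF bl svd]) (auto simp: white_noise_def)
    have "AE \<omega> in M. (\<lambda>m. (\<Sum>j=1..m. (Z (u j) \<omega>)\<^sup>2) / real m) \<longlonglongrightarrow> 1"
      using svd_orthonormal(2)[OF bl svd] by (rule white_noise_mean_square[OF assms(10,11) _ assms(12)])
    then show "AE \<omega> in M. \<forall>\<^sub>F \<delta> in at_right 0. \<omega> \<in> {\<omega> \<in> space M.
        \<exists>x. modified_dp_output K u \<tau> \<delta> (noisy_data y\<^sub>0 \<delta> Z \<omega>) = Some x \<and> norm (x - x\<^sub>0) \<le> \<epsilon>}"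
      using AE_space
    proof eventually_elim
      case (elim \<omega>)
      from pathwise_convergence[where Z = Z and \<omega> = \<omega>, OF assms(3,5) svd assms(7,8,9,13) elim(1)] elim(2) show ?case by simp
    qed
  qed
qed

end
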